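(* Let $q\in L_1[0,1]$ be complex-valued with $\int_0^1 q(x)\,dx=0$, let $\beta\in\mathbb{C}$, $\beta\neq\pm1$, and let $T_2$ be the operator in $L_2[0,1]$ generated by $-y''+q(x)y$ and the boundary conditions $y'(0)+\beta y'(1)=0$, $y(0)+y(1)=0$. Put $s_k=\int_0^1 q(x)\sin 2\pi kx\,dx$ and $\gamma_2=\dfrac{8\pi(\beta-1)}{\beta+1}$. If $$\lim_{n\to\infty}\frac{\ln|n|}{n\,s_{2n+1}}=0,$$ then the large eigenvalues $\lambda_{n,j,2}$ of $T_2$ are simple and satisfy the asymptotic formulas $$\lambda_{n,j,2}=((2n+1)\pi)^2+(-1)^j\frac{\sqrt{2\gamma_2}}{2}\sqrt{(2n+1)s_{2n+1}}\,(1+o(1))$$ for $j=1,2$. The normalized eigenfunctions $\Psi_{n,j,2}$ corresponding to $\lambda_{n,j,2}$ obey (up to multiplication by a constant of modulus one) $$\Psi_{n,j,2}(x)=\sqrt{2}\cos (2n+1)\pi x+O(n^{-1/2}).$$ Moreover, if there exists a sequence $\{n_k\}$ of positive integers with $n_k\to\infty$ such that $\lim_{k\to\infty}\dfrac{\ln|n_k|}{n_k\,s_{2n_k+1}}=0$, then the root functions of $T_2$ do not form a Riesz basis in $L_2[0,1]$.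
   Context: The eigenvalues of $T_2$ consist of two sequences $\{\lambda_{n,1,2}\},\{\lambda_{n,2,2}\}$ (counted with algebraic multiplicity) with $\lambda_{n,j,2}=(2n\pi+\pi)^2+O(n^{1/2})$, $j=1,2$. "Large eigenvalues are simple" means that there is $N$ such that $\lambda_{n,j,2}$ is simple for all $n>N$, $j=1,2$. For each large $n$ the labels $j=1,2$ are assigned suitably, with a fixed choice of branch of the square roots. Eigenfunctions are normalized by $\|\Psi_{n,j,2}\|_{L_2[0,1]}=1$, and the $O$-term is uniform in $x\in[0,1]$ as $n\to\infty$. The root functions of an operator are its eigenfunctions and associated functions. *)

theory Defs
  imports
    "HOL-Analysis.Analysis"
    "HOL-Library.Function_Algebras"
    "HOL-Library.Landau_Symbols"
begin

subsection \<open>The space $L_2[0,1]$\<close>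

text \<open>Elements of $L_2[0,1]$ are represented by functions; values outside $[0,1]$ are irrelevant
  and equality in $L_2[0,1]$ is equality almost everywhere on $[0,1]$.\<close>

abbreviation leb01 :: "real measure" where
  "leb01 \<equiv> lebesgue_on {0..1}"

definition L2 :: "(real \<Rightarrow> complex) set" where
  "L2 = {f \<in> borel_measurable leb01. integrable leb01 (\<lambda>x. (norm (f x))\<^sup>2)}"

definition l2_inner :: "(real \<Rightarrow> complex) \<Rightarrow> (real \<Rightarrow> complex) \<Rightarrow> complex" where
  "l2_inner f g = (LINT x|leb01. f x * cnj (g x))"

definition l2_norm :: "(real \<Rightarrow> complex) \<Rightarrow> real" where
  "l2_norm f = sqrt (LINT x|leb01. (norm (f x))\<^sup>2)"

definition orthonormal_basis :: "(nat \<Rightarrow> real \<Rightarrow> complex) \<Rightarrow> bool" where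
  "orthonormal_basis g \<longleftrightarrow>
     (\<forall>i. g i \<in> L2) \<and>
     (\<forall>i j. l2_inner (g i) (g j) = (if i = j then 1 else 0)) \<and>
     (\<forall>f\<in>L2. \<forall>\<epsilon>>0. \<exists>N c. l2_norm (\<lambda>x. f x - (\<Sum>i<N. c i * g i x)) < \<epsilon>)"

text \<open>Boundedness and linearity up to null sets imply that the operator respects equality
  almost everywhere, so that it induces a bounded operator on equivalence classes.\<close>

definition bounded_l2_operator :: "((real \<Rightarrow> complex) \<Rightarrow> real \<Rightarrow> complex) \<Rightarrow> bool" where
  "bounded_l2_operator U \<longleftrightarrow>
     (\<forall>f\<in>L2. U f \<in> L2) \<and>
     (\<forall>f\<in>L2. \<forall>g\<in>L2. \<forall>a b.
        AE x in leb01. U (\<lambda>t. a * f t + b * g t) x = a * U f x + b * U g x) \<and>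
     (\<exists>C. \<forall>f\<in>L2. l2_norm (U f) \<le> C * l2_norm f)"

definition boundedly_invertible :: "((real \<Rightarrow> complex) \<Rightarrow> real \<Rightarrow> complex) \<Rightarrow> bool" where
  "boundedly_invertible U \<longleftrightarrow>
     bounded_l2_operator U \<and>
     (\<exists>V. bounded_l2_operator V \<and>
          (\<forall>f\<in>L2. (AE x in leb01. V (U f) x = f x) \<and> (AE x in leb01. U (V f) x = f x)))"

definition riesz_basis :: "(nat \<Rightarrow> real \<Rightarrow> complex) \<Rightarrow> bool" where
  "riesz_basis e \<longleftrightarrow>
     (\<forall>i. e i \<in> L2) \<and>
     (\<exists>g U. orthonormal_basis g \<and> boundedly_invertible U \<and>
            (\<forall>i. AE x in leb01. e i x = U (g i) x))"

subsection \<open>The operator $T_2$\<close>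

text \<open>Absolute continuity of $f$ on $[0,1]$ in integral form: $f$ is the indefinite integral of
  the integrable function $g$, which is then its derivative almost everywhere.\<close>

definition ac_derivative :: "(real \<Rightarrow> complex) \<Rightarrow> (real \<Rightarrow> complex) \<Rightarrow> bool" where
  "ac_derivative f g \<longleftrightarrow>
     integrable leb01 g \<and> (\<forall>x\<in>{0..1}. f x = f 0 + (LINT t|lebesgue_on {0..x}. g t))"

text \<open>The operator is given by its graph: \<open>T2 q \<beta> y f\<close> says that \<open>y\<close> is in the domain of
  $T_2$ and $T_2 y = f$ in $L_2[0,1]$.  An element of the domain is represented by its continuous
  representative on $[0,1]$ extended by zero; this makes the representing function unique, so that
  dimensions of spaces of such functions are those of the corresponding subspaces of $L_2[0,1]$.
  Below, \<open>y1\<close> and \<open>y2\<close> are $y'$ and $y''$.\<close>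

definition T2 :: "(real \<Rightarrow> complex) \<Rightarrow> complex \<Rightarrow> (real \<Rightarrow> complex) \<Rightarrow> (real \<Rightarrow> complex) \<Rightarrow> bool" where
  "T2 q \<beta> y f \<longleftrightarrow>
     (\<forall>x. x \<notin> {0..1} \<longrightarrow> y x = 0) \<and> f \<in> L2 \<and>
     (\<exists>y1 y2.
        (\<forall>x\<in>{0..1}. (y has_vector_derivative y1 x) (at x within {0..1})) \<and>
        ac_derivative y1 y2 \<and>
        (AE x in leb01. f x = - y2 x + q x * y x) \<and>
        y1 0 + \<beta> * y1 1 = 0 \<and> y 0 + y 1 = 0)"

definition eigenfunction :: "(real \<Rightarrow> complex) \<Rightarrow> complex \<Rightarrow> complex \<Rightarrow> (real \<Rightarrow> complex) \<Rightarrow> bool" where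
  "eigenfunction q \<beta> \<mu> y \<longleftrightarrow> T2 q \<beta> y (\<lambda>x. \<mu> * y x) \<and> (\<exists>x. y x \<noteq> 0)"

text \<open>Eigenfunctions and associated functions: $(T_2 - \mu) v = u$ with $u$ an eigenfunction or
  an associated function.\<close>

inductive root_function :: "(real \<Rightarrow> complex) \<Rightarrow> complex \<Rightarrow> complex \<Rightarrow> (real \<Rightarrow> complex) \<Rightarrow> bool"
  for q \<beta> \<mu> where
  eigen: "eigenfunction q \<beta> \<mu> y \<Longrightarrow> root_function q \<beta> \<mu> y"
| assoc: "root_function q \<beta> \<mu> u \<Longrightarrow> T2 q \<beta> v (\<lambda>x. \<mu> * v x + u x) \<Longrightarrow> root_function q \<beta> \<mu> v"

definition root_space :: "(real \<Rightarrow> complex) \<Rightarrow> complex \<Rightarrow> complex \<Rightarrow> (real \<Rightarrow> complex) set" where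
  "root_space q \<beta> \<mu> = insert (\<lambda>x. 0) {y. root_function q \<beta> \<mu> y}"

interpretation cfun: vector_space "\<lambda>(c::complex) (f::real \<Rightarrow> complex) x. c * f x"
  by standard (simp_all add: fun_eq_iff algebra_simps)

definition algebraic_multiplicity :: "(real \<Rightarrow> complex) \<Rightarrow> complex \<Rightarrow> complex \<Rightarrow> nat" where
  "algebraic_multiplicity q \<beta> \<mu> = cfun.dim (root_space q \<beta> \<mu>)"

definition simple_eigenvalue :: "(real \<Rightarrow> complex) \<Rightarrow> complex \<Rightarrow> complex \<Rightarrow> bool" where
  "simple_eigenvalue q \<beta> \<mu> \<longleftrightarrow> (\<exists>y. eigenfunction q \<beta> \<mu> y) \<and> algebraic_multiplicity q \<beta> \<mu> = 1"

text \<open>The eigenvalues, counted with algebraic multiplicity, are \<open>lam n j\<close> for $n \ge 0$ and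
  $j = 1,2$.  The index starts at $n = 0$: for $q = 0$ the eigenvalues are exactly the numbers
  $((2n+1)\pi)^2$ with $n \ge 0$, each of multiplicity two.\<close>

definition eigenvalue_labelling ::
    "(real \<Rightarrow> complex) \<Rightarrow> complex \<Rightarrow> (nat \<Rightarrow> nat \<Rightarrow> complex) \<Rightarrow> bool" where
  "eigenvalue_labelling q \<beta> lam \<longleftrightarrow>
     (\<forall>\<mu>. finite {(n, j). j \<in> {1, 2} \<and> lam n j = \<mu>} \<and>
          card {(n, j). j \<in> {1, 2} \<and> lam n j = \<mu>} = algebraic_multiplicity q \<beta> \<mu>) \<and>
     (\<forall>j\<in>{1, 2}. (\<lambda>n. lam n j - of_real ((2 * real n * pi + pi)\<^sup>2))
                    \<in> O(\<lambda>n. of_real (sqrt (real n))))"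

text \<open>A system of root functions of $T_2$ consists of a basis of each root subspace.
  No normalization is imposed and the bases are arbitrary, so this covers in particular
  systems of normalized functions and systems of Jordan chains.\<close>

definition root_function_system ::
    "(real \<Rightarrow> complex) \<Rightarrow> complex \<Rightarrow> (nat \<Rightarrow> real \<Rightarrow> complex) \<Rightarrow> bool" where
  "root_function_system q \<beta> e \<longleftrightarrow>
     inj e \<and>
     (\<forall>i. \<exists>\<mu>. root_function q \<beta> \<mu> (e i)) \<and>
     (\<forall>\<mu>. cfun.independent (range e \<inter> root_space q \<beta> \<mu>) \<and>
          cfun.span (range e \<inter> root_space q \<beta> \<mu>) = root_space q \<beta> \<mu>)"

definition root_functions_form_riesz_basis :: "(real \<Rightarrow> complex) \<Rightarrow> complex \<Rightarrow> bool" where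
  "root_functions_form_riesz_basis q \<beta> \<longleftrightarrow> (\<exists>e. root_function_system q \<beta> e \<and> riesz_basis e)"

definition sine_coeff :: "(real \<Rightarrow> complex) \<Rightarrow> nat \<Rightarrow> complex" where
  "sine_coeff q k = (LINT x|leb01. q x * of_real (sin (2 * pi * real k * x)))"

definition gamma2 :: "complex \<Rightarrow> complex" where
  "gamma2 \<beta> = 8 * of_real pi * (\<beta> - 1) / (\<beta> + 1)"

text \<open>$\lim_{k\to\infty} \ln m_k / (m_k s_{2m_k+1}) = 0$.  The quotient has to be defined for large
  $k$, which is stated explicitly because division by zero yields zero in HOL.\<close>

definition log_over_sine_coeff_tendsto_0 :: "(real \<Rightarrow> complex) \<Rightarrow> (nat \<Rightarrow> nat) \<Rightarrow> bool" where
  "log_over_sine_coeff_tendsto_0 q m \<longleftrightarrow>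
     (\<forall>\<^sub>F k in sequentially. sine_coeff q (2 * m k + 1) \<noteq> 0) \<and>
     (\<lambda>k. of_real (ln (real (m k))) / (of_nat (m k) * sine_coeff q (2 * m k + 1)))
        \<longlonglongrightarrow> 0"

end

theory Submission
  imports Defs
begin

text \<open>Write \<open>\<lambda> = \<rho>\<^sup>2\<close>.  For \<open>\<rho>\<close> in the strip \<open>\<bar>Im \<rho>\<bar> \<le> 1\<close> with \<open>\<bar>\<rho>\<bar>\<close> large, variation of
  constants turns the differential equation into a Volterra equation with kernel
  \<open>sin (\<rho> (x - t)) q t / \<rho>\<close>, whose operator norm in the sup norm is at most \<open>1/2\<close>.  Integrability
  of \<open>q\<close> therefore suffices for solutions that differ from \<open>cos (\<rho> x)\<close> and \<open>sin (\<rho> x)\<close> by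
  \<open>O(1/\<bar>\<rho>\<bar>)\<close> and are Lipschitz in \<open>\<rho>\<close>.  The boundary conditions become a linear system
  of two equations, and \<open>\<rho>\<^sup>2\<close> is an eigenvalue iff its determinant \<open>char_det \<rho>\<close> vanishes.

  Put \<open>\<rho> = \<rho>\<^sub>n + \<delta>\<close> with \<open>\<rho>\<^sub>n = (2 n + 1) \<pi>\<close>.  The unperturbed determinant
  \<open>(1 + \<beta>) (1 + cos \<rho>)\<close> has a double zero at \<open>\<rho>\<^sub>n\<close>.  The first order term of the perturbation
  is \<open>(1 - \<beta>) s / (2 \<rho>\<^sub>n)\<close> with the sine coefficient \<open>s\<close> of index \<open>2 n + 1\<close>.  After division by
  \<open>(1 + \<beta>) / 2\<close> the determinant is
    \<open>\<delta>\<^sup>2 - z\<^sup>2 + O(\<bar>\<delta>\<bar>\<^sup>3 + \<bar>\<delta>\<bar> / n + 1 / n\<^sup>2)\<close>,  where  \<open>z\<^sup>2 = (\<beta> - 1) / (\<beta> + 1) * s / \<rho>\<^sub>n\<close>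
  (\<open>redet_approx\<close>), and two of its values differ by at least
  \<open>(\<bar>\<delta> + \<epsilon>\<bar> / 4 - O(1/n)) \<bar>\<delta> - \<epsilon>\<bar>\<close> (\<open>redet_diff_ge\<close>).  The logarithmic hypothesis gives
  \<open>n \<bar>s\<bar> \<rightarrow> \<infinity>\<close>, which is \<open>n \<bar>z\<bar> \<rightarrow> \<infinity>\<close>: the splitting \<open>z\<close> of the double zero dominates all errors.
  Three facts follow.  Every small zero satisfies \<open>(\<delta> / z)\<^sup>2 \<approx> 1\<close> (\<open>redet_zero_asymptotics\<close>).
  Brouwer's theorem gives a zero near \<open>z\<close> and one near \<open>- z\<close> (\<open>redet_zero_exists\<close>).  Two different
  zeros satisfy \<open>\<delta> + \<epsilon> = O(1/n)\<close> (\<open>distinct_zeros\<close>), so they lie on opposite branches.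

  Near \<open>\<rho>\<^sub>n\<close> one diagonal coefficient of the boundary system is close to \<open>1 - \<beta> \<noteq> 0\<close>, which
  makes every eigenspace one-dimensional and every eigenfunction a multiple of
  \<open>cos (\<rho>\<^sub>n x) + O(\<bar>\<delta>\<bar> + 1/n)\<close> (\<open>eigenfunction_near_cos\<close>).  An associated function \<open>v\<close> of an
  eigenfunction \<open>u\<close> would make \<open>u + (\<lambda> - \<mu>) v\<close> an eigenfunction at \<open>\<lambda>\<close> up to an error
  \<open>O(\<bar>\<lambda> - \<mu>\<bar>\<^sup>2)\<close>, so that the determinant would vanish to second order at the eigenvalue \<open>\<mu>\<close>,
  against the lower bound on its differences.  Hence the eigenvalues are simple
  (\<open>simple_near_rn\<close>).

  In a system of root functions the two eigenvalues near \<open>\<rho>\<^sub>n\<^sup>2\<close> contribute one multiple each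
  of almost the same cosine.  The angle between the two elements tends to zero along the given
  subsequence, whereas the elements of a Riesz basis have angles bounded from below
  (\<open>riesz_basis_bounds\<close>).\<close>

section \<open>Products of absolutely continuous functions\<close>

lemma integrable_leb01_iff:
  fixes f :: "real \<Rightarrow> complex"
  shows "integrable leb01 f \<longleftrightarrow> f absolutely_integrable_on {0..1}"
  by (simp add: integrable_restrict_space set_integrable_def)

lemma absint_subinterval:
  fixes f :: "real \<Rightarrow> complex"
  assumes "f absolutely_integrable_on {0..1}" "0 \<le> a" "b \<le> 1"
  shows "f absolutely_integrable_on {a..b}"
  using absolutely_integrable_on_subinterval[OF assms(1), of a b] assms by auto

lemma lebesgue_integral_subinterval:
  fixes f :: "real \<Rightarrow> complex"
  assumes "f absolutely_integrable_on {0..1}" "0 \<le> a" "b \<le> 1"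
  shows "(LINT t|lebesgue_on {a..b}. f t) = integral {a..b} f"
proof -
  have "integrable (lebesgue_on {a..b}) f"
    using absint_subinterval[OF assms] by (simp add: integrable_restrict_space set_integrable_def)
  then show ?thesis by (simp add: lebesgue_integral_eq_integral)
qed

lemma absint_continuous:
  fixes g :: "real \<Rightarrow> complex"
  assumes "continuous_on {0..1} g"
  shows "g absolutely_integrable_on {0..1}"
  using absolutely_integrable_continuous_real[OF assms] .

lemma absint_continuous_mult:
  fixes g f :: "real \<Rightarrow> complex"
  assumes "continuous_on {0..1} g" "f absolutely_integrable_on {0..1}"
  shows "(\<lambda>t. g t * f t) absolutely_integrable_on {0..1}"
proof (rule absolutely_integrable_bounded_measurable_product[OF bilinear_times])
  show "g \<in> borel_measurable (lebesgue_on {0..1})"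
    using assms(1) by (intro continuous_imp_measurable_on_sets_lebesgue) auto
  show "bounded (g ` {0..1})"
    using assms(1) by (intro compact_imp_bounded compact_continuous_image) auto
qed (use assms in auto)

lemma absint_indefinite_continuous:
  fixes f :: "real \<Rightarrow> complex"
  assumes "f absolutely_integrable_on {0..1}"
  shows "continuous_on {0..1} (\<lambda>x. integral {0..x} f)"
  using assms by (intro indefinite_integral_continuous_1) (simp add: set_lebesgue_integral_eq_integral)

text \<open>The difference \<open>H\<close> of the two sides satisfies
  \<open>\<bar>H v - H u\<bar> \<le> 2 L (v - u) \<integral>\<^bsub>u\<^esub>\<^bsup>v\<^esup> \<bar>f\<bar>\<close> with a Lipschitz constant \<open>L\<close> of \<open>E\<close>.  The integral is
  continuous in its endpoints, so \<open>H\<close> has derivative zero at every point and is constant, although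
  \<open>F\<close> itself is differentiable only almost everywhere.\<close>
lemma absolutely_continuous_product_rule:
  fixes E E' F f :: "real \<Rightarrow> complex"
  assumes f: "f absolutely_integrable_on {0..1}"
    and F: "\<And>x. x \<in> {0..1} \<Longrightarrow> F x = F 0 + integral {0..x} f"
    and E: "\<And>x. x \<in> {0..1} \<Longrightarrow> (E has_vector_derivative E' x) (at x within {0..1})"
    and E': "continuous_on {0..1} E'"
    and x: "x \<in> {0..1}"
  shows "E x * F x = E 0 * F 0 + integral {0..x} (\<lambda>t. E' t * F t + E t * f t)"
proof -
  have contE: "continuous_on {0..1} E"
    using E continuous_on_vector_derivative by blast
  have contF: "continuous_on {0..1} F"
  proof -
    have "continuous_on {0..1} (\<lambda>x. F 0 + integral {0..x} f)"
      by (intro continuous_intros absint_indefinite_continuous f)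
    then show ?thesis using F continuous_on_cong[OF refl, of "{0..1}" F "\<lambda>x. F 0 + integral {0..x} f"] by blast
  qed
  define g where "g = (\<lambda>t. E' t * F t + E t * f t)"
  have g: "g absolutely_integrable_on {0..1}"
    unfolding g_def
    by (intro set_integral_add(1) absint_continuous absint_continuous_mult continuous_intros contE contF E' f)
  have nf: "(\<lambda>t. norm (f t)) integrable_on {0..1}"
    using f absolutely_integrable_on_def by blast
  have fi: "f integrable_on {0..1}" and gi: "g integrable_on {0..1}"
    using f g by (auto simp: set_lebesgue_integral_eq_integral)
  define A where "A = (\<lambda>x. integral {0..x} (\<lambda>t. norm (f t)))"
  have contA: "continuous_on {0..1} A"
    unfolding A_def using nf by (rule indefinite_integral_continuous_1)
  have split: "integral {0..v} h - integral {0..u} h = integral {u..v} h"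
    if "h integrable_on {0..1}" "0 \<le> u" "u \<le> v" "v \<le> 1"
    for h :: "real \<Rightarrow> 'a::banach" and u v
  proof -
    have "h integrable_on {0..v}"
      using that integrable_on_subinterval[of h "{0..1}" 0 v] by auto
    from Henstock_Kurzweil_Integration.integral_combine[OF that(2,3) this] show ?thesis by (simp add: algebra_simps)
  qed
  have "bounded (E' ` {0..1})"
    using E' by (intro compact_imp_bounded compact_continuous_image) auto
  then obtain L where L: "\<And>t. t \<in> {0..1} \<Longrightarrow> norm (E' t) \<le> L" 
    unfolding bounded_iff by blast
  have L0: "L \<ge> 0" using L[of 0] norm_ge_zero[of "E' 0"] by (auto intro: order_trans simp del: norm_ge_zero)
  have LipE: "norm (E v - E u) \<le> L * \<bar>v - u\<bar>" if "u \<in> {0..1}" "v \<in> {0..1}" for u v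
  proof -
    have "norm (E v - E u) \<le> L * norm (v - u)"
    proof (rule differentiable_bound[of "{0..1}" E "\<lambda>x h. h *\<^sub>R E' x"])
      show "onorm (\<lambda>h. h *\<^sub>R E' x) \<le> L" if "x \<in> {0..1}" for x
        by (rule onorm_le) (use mult_right_mono[OF L[OF that] abs_ge_zero] in \<open>simp add: mult.commute\<close>)
    qed (use E that in \<open>auto simp: has_vector_derivative_def\<close>)
    then show ?thesis by simp
  qed
  define H where "H = (\<lambda>x. E x * F x - integral {0..x} g)"
  have main: "norm (H v - H u) \<le> 2 * L * (v - u) * (A v - A u)"
    if uv: "0 \<le> u" "u \<le> v" "v \<le> 1" for u v
  proof -
    have sub: "h integrable_on {u..v}" if "h integrable_on {0..1}" for h :: "real \<Rightarrow> 'a::banach"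
      using that uv integrable_on_subinterval[of h "{0..1}" u v] by auto
    have fF: "F v - F u = integral {u..v} f"
      using split[OF fi uv] F[of u] F[of v] uv by simp
    have E'E: "(E' has_integral (E v - E u)) {u..v}"
      by (rule fundamental_theorem_of_calculus[OF uv(2)])
        (use uv in \<open>auto intro: has_vector_derivative_within_subset[OF E]\<close>)
    have 1: "((\<lambda>t. E v * f t) has_integral (E v * (F v - F u))) {u..v}"
      unfolding fF using sub[OF fi] by (intro has_integral_mult_right integrable_integral)
    have 2: "((\<lambda>t. E' t * F u) has_integral ((E v - E u) * F u)) {u..v}"
      by (intro has_integral_mult_left E'E)
    have 3: "(g has_integral (integral {0..v} g - integral {0..u} g)) {u..v}"
      unfolding split[OF gi uv] using sub[OF gi] by (rule integrable_integral)
    have 4: "((\<lambda>t. E v * f t + E' t * F u - g t) has_integral (H v - H u)) {u..v}"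
      using has_integral_diff[OF has_integral_add[OF 1 2] 3]
      by (simp add: H_def algebra_simps)
    have nn: "((\<lambda>t. L * (v - u) * norm (f t)) has_integral (L * (v - u) * (A v - A u))) {u..v}"
      unfolding A_def split[OF nf uv] using sub[OF nf]
      by (intro has_integral_mult_right integrable_integral)
    have cc: "((\<lambda>t. L * (A v - A u)) has_integral (L * (v - u) * (A v - A u))) {u..v}"
      using has_integral_const_real[of "L * (A v - A u)" u v] uv by (simp add: mult_ac)
    have bd: "norm (E v * f t + E' t * F u - g t) \<le> L * (v - u) * norm (f t) + L * (A v - A u)"
      if t: "t \<in> {u..v}" for t
    proof -
      have t01: "t \<in> {0..1}" using t uv by auto
      have "E v * f t + E' t * F u - g t = (E v - E t) * f t + E' t * (F u - F t)"
        by (simp add: g_def algebra_simps)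
      moreover have "norm ((E v - E t) * f t) \<le> L * (v - u) * norm (f t)"
      proof -
        have "norm (E v - E t) \<le> L * \<bar>v - t\<bar>" using LipE t01 uv by auto
        also have "\<dots> \<le> L * (v - u)" using L0 t by (intro mult_left_mono) auto
        finally show ?thesis by (simp add: norm_mult mult_right_mono)
      qed
      moreover have "norm (E' t * (F u - F t)) \<le> L * (A v - A u)"
      proof -
        have eq: "F t - F u = integral {u..t} f"
          using split[OF fi, of u t] F[of u] F[of t] uv t by auto
        have "norm (F u - F t) = norm (F t - F u)" by (simp add: norm_minus_commute)
        also have "\<dots> \<le> integral {u..t} (\<lambda>s. norm (f s))"
          unfolding eq using fi nf uv t
          by (intro integral_norm_bound_integral) (auto intro: integrable_on_subinterval)
        also have "\<dots> \<le> integral {u..v} (\<lambda>s. norm (f s))"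
          using nf uv t by (intro integral_subset_le) (auto intro: integrable_on_subinterval)
        also have "\<dots> = A v - A u" unfolding A_def split[OF nf uv] ..
        finally show ?thesis using L[OF t01] L0 by (simp add: norm_mult mult_mono)
      qed
      ultimately show ?thesis by (metis norm_triangle_mono)
    qed
    have "norm (integral {u..v} (\<lambda>t. E v * f t + E' t * F u - g t))
        \<le> integral {u..v} (\<lambda>t. L * (v - u) * norm (f t) + L * (A v - A u))"
      using 4 has_integral_add[OF nn cc] bd
      by (intro integral_norm_bound_integral) (auto simp: has_integral_integrable)
    then show ?thesis
      using integral_unique[OF 4] integral_unique[OF has_integral_add[OF nn cc]] by (simp add: algebra_simps)
  qed
  have main': "norm (H v - H u) \<le> 2 * L * \<bar>A v - A u\<bar> * norm (v - u)" if "u \<in> {0..1}" "v \<in> {0..1}" for u v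
  proof (cases "u \<le> v")
    case True
    have "norm (H v - H u) \<le> 2 * L * (v - u) * (A v - A u)" using main that True by auto
    also have "\<dots> \<le> 2 * L * (v - u) * \<bar>A v - A u\<bar>" using L0 True by (intro mult_left_mono) auto
    finally show ?thesis using True by (simp add: algebra_simps)
  next
    case False
    have "norm (H u - H v) \<le> 2 * L * (u - v) * (A u - A v)" using main that False by auto
    also have "\<dots> \<le> 2 * L * (u - v) * \<bar>A u - A v\<bar>" using L0 False by (intro mult_left_mono) auto
    finally show ?thesis using False by (simp add: algebra_simps norm_minus_commute abs_minus_commute)
  qed
  have "(H has_derivative (\<lambda>h. 0)) (at u within {0..1})" if u: "u \<in> {0..1}" for u
    unfolding has_derivative_within_alt
  proof (intro conjI allI impI)
    fix e :: real assume "e > 0"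
    then have "e / (2 * L + 1) > 0" using L0 by auto
    then obtain d where d: "d > 0" "\<And>v. v \<in> {0..1} \<Longrightarrow> dist v u < d \<Longrightarrow> dist (A v) (A u) < e / (2 * L + 1)"
      using contA u unfolding continuous_on_iff by metis
    have "norm (H v - H u) \<le> e * norm (v - u)" if v: "v \<in> {0..1}" "norm (v - u) < d" for v
    proof -
      have "2 * L * \<bar>A v - A u\<bar> \<le> (2 * L + 1) * (e / (2 * L + 1))"
        using d(2)[OF v(1)] v(2) L0 by (intro mult_mono) (auto simp: dist_norm)
      also have "\<dots> = e" using L0 by simp
      finally have "2 * L * \<bar>A v - A u\<bar> \<le> e" .
      then show ?thesis
        using main'[OF u v(1)] by (meson mult_right_mono norm_ge_zero order_trans)
    qed
    then show "\<exists>d>0. \<forall>y\<in>{0..1}. norm (y - u) < d \<longrightarrow> norm (H y - H u - 0) \<le> e * norm (y - u)"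
      using d(1) by auto
  qed auto
  then obtain c where "\<And>u. u \<in> {0..1} \<Longrightarrow> H u = c"
    using has_derivative_zero_constant[of "{0..1}" H] by auto
  then have "H x = H 0" using x by auto
  then show ?thesis by (simp add: H_def g_def algebra_simps)
qed

section \<open>Variation of constants\<close>

lemma absint_imp_integrable_on:
  fixes f :: "real \<Rightarrow> complex"
  assumes "f absolutely_integrable_on {0..1}" "x \<in> {0..1}"
  shows "f integrable_on {0..x}"
  using set_lebesgue_integral_eq_integral(1)[OF absint_subinterval[OF assms(1), of 0 x]] assms(2) by simp

lemma sin_has_vector_derivative:
  fixes \<rho> :: complex
  shows "((\<lambda>t::real. sin (\<rho> * of_real t)) has_vector_derivative \<rho> * cos (\<rho> * of_real t)) (at t within S)"
  by (rule has_vector_derivative_real_field) (auto intro!: derivative_eq_intros)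

lemma cos_has_vector_derivative:
  fixes \<rho> :: complex
  shows "((\<lambda>t::real. cos (\<rho> * of_real t)) has_vector_derivative - \<rho> * sin (\<rho> * of_real t)) (at t within S)"
  by (rule has_vector_derivative_real_field) (auto intro!: derivative_eq_intros)

lemma sin_reflected_has_vector_derivative:
  fixes \<rho> :: complex
  shows "((\<lambda>t::real. sin (\<rho> * of_real (x - t))) has_vector_derivative - \<rho> * cos (\<rho> * of_real (x - t))) (at t within S)"
proof -
  have "((\<lambda>z. sin (\<rho> * (of_real x - z))) has_field_derivative - \<rho> * cos (\<rho> * (of_real x - of_real t))) (at (of_real t))"
    by (auto intro!: derivative_eq_intros)
  from has_vector_derivative_real_field[OF this] show ?thesis by simp
qed

lemma cos_reflected_has_vector_derivative:
  fixes \<rho> :: complex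
  shows "((\<lambda>t::real. cos (\<rho> * of_real (x - t))) has_vector_derivative \<rho> * sin (\<rho> * of_real (x - t))) (at t within S)"
proof -
  have "((\<lambda>z. cos (\<rho> * (of_real x - z))) has_field_derivative \<rho> * sin (\<rho> * (of_real x - of_real t))) (at (of_real t))"
    by (auto intro!: derivative_eq_intros)
  from has_vector_derivative_real_field[OF this] show ?thesis by simp
qed

text \<open>The kernels of the Volterra equation for \<open>y\<close> and of the formula for \<open>y'\<close> are both of
  convolution type.\<close>
abbreviation conv :: "(complex \<Rightarrow> complex) \<Rightarrow> complex \<Rightarrow> (real \<Rightarrow> complex) \<Rightarrow> real \<Rightarrow> complex" where
  "conv T \<rho> g x \<equiv> integral {0..x} (\<lambda>t. T (\<rho> * of_real (x - t)) * g t)"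

text \<open>The product rule is applied to \<open>sin (\<rho> (x - t)) y' t\<close> and \<open>\<rho> cos (\<rho> (x - t)) y t\<close>;
  in the sum all terms with \<open>y\<close> and \<open>y'\<close> cancel under the integral and \<open>sin (\<rho> (x - t)) g t\<close>
  remains.  The formula for \<open>y'\<close> comes from \<open>cos (\<rho> (x - t)) y' t\<close> and
  \<open>- \<rho> sin (\<rho> (x - t)) y t\<close> in the same way.\<close>
lemma variation_of_constants:
  fixes y y1 g :: "real \<Rightarrow> complex"
  assumes g: "g absolutely_integrable_on {0..1}"
    and \<rho>: "\<rho> \<noteq> 0"
    and y: "\<And>x. x \<in> {0..1} \<Longrightarrow> (y has_vector_derivative y1 x) (at x within {0..1})"
    and y1: "\<And>x. x \<in> {0..1} \<Longrightarrow> y1 x = y1 0 + integral {0..x} (\<lambda>t. g t - \<rho>\<^sup>2 * y t)"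
    and x: "x \<in> {0..1}"
  shows "y x = y 0 * cos (\<rho> * of_real x) + y1 0 / \<rho> * sin (\<rho> * of_real x)
               + conv sin \<rho> g x / \<rho>" (is ?thesis1)
    and "y1 x = y1 0 * cos (\<rho> * of_real x) - \<rho> * y 0 * sin (\<rho> * of_real x)
               + conv cos \<rho> g x" (is ?thesis2)
proof -
  let ?S = "\<lambda>t. sin (\<rho> * of_real (x - t))" and ?C = "\<lambda>t. cos (\<rho> * of_real (x - t))"
  have conty: "continuous_on {0..1} y"
    using y continuous_on_vector_derivative by blast
  have f: "(\<lambda>t. g t - \<rho>\<^sup>2 * y t) absolutely_integrable_on {0..1}"
    by (intro set_integral_diff(1) g absint_continuous continuous_intros conty)
  have conty1: "continuous_on {0..1} y1"
  proof -
    have "continuous_on {0..1} (\<lambda>x. y1 0 + integral {0..x} (\<lambda>t. g t - \<rho>\<^sup>2 * y t))"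
      by (intro continuous_intros absint_indefinite_continuous f)
    then show ?thesis
      using continuous_on_cong[OF refl, of "{0..1}" y1 "\<lambda>x. y1 0 + integral {0..x} (\<lambda>t. g t - \<rho>\<^sup>2 * y t)"] y1
      by blast
  qed
  have yint: "y u = y 0 + integral {0..u} y1" if u: "u \<in> {0..1}" for u
  proof -
    have "(y1 has_integral (y u - y 0)) {0..u}"
      by (rule fundamental_theorem_of_calculus)
        (use u in \<open>auto intro: has_vector_derivative_within_subset[OF y]\<close>)
    then show ?thesis by (simp add: integral_unique)
  qed
  have y1a: "y1 absolutely_integrable_on {0..1}" by (rule absint_continuous[OF conty1])
  note aint = absint_imp_integrable_on[OF _ x]
  have ai: "(\<lambda>t. A t * y1 t + B t * (g t - \<rho>\<^sup>2 * y t)) integrable_on {0..x}"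
     "(\<lambda>t. A t * y t + B t * y1 t) integrable_on {0..x}"
    if "continuous_on {0..1} A" "continuous_on {0..1} B" for A B
    by (intro aint set_integral_add(1) absint_continuous_mult f absint_continuous continuous_on_mult conty conty1 that)+
  have s: "continuous_on {0..1} (\<lambda>t. ?S t)"
      "continuous_on {0..1} (\<lambda>t. ?C t)"
      "continuous_on {0..1} (\<lambda>t. \<rho> * ?S t)"
      "continuous_on {0..1} (\<lambda>t. \<rho> * ?C t)"
      "continuous_on {0..1} (\<lambda>t. - \<rho> * ?C t)"
      "continuous_on {0..1} (\<lambda>t. - \<rho> * ?S t)"
      "continuous_on {0..1} (\<lambda>t. \<rho> * (\<rho> * ?S t))"
      "continuous_on {0..1} (\<lambda>t. - \<rho> * (- \<rho> * ?C t))"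
    by (intro continuous_intros)+
  note pr = absolutely_continuous_product_rule[OF _ _ _ _ x]
  have 1: "0 = sin (\<rho> * of_real x) * y1 0
      + integral {0..x} (\<lambda>t. - \<rho> * ?C t * y1 t
          + ?S t * (g t - \<rho>\<^sup>2 * y t))"
    using pr[OF f y1 sin_reflected_has_vector_derivative[where \<rho>=\<rho> and x=x] s(5)] by simp
  have 2: "\<rho> * y x = \<rho> * cos (\<rho> * of_real x) * y 0
      + integral {0..x} (\<lambda>t. \<rho> * (\<rho> * ?S t) * y t
          + \<rho> * ?C t * y1 t)"
    using pr[OF y1a yint has_vector_derivative_mult_right[OF cos_reflected_has_vector_derivative[where \<rho>=\<rho> and x=x], where a=\<rho>] s(7)] by simp
  have "\<rho> * y x = \<rho> * cos (\<rho> * of_real x) * y 0 + sin (\<rho> * of_real x) * y1 0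
      + (integral {0..x} (\<lambda>t. - \<rho> * ?C t * y1 t
          + ?S t * (g t - \<rho>\<^sup>2 * y t)) 
      + integral {0..x} (\<lambda>t. \<rho> * (\<rho> * ?S t) * y t
          + \<rho> * ?C t * y1 t))"
    using arg_cong2[OF 1 2, of "(+)"] by (simp add: algebra_simps)
  also have "integral {0..x} (\<lambda>t. - \<rho> * ?C t * y1 t
          + ?S t * (g t - \<rho>\<^sup>2 * y t)) 
      + integral {0..x} (\<lambda>t. \<rho> * (\<rho> * ?S t) * y t
          + \<rho> * ?C t * y1 t)
      = conv sin \<rho> g x"
    by (subst integral_add[symmetric], rule ai(1)[OF s(5) s(1)], rule ai(2)[OF s(7) s(4)])
      (simp add: algebra_simps power2_eq_square)
  finally show ?thesis1 using \<rho> by (simp add: field_simps)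
  have 3: "y1 x = cos (\<rho> * of_real x) * y1 0
      + integral {0..x} (\<lambda>t. \<rho> * ?S t * y1 t
          + ?C t * (g t - \<rho>\<^sup>2 * y t))"
    using pr[OF f y1 cos_reflected_has_vector_derivative[where \<rho>=\<rho> and x=x] s(3)] by simp
  have 4: "0 = - \<rho> * sin (\<rho> * of_real x) * y 0
      + integral {0..x} (\<lambda>t. - \<rho> * (- \<rho> * ?C t) * y t
          + - \<rho> * ?S t * y1 t)"
    using pr[OF y1a yint has_vector_derivative_mult_right[OF sin_reflected_has_vector_derivative[where \<rho>=\<rho> and x=x], where a="-\<rho>"] s(8)]
    by simp
  have "y1 x = cos (\<rho> * of_real x) * y1 0 - \<rho> * sin (\<rho> * of_real x) * y 0
      + (integral {0..x} (\<lambda>t. \<rho> * ?S t * y1 t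
          + ?C t * (g t - \<rho>\<^sup>2 * y t))
      + integral {0..x} (\<lambda>t. - \<rho> * (- \<rho> * ?C t) * y t
          + - \<rho> * ?S t * y1 t))"
    using arg_cong2[OF 3 4, of "(+)"] by (simp add: algebra_simps)
  also have "integral {0..x} (\<lambda>t. \<rho> * ?S t * y1 t
          + ?C t * (g t - \<rho>\<^sup>2 * y t))
      + integral {0..x} (\<lambda>t. - \<rho> * (- \<rho> * ?C t) * y t
          + - \<rho> * ?S t * y1 t)
      = conv cos \<rho> g x"
    by (subst integral_add[symmetric], rule ai(1)[OF s(3) s(2)], rule ai(2)[OF s(8) s(6)])
      (simp add: algebra_simps power2_eq_square)
  finally show ?thesis2 by (simp add: algebra_simps)
qed

text \<open>The addition theorems express the convolutions through the absolutely continuous functions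
  \<open>P\<close> and \<open>R\<close>, the integrals of \<open>cos (\<rho> t) g t\<close> and \<open>sin (\<rho> t) g t\<close>.  In
  \<open>sin (\<rho> x) P x - cos (\<rho> x) R x\<close> the two terms with \<open>g\<close> cancel, so this function is the integral
  of a continuous one and \<open>y\<close> is differentiable everywhere.\<close>
lemma variation_of_constants_converse:
  fixes y y1 g :: "real \<Rightarrow> complex"
  assumes g: "g absolutely_integrable_on {0..1}"
    and \<rho>: "\<rho> \<noteq> 0"
    and y: "\<And>x. x \<in> {0..1} \<Longrightarrow> y x = a * cos (\<rho> * of_real x) + b * sin (\<rho> * of_real x)
               + conv sin \<rho> g x / \<rho>"
    and y1: "\<And>x. x \<in> {0..1} \<Longrightarrow> y1 x = \<rho> * b * cos (\<rho> * of_real x) - \<rho> * a * sin (\<rho> * of_real x)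
               + conv cos \<rho> g x"
  shows "\<And>x. x \<in> {0..1} \<Longrightarrow> (y has_vector_derivative y1 x) (at x within {0..1})"
    and "\<And>x. x \<in> {0..1} \<Longrightarrow> y1 x = y1 0 + integral {0..x} (\<lambda>t. g t - \<rho>\<^sup>2 * y t)"
proof -
  let ?s = "\<lambda>t::real. sin (\<rho> * of_real t)" and ?c = "\<lambda>t::real. cos (\<rho> * of_real t)"
  define P where "P = (\<lambda>x. integral {0..x} (\<lambda>t. ?c t * g t))"
  define R where "R = (\<lambda>x. integral {0..x} (\<lambda>t. ?s t * g t))"
  have cs: "continuous_on {0..1} ?c" "continuous_on {0..1} ?s"
    by (intro continuous_intros)+
  have Pi: "(\<lambda>t. ?c t * g t) absolutely_integrable_on {0..1}"
    and Ri: "(\<lambda>t. ?s t * g t) absolutely_integrable_on {0..1}"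
    by (intro absint_continuous_mult cs g)+
  have contP: "continuous_on {0..1} P" and contR: "continuous_on {0..1} R"
    unfolding P_def R_def by (intro absint_indefinite_continuous Pi Ri)+
  have P0: "P 0 = 0" "R 0 = 0" by (simp_all add: P_def R_def)
  have Pe: "P x = P 0 + integral {0..x} (\<lambda>t. ?c t * g t)" 
    and Re: "R x = R 0 + integral {0..x} (\<lambda>t. ?s t * g t)" for x
    by (simp_all add: P_def R_def)
  have aint: "f absolutely_integrable_on {0..1} \<Longrightarrow> f integrable_on {0..x}" if "x \<in> {0..1}" for x and f :: "real \<Rightarrow> complex"
    using absint_imp_integrable_on that by blast
  have sinsplit: "conv sin \<rho> g x
      = ?s x * P x - ?c x * R x" if x: "x \<in> {0..1}" for x
  proof -
    have "?s x * P x - ?c x * R x = 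
       integral {0..x} (\<lambda>t. ?s x * (?c t * g t) - ?c x * (?s t * g t))"
      unfolding P_def R_def
      by (subst integral_diff) (intro integrable_on_mult_right aint[OF x] Pi Ri | simp)+
    then show ?thesis by (simp add: right_diff_distrib sin_diff algebra_simps)
  qed
  have cossplit: "conv cos \<rho> g x
      = ?c x * P x + ?s x * R x" if x: "x \<in> {0..1}" for x
  proof -
    have "?c x * P x + ?s x * R x = 
       integral {0..x} (\<lambda>t. ?c x * (?c t * g t) + ?s x * (?s t * g t))"
      unfolding P_def R_def
      by (subst integral_add) (intro integrable_on_mult_right aint[OF x] Pi Ri | simp)+
    then show ?thesis by (simp add: right_diff_distrib cos_diff algebra_simps)
  qed
  have gi: "(\<lambda>t. A t * X t + B t * (C t * g t)) absolutely_integrable_on {0..1}"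
    if "continuous_on {0..1} A" "continuous_on {0..1} B" "continuous_on {0..1} C" "continuous_on {0..1} X"
    for A B C X :: "real \<Rightarrow> complex"
    by (intro set_integral_add(1) absint_continuous_mult absint_continuous continuous_on_mult that g)
  note cont = cs contP contR
  have sP: "?s x * P x = integral {0..x} (\<lambda>t. \<rho> * ?c t * P t + ?s t * (?c t * g t))"
    and cR: "?c x * R x = integral {0..x} (\<lambda>t. - \<rho> * ?s t * R t + ?c t * (?s t * g t))"
    and cP: "?c x * P x = integral {0..x} (\<lambda>t. - \<rho> * ?s t * P t + ?c t * (?c t * g t))"
    and sR: "?s x * R x = integral {0..x} (\<lambda>t. \<rho> * ?c t * R t + ?s t * (?s t * g t))"
    if x: "x \<in> {0..1}" for x
    using absolutely_continuous_product_rule[OF Pi Pe sin_has_vector_derivative _ x]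
      absolutely_continuous_product_rule[OF Ri Re cos_has_vector_derivative _ x]
      absolutely_continuous_product_rule[OF Pi Pe cos_has_vector_derivative _ x]
      absolutely_continuous_product_rule[OF Ri Re sin_has_vector_derivative _ x]
    by (simp_all add: P0 continuous_intros)
  define w where "w = (\<lambda>t. ?c t * P t + ?s t * R t)"
  have contw: "continuous_on {0..1} w" unfolding w_def by (intro continuous_intros cont)
  have diff: "?s x * P x - ?c x * R x = integral {0..x} (\<lambda>t. \<rho> * w t)"
    if x: "x \<in> {0..1}" for x
    unfolding sP[OF x] cR[OF x]
    by (subst integral_diff[symmetric], (intro aint[OF x] gi cont continuous_intros)+)
      (simp add: w_def algebra_simps)
  have yw: "y x = a * ?c x + b * ?s x + integral {0..x} w" if x: "x \<in> {0..1}" for x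
    using y[OF x] \<rho> unfolding sinsplit[OF x] diff[OF x] by simp
  show "(y has_vector_derivative y1 x) (at x within {0..1})" if x: "x \<in> {0..1}" for x
  proof (rule has_vector_derivative_transform[OF x])
    show "y x = a * ?c x + b * ?s x + integral {0..x} w" if "x \<in> {0..1}" for x 
      using yw[OF that] .
    show "((\<lambda>x. a * ?c x + b * ?s x + integral {0..x} w) has_vector_derivative y1 x) (at x within {0..1})"
    proof -
      have "((\<lambda>x. a * ?c x + b * ?s x + integral {0..x} w) has_vector_derivative 
          a * (- \<rho> * ?s x) + b * (\<rho> * ?c x) + w x) (at x within {0..1})"
        by (intro has_vector_derivative_add has_vector_derivative_mult_right cos_has_vector_derivative
          sin_has_vector_derivative integral_has_vector_derivative contw x)
      moreover have "a * (- \<rho> * ?s x) + b * (\<rho> * ?c x) + w x = y1 x"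
        using y1[OF x] unfolding cossplit[OF x] w_def by (simp add: algebra_simps)
      ultimately show ?thesis by simp
    qed
  qed
  show "y1 x = y1 0 + integral {0..x} (\<lambda>t. g t - \<rho>\<^sup>2 * y t)" if x: "x \<in> {0..1}" for x
  proof -
    have c: "?c x * P x + ?s x * R x
        = integral {0..x} (\<lambda>t. (- \<rho> * ?s t * P t + ?c t * (?c t * g t))
             + (\<rho> * ?c t * R t + ?s t * (?s t * g t)))"
      unfolding cP[OF x] sR[OF x]
      by (subst integral_add, (intro aint[OF x] gi cont continuous_intros)+) simp
    have ftc: "((\<lambda>t. \<rho> * b * (- \<rho> * ?s t) - \<rho> * a * (\<rho> * ?c t)) has_integral
       (\<rho> * b * ?c x - \<rho> * a * ?s x) - (\<rho> * b * ?c 0 - \<rho> * a * ?s 0)) {0..x}"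
      using x by (intro fundamental_theorem_of_calculus has_vector_derivative_diff has_vector_derivative_mult_right
         cos_has_vector_derivative sin_has_vector_derivative) auto
    have "y1 x = \<rho> * b + (integral {0..x} (\<lambda>t. \<rho> * b * (- \<rho> * ?s t) - \<rho> * a * (\<rho> * ?c t))
       + (?c x * P x + ?s x * R x))"
      using y1[OF x] integral_unique[OF ftc] unfolding cossplit[OF x] by simp
    also have "\<dots> = \<rho> * b + integral {0..x} (\<lambda>t. (\<rho> * b * (- \<rho> * ?s t) - \<rho> * a * (\<rho> * ?c t))
       + ((- \<rho> * ?s t * P t + ?c t * (?c t * g t))
             + (\<rho> * ?c t * R t + ?s t * (?s t * g t))))"
      unfolding c
      by (subst integral_add[OF has_integral_integrable[OF ftc]])
        (intro aint[OF x] set_integral_add(1) gi cont continuous_intros | simp)+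
    also have "\<dots> = \<rho> * b + integral {0..x} (\<lambda>t. g t - \<rho>\<^sup>2 * y t)"
    proof -
      have "(\<rho> * b * (- \<rho> * ?s t) - \<rho> * a * (\<rho> * ?c t))
       + ((- \<rho> * ?s t * P t + ?c t * (?c t * g t))
             + (\<rho> * ?c t * R t + ?s t * (?s t * g t)))
         = g t - \<rho>\<^sup>2 * y t" if t: "t \<in> {0..x}" for t
      proof -
        have t': "t \<in> {0..1}" using t x by auto
        have pyth: "?c t * (?c t * g t) + ?s t * (?s t * g t) = g t"
          using sin_cos_squared_add3[of "\<rho> * of_real t"] by (metis distrib_right mult.assoc mult.left_neutral)
        have "\<rho> * y t = \<rho> * (a * ?c t + b * ?s t) + 
            (?s t * P t - ?c t * R t)"
          using y[OF t'] \<rho> unfolding sinsplit[OF t'] by (simp add: field_simps)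
        then have "\<rho> * (\<rho> * y t) = \<rho> * (\<rho> * (a * ?c t + b * ?s t) + 
            (?s t * P t - ?c t * R t))"
          by simp
        then show ?thesis using pyth by (simp add: algebra_simps power2_eq_square)
      qed
      then show ?thesis by (metis (no_types, lifting) integral_cong)
    qed
    finally show ?thesis using y1[of 0] by simp
  qed
qed

section \<open>The Volterra equation for large spectral parameter\<close>

text \<open>The constant \<open>3\<close>, here and below, is an upper bound of \<open>exp 1\<close>.\<close>
lemma norm_trig_le:
  fixes z :: complex
  assumes "\<bar>Im z\<bar> \<le> 1"
  shows "norm (sin z) \<le> 3" "norm (cos z) \<le> 3"
proof -
  have e: "norm (exp (\<i> * z)) \<le> 3" "norm (exp (- (\<i> * z))) \<le> 3"
    using assms exp_le by (auto simp: norm_exp_eq_Re intro: order_trans[of _ "exp 1"])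
  have "norm (exp (\<i> * z) - exp (- (\<i> * z))) \<le> 6" "norm (exp (\<i> * z) + exp (- (\<i> * z))) \<le> 6"
    using norm_triangle_ineq4[of "exp (\<i> * z)" "exp (- (\<i> * z))"]
      norm_triangle_ineq[of "exp (\<i> * z)" "exp (- (\<i> * z))"] e by linarith+
  then show "norm (sin z) \<le> 3" "norm (cos z) \<le> 3"
    by (auto simp: sin_exp_eq cos_exp_eq norm_divide norm_mult)
qed

lemma norm_trig_diff_le:
  fixes z w :: complex
  assumes "\<bar>Im z\<bar> \<le> 1" "\<bar>Im w\<bar> \<le> 1"
  shows "norm (sin z - sin w) \<le> 3 * norm (z - w)" "norm (cos z - cos w) \<le> 3 * norm (z - w)"
proof -
  have "{z. \<bar>Im z\<bar> \<le> 1} = {z. Im z \<le> 1} \<inter> {z. Im z \<ge> - 1}" by auto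
  then have conv: "convex {z. \<bar>Im z\<bar> \<le> 1}"
    by (simp add: convex_Int convex_halfspace_Im_le convex_halfspace_Im_ge)
  show "norm (sin z - sin w) \<le> 3 * norm (z - w)"
    by (rule field_differentiable_bound[OF conv, of sin cos])
      (use assms norm_trig_le in \<open>auto intro: DERIV_subset[OF DERIV_sin]\<close>)
  show "norm (cos z - cos w) \<le> 3 * norm (z - w)"
    by (rule field_differentiable_bound[OF conv, of cos "\<lambda>z. - sin z"])
      (use assms norm_trig_le in \<open>auto intro: DERIV_subset[OF DERIV_cos]\<close>)
qed

locale potential =
  fixes q :: "real \<Rightarrow> complex"
  assumes q_absint: "q absolutely_integrable_on {0..1}"
begin

definition qnorm :: real where
  "qnorm = integral {0..1} (\<lambda>t. norm (q t))"

lemma norm_q_integrable: "(\<lambda>t. norm (q t)) integrable_on {0..1}"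
  using q_absint absolutely_integrable_on_def by blast

lemma qnorm_nonneg: "qnorm \<ge> 0"
  unfolding qnorm_def by (rule integral_nonneg[OF norm_q_integrable]) simp

lemma norm_integral_mult_q_le:
  assumes g: "continuous_on {0..1} g" and M: "\<And>t. t \<in> {0..x} \<Longrightarrow> norm (g t) \<le> M" and x: "x \<in> {0..1}"
  shows "norm (integral {0..x} (\<lambda>t. g t * q t)) \<le> M * qnorm"
proof -
  have M0: "M \<ge> 0" using M[of 0] x norm_ge_zero[of "g 0"] by (auto intro: order_trans simp del: norm_ge_zero)
  have i: "(\<lambda>t. norm (q t)) integrable_on {0..x}"
    using norm_q_integrable x integrable_on_subinterval[of _ "{0..1}" 0 x] by auto
  have "norm (integral {0..x} (\<lambda>t. g t * q t)) \<le> integral {0..x} (\<lambda>t. M * norm (q t))"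
    by (intro integral_norm_bound_integral absint_imp_integrable_on[OF _ x] absint_continuous_mult g q_absint
         integrable_on_mult_right i) (use M in \<open>auto simp: norm_mult intro: mult_right_mono\<close>)
  also have "\<dots> = M * integral {0..x} (\<lambda>t. norm (q t))" by simp
  also have "\<dots> \<le> M * qnorm"
    unfolding qnorm_def using x
    by (intro mult_left_mono[OF _ M0] integral_subset_le i norm_q_integrable) auto
  finally show ?thesis .
qed

definition kern :: "(complex \<Rightarrow> complex) \<Rightarrow> complex \<Rightarrow> (real \<Rightarrow> complex) \<Rightarrow> real \<Rightarrow> complex" where
  "kern T \<rho> y x = conv T \<rho> (\<lambda>t. y t * q t) x"

lemma trig_continuous:
  "T \<in> {sin, cos} \<Longrightarrow> continuous_on {0..1} (\<lambda>t::real. T ((\<rho>::complex) * of_real (x - t)))"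
  by (auto intro!: continuous_intros)

lemma kern_integrable:
  assumes "T \<in> {sin, cos}" "continuous_on {0..1} y" "x \<in> {0..1}"
  shows "(\<lambda>t. T (\<rho> * of_real (x - t)) * (y t * q t)) integrable_on {0..x}"
  by (intro absint_imp_integrable_on[OF _ assms(3)] absint_continuous_mult trig_continuous q_absint assms)

lemma Im_mult_of_real_le:
  assumes "\<bar>Im \<rho>\<bar> \<le> 1" "u \<in> {0..1::real}"
  shows "\<bar>Im (\<rho> * of_real u)\<bar> \<le> 1"
  using assms by (auto simp: abs_mult intro: mult_le_one)

lemma kern_bound:
  assumes T: "T \<in> {sin, cos}" and \<rho>: "\<bar>Im \<rho>\<bar> \<le> 1" and y: "continuous_on {0..1} y"
    and M: "\<And>t. t \<in> {0..1} \<Longrightarrow> norm (y t) \<le> M" and x: "x \<in> {0..1}"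
  shows "norm (kern T \<rho> y x) \<le> 3 * M * qnorm"
proof -
  have "norm (integral {0..x} (\<lambda>t. (T (\<rho> * of_real (x - t)) * y t) * q t)) \<le> 3 * M * qnorm"
  proof (rule norm_integral_mult_q_le[OF _ _ x])
    show "continuous_on {0..1} (\<lambda>t. T (\<rho> * of_real (x - t)) * y t)"
      by (intro continuous_on_mult trig_continuous T y)
    fix t assume t: "t \<in> {0..x}"
    have "norm (T (\<rho> * of_real (x - t))) \<le> 3"
      using T norm_trig_le[OF Im_mult_of_real_le[OF \<rho>, of "x - t"]] t x by auto
    then show "norm (T (\<rho> * of_real (x - t)) * y t) \<le> 3 * M"
      using M[of t] t x by (auto simp: norm_mult intro: mult_mono)
  qed
  then show ?thesis by (simp add: kern_def mult.assoc)
qed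

lemma kern_lipschitz:
  assumes T: "T \<in> {sin, cos}" and \<rho>: "\<bar>Im \<rho>\<bar> \<le> 1" "\<bar>Im \<sigma>\<bar> \<le> 1" and y: "continuous_on {0..1} y"
    and M: "\<And>t. t \<in> {0..1} \<Longrightarrow> norm (y t) \<le> M" and x: "x \<in> {0..1}"
  shows "norm (kern T \<rho> y x - kern T \<sigma> y x) \<le> 3 * norm (\<rho> - \<sigma>) * M * qnorm"
proof -
  have "kern T \<rho> y x - kern T \<sigma> y x =
      integral {0..x} (\<lambda>t. ((T (\<rho> * of_real (x - t)) - T (\<sigma> * of_real (x - t))) * y t) * q t)"
    unfolding kern_def
    by (subst integral_diff[symmetric]) (intro kern_integrable T y x | simp add: algebra_simps)+
  also have "norm \<dots> \<le> 3 * norm (\<rho> - \<sigma>) * M * qnorm"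
  proof (rule norm_integral_mult_q_le[OF _ _ x])
    show "continuous_on {0..1} (\<lambda>t. (T (\<rho> * of_real (x - t)) - T (\<sigma> * of_real (x - t))) * y t)"
      by (intro continuous_on_mult continuous_on_diff trig_continuous T y)
    fix t assume t: "t \<in> {0..x}"
    have u: "x - t \<in> {0..1}" using t x by auto
    have "norm (T (\<rho> * of_real (x - t)) - T (\<sigma> * of_real (x - t))) 
        \<le> 3 * norm (\<rho> * of_real (x - t) - \<sigma> * of_real (x - t))"
      using T norm_trig_diff_le[OF Im_mult_of_real_le[OF \<rho>(1) u] Im_mult_of_real_le[OF \<rho>(2) u]] by auto
    also have "\<dots> = 3 * (norm (\<rho> - \<sigma>) * \<bar>x - t\<bar>)"
      by (metis left_diff_distrib norm_mult norm_of_real)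
    also have "\<dots> \<le> 3 * norm (\<rho> - \<sigma>)"
      using u by (simp add: mult_left_le)
    finally show "norm ((T (\<rho> * of_real (x - t)) - T (\<sigma> * of_real (x - t))) * y t) \<le> 3 * norm (\<rho> - \<sigma>) * M"
      using M[of t] t x by (auto simp: norm_mult intro: mult_mono)
  qed
  finally show ?thesis .
qed

lemma kern_linear:
  assumes T: "T \<in> {sin, cos}" and y: "continuous_on {0..1} y" "continuous_on {0..1} z" and x: "x \<in> {0..1}"
  shows "kern T \<rho> (\<lambda>t. a * y t + b * z t) x = a * kern T \<rho> y x + b * kern T \<rho> z x"
proof -
  have "a * kern T \<rho> y x + b * kern T \<rho> z x =
    integral {0..x} (\<lambda>t. a * (T (\<rho> * of_real (x - t)) * (y t * q t)) + b * (T (\<rho> * of_real (x - t)) * (z t * q t)))"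
    unfolding kern_def
    by (subst integral_add) (intro integrable_on_mult_right kern_integrable T y x | simp)+
  then show ?thesis unfolding kern_def by (simp add: algebra_simps)
qed

lemma kern_diff:
  assumes "T \<in> {sin, cos}" "continuous_on {0..1} y" "continuous_on {0..1} z" "x \<in> {0..1}"
  shows "kern T \<rho> (\<lambda>t. y t - z t) x = kern T \<rho> y x - kern T \<rho> z x"
  using kern_linear[OF assms, of \<rho> 1 "-1"] by simp

lemma kern_cong:
  assumes "\<And>t. t \<in> {0..1} \<Longrightarrow> y t = z t" "x \<in> {0..1}"
  shows "kern T \<rho> y x = kern T \<rho> z x"
  unfolding kern_def by (rule integral_cong) (use assms in auto)

text \<open>By variation of constants \<open>kern sin \<rho> y / \<rho>\<close> is even differentiable.\<close>
lemma kern_sin_continuous: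
  assumes y: "continuous_on {0..1} y" and \<rho>: "\<rho> \<noteq> 0"
  shows "continuous_on {0..1} (kern sin \<rho> y)"
proof -
  have "((\<lambda>x. kern sin \<rho> y x / \<rho>) has_vector_derivative kern cos \<rho> y x) (at x within {0..1})" if "x \<in> {0..1}" for x
    by (rule variation_of_constants_converse(1)[of "\<lambda>t. y t * q t" \<rho> "\<lambda>x. kern sin \<rho> y x / \<rho>" 0 0])
      (use that \<rho> absint_continuous_mult[OF y q_absint] in \<open>auto simp: kern_def\<close>)
  then have "continuous_on {0..1} (\<lambda>x. kern sin \<rho> y x / \<rho>)"
    using continuous_on_vector_derivative by blast
  then have "continuous_on {0..1} (\<lambda>x. \<rho> * (kern sin \<rho> y x / \<rho>))" by (rule continuous_on_mult_left)
  then show ?thesis using \<rho> by simp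
qed

text \<open>The convolution kernels are bounded by \<open>3\<close> on the strip, so \<open>6 * qnorm \<le> norm \<rho>\<close> makes the
  Volterra operator a contraction with constant \<open>1/2\<close>; the summand \<open>1\<close> gives
  \<open>1 / norm \<rho> \<le> 1\<close> as well.\<close>
definition admissible :: "complex \<Rightarrow> bool" where
  "admissible \<rho> \<longleftrightarrow> \<bar>Im \<rho>\<bar> \<le> 1 \<and> 6 * qnorm + 1 \<le> norm \<rho>"

lemma admissibleD:
  assumes "admissible \<rho>"
  shows "\<bar>Im \<rho>\<bar> \<le> 1" "1 \<le> norm \<rho>" "6 * qnorm \<le> norm \<rho>" "\<rho> \<noteq> 0"
  using assms qnorm_nonneg unfolding admissible_def by auto

definition volterra :: "(real \<Rightarrow> complex) \<Rightarrow> complex \<Rightarrow> (real \<Rightarrow> complex) \<Rightarrow> bool" where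
  "volterra \<phi> \<rho> y \<longleftrightarrow> continuous_on {0..1} y \<and> (\<forall>x\<in>{0..1}. y x = \<phi> x + kern sin \<rho> y x / \<rho>)"

lemma kern_contraction:
  assumes "admissible \<rho>" "continuous_on {0..1} y" "\<And>t. t \<in> {0..1} \<Longrightarrow> norm (y t) \<le> M" "x \<in> {0..1}"
  shows "norm (kern sin \<rho> y x / \<rho>) \<le> M / 2"
proof -
  have M0: "M \<ge> 0" using assms(3)[of 0] norm_ge_zero[of "y 0"] by (auto intro: order_trans simp del: norm_ge_zero)
  have "norm (kern sin \<rho> y x) \<le> 3 * M * qnorm"
    using kern_bound[of sin \<rho> y M x] assms admissibleD by auto
  also have "\<dots> \<le> M / 2 * norm \<rho>" 
    using mult_left_mono[OF admissibleD(3)[OF assms(1)] M0] by simp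
  finally show ?thesis using admissibleD(4)[OF assms(1)] by (simp add: norm_divide divide_le_eq)
qed

text \<open>At a point where \<open>norm (y x)\<close> is maximal the integral term is at most half of this maximum.\<close>
lemma volterra_bound:
  assumes \<rho>: "admissible \<rho>" and y: "volterra \<phi> \<rho> y" and M: "\<And>t. t \<in> {0..1} \<Longrightarrow> norm (\<phi> t) \<le> M"
    and x: "x \<in> {0..1}"
  shows "norm (y x) \<le> 2 * M"
proof -
  have c: "continuous_on {0..1} y" using y by (simp add: volterra_def)
  have "continuous_on {0..1} (\<lambda>t. norm (y t))" by (intro continuous_intros c)
  then obtain x0 where x0: "x0 \<in> {0..1}" "\<And>t. t \<in> {0..1} \<Longrightarrow> norm (y t) \<le> norm (y x0)"
    using continuous_attains_sup[of "{0..1::real}" "\<lambda>t. norm (y t)"] by auto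
  have "norm (kern sin \<rho> y x0 / \<rho>) \<le> norm (y x0) / 2"
    by (rule kern_contraction[OF \<rho> c x0(2) x0(1)])
  moreover have "norm (y x0) \<le> norm (\<phi> x0) + norm (kern sin \<rho> y x0 / \<rho>)"
    using y x0(1) norm_triangle_ineq unfolding volterra_def by metis
  ultimately have "norm (y x0) \<le> 2 * M" using M[OF x0(1)] by linarith
  then show ?thesis using x0(2)[OF x] by linarith
qed

lemma volterra_linear:
  assumes "volterra \<phi> \<rho> y" "volterra \<psi> \<rho> z"
  shows "volterra (\<lambda>x. a * \<phi> x + b * \<psi> x) \<rho> (\<lambda>x. a * y x + b * z x)"
proof -
  have c: "continuous_on {0..1} y" "continuous_on {0..1} z" using assms by (auto simp: volterra_def)
  have "a * y x + b * z x = a * \<phi> x + b * \<psi> x + kern sin \<rho> (\<lambda>x. a * y x + b * z x) x / \<rho>" if x: "x \<in> {0..1}" for x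
  proof -
    have "y x = \<phi> x + kern sin \<rho> y x / \<rho>" "z x = \<psi> x + kern sin \<rho> z x / \<rho>"
      using assms x by (auto simp: volterra_def)
    then have "a * y x + b * z x = a * (\<phi> x + kern sin \<rho> y x / \<rho>) + b * (\<psi> x + kern sin \<rho> z x / \<rho>)" by simp
    then show ?thesis using kern_linear[OF _ c x, of sin \<rho> a b] by (simp add: add_divide_distrib algebra_simps)
  qed
  moreover have "continuous_on {0..1} (\<lambda>x. a * y x + b * z x)" by (intro continuous_intros c)
  ultimately show ?thesis by (simp add: volterra_def)
qed

lemma volterra_unique:
  assumes "admissible \<rho>" "volterra \<phi> \<rho> y" "volterra \<phi> \<rho> z" "x \<in> {0..1}"
  shows "y x = z x"
  using volterra_bound[OF assms(1) volterra_linear[OF assms(2,3), of 1 "-1"], of 0 x] assms(4) by simp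

text \<open>Banach's fixed point theorem in the space of bounded continuous functions on the real line;
  functions on \<open>[0,1]\<close> are continued by constants, that is, composed with the retraction \<open>cl\<close>.\<close>
lemma volterra_exists:
  assumes \<rho>: "admissible \<rho>" and \<phi>: "continuous_on {0..1} \<phi>"
  shows "\<exists>y. volterra \<phi> \<rho> y"
proof -
  define cl where "cl = (\<lambda>x::real. max 0 (min 1 x))"
  have cl: "cl x \<in> {0..1}" "x \<in> {0..1} \<Longrightarrow> cl x = x" for x by (auto simp: cl_def)
  have contcl: "continuous_on UNIV cl" unfolding cl_def by (intro continuous_intros)
  define \<Phi> where "\<Phi> = (\<lambda>f :: real \<Rightarrow>\<^sub>C complex. \<lambda>x. \<phi> (cl x) + kern sin \<rho> (apply_bcontfun f) (cl x) / \<rho>)"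
  have \<Phi>: "\<Phi> f \<in> bcontfun" for f
  proof -
    define h where "h = (\<lambda>x. \<phi> x + kern sin \<rho> (apply_bcontfun f) x / \<rho>)"
    have h: "continuous_on {0..1} h" unfolding h_def
      by (intro continuous_intros \<phi> kern_sin_continuous) (use admissibleD(4)[OF \<rho>] in auto)
    have "continuous_on UNIV (\<lambda>x. h (cl x))"
      using continuous_on_compose2[OF h contcl] cl by blast
    moreover have "bounded (range (\<lambda>x. h (cl x)))"
    proof (rule bounded_subset)
      show "bounded (h ` {0..1})" by (intro compact_imp_bounded compact_continuous_image h) auto
    qed (use cl(1) in blast)
    ultimately show ?thesis unfolding bcontfun_def \<Phi>_def h_def by simp
  qed
  define \<Psi> where "\<Psi> = (\<lambda>f. Bcontfun (\<Phi> f))"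
  have app: "apply_bcontfun (\<Psi> f) = \<Phi> f" for f using \<Phi> by (simp add: \<Psi>_def Bcontfun_inverse)
  have "dist (\<Psi> f) (\<Psi> g) \<le> 1 / 2 * dist f g" for f g
  proof (rule dist_bound)
    fix x
    have "\<Phi> f x - \<Phi> g x = kern sin \<rho> (\<lambda>t. f t - g t) (cl x) / \<rho>"
      unfolding \<Phi>_def by (subst kern_diff) (use cl in \<open>auto simp: diff_divide_distrib\<close>)
    also have "norm \<dots> \<le> dist f g / 2"
      by (rule kern_contraction[OF \<rho>])
        (use dist_bounded[of f _ g] cl in \<open>auto simp: dist_norm[symmetric] intro!: continuous_intros\<close>)
    finally show "dist (\<Psi> f x) (\<Psi> g x) \<le> 1 / 2 * dist f g" by (simp add: app dist_norm)
  qed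
  then obtain f where f: "\<Psi> f = f" using banach_fix_type[of "1/2" \<Psi>] by auto
  have "volterra \<phi> \<rho> f"
    unfolding volterra_def
  proof (intro conjI ballI)
    fix x :: real assume "x \<in> {0..1}"
    then show "f x = \<phi> x + kern sin \<rho> f x / \<rho>"
      using arg_cong[OF f, of "\<lambda>f. apply_bcontfun f x"] cl unfolding app by (simp add: \<Phi>_def)
  qed simp
  then show ?thesis by blast
qed

lemma norm_inverse_diff_le:
  assumes "admissible \<rho>" "admissible \<sigma>"
  shows "norm (1 / \<rho> - 1 / \<sigma>) \<le> norm (\<rho> - \<sigma>) / norm \<rho>"
proof -
  note r = admissibleD[OF assms(1)] and s = admissibleD[OF assms(2)]
  have "1 / \<rho> - 1 / \<sigma> = (\<sigma> - \<rho>) / \<rho> / \<sigma>" using r(4) s(4) by (simp add: field_simps)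
  then have "norm (1 / \<rho> - 1 / \<sigma>) = norm (\<rho> - \<sigma>) / norm \<rho> / norm \<sigma>" by (simp add: norm_divide norm_mult norm_minus_commute)
  also have "\<dots> \<le> norm (\<rho> - \<sigma>) / norm \<rho>"
    using divide_left_mono[OF s(2), of "norm (\<rho> - \<sigma>) / norm \<rho>"] s(2,4) by simp
  finally show ?thesis .
qed

lemma norm_div_diff_le:
  assumes "admissible \<rho>" "admissible \<sigma>" "norm (k - l) \<le> A * norm (\<rho> - \<sigma>)" "norm l \<le> B"
  shows "norm (k / \<rho> - l / \<sigma>) \<le> (A + B) * norm (\<rho> - \<sigma>) / norm \<rho>"
proof -
  have "k / \<rho> - l / \<sigma> = (k - l) / \<rho> + l * (1 / \<rho> - 1 / \<sigma>)" by (simp add: algebra_simps diff_divide_distrib)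
  also have "norm \<dots> \<le> norm (k - l) / norm \<rho> + norm l * norm (1 / \<rho> - 1 / \<sigma>)"
    by (metis norm_divide norm_mult norm_triangle_ineq)
  also have "\<dots> \<le> A * norm (\<rho> - \<sigma>) / norm \<rho> + B * (norm (\<rho> - \<sigma>) / norm \<rho>)"
    using assms norm_inverse_diff_le[OF assms(1,2)] order_trans[OF norm_ge_zero assms(4)]
    by (intro add_mono divide_right_mono mult_mono) auto
  finally show ?thesis by (simp add: algebra_simps add_divide_distrib)
qed

text \<open>The difference \<open>y - z\<close> solves the Volterra equation at \<open>\<sigma>\<close> whose inhomogeneity collects the
  change of the free term and the change of the kernel.\<close>
lemma volterra_lipschitz:
  assumes \<rho>: "admissible \<rho>" and \<sigma>: "admissible \<sigma>"
    and y: "volterra \<phi> \<rho> y" and z: "volterra \<psi> \<sigma> z"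
    and \<phi>: "\<And>t. t \<in> {0..1} \<Longrightarrow> norm (\<phi> t) \<le> 3"
    and d: "\<And>t. t \<in> {0..1} \<Longrightarrow> norm (\<phi> t - \<psi> t) \<le> 3 * norm (\<rho> - \<sigma>)"
    and x: "x \<in> {0..1}"
  shows "norm (y x - z x) \<le> 18 * norm (\<rho> - \<sigma>)"
proof -
  have cy: "continuous_on {0..1} y" and cz: "continuous_on {0..1} z" using y z by (auto simp: volterra_def)
  define \<theta> where "\<theta> = (\<lambda>x. (\<phi> x - \<psi> x) + (kern sin \<rho> y x / \<rho> - kern sin \<sigma> y x / \<sigma>))"
  have y6: "norm (y t) \<le> 6" if "t \<in> {0..1}" for t using volterra_bound[OF \<rho> y \<phi> that] by simp
  have "volterra \<theta> \<sigma> (\<lambda>x. y x - z x)"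
    unfolding volterra_def
  proof (intro conjI ballI)
    show "continuous_on {0..1} (\<lambda>x. y x - z x)" by (intro continuous_intros cy cz)
    fix x :: real assume x: "x \<in> {0..1}"
    have "y x = \<phi> x + kern sin \<rho> y x / \<rho>" "z x = \<psi> x + kern sin \<sigma> z x / \<sigma>"
      using y z x by (auto simp: volterra_def)
    then show "y x - z x = \<theta> x + kern sin \<sigma> (\<lambda>x. y x - z x) x / \<sigma>"
      using kern_diff[OF _ cy cz x, of sin \<sigma>] by (simp add: \<theta>_def diff_divide_distrib)
  qed
  moreover have "norm (\<theta> t) \<le> 9 * norm (\<rho> - \<sigma>)" if t: "t \<in> {0..1}" for t
  proof -
    have "norm (kern sin \<rho> y t / \<rho> - kern sin \<sigma> y t / \<sigma>) \<le> (18 * qnorm + 18 * qnorm) * norm (\<rho> - \<sigma>) / norm \<rho>"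
      using kern_lipschitz[of sin \<rho> \<sigma> y 6 t] kern_bound[of sin \<sigma> y 6 t] admissibleD[OF \<rho>] admissibleD[OF \<sigma>] cy y6 t
      by (intro norm_div_diff_le \<rho> \<sigma>) (auto simp: algebra_simps)
    also have "\<dots> = 6 * norm (\<rho> - \<sigma>) * (6 * qnorm / norm \<rho>)" by simp
    also have "\<dots> \<le> 6 * norm (\<rho> - \<sigma>) * 1"
      using admissibleD[OF \<rho>] by (intro mult_left_mono) (auto simp: divide_le_eq)
    finally show ?thesis
      using d[OF t] norm_triangle_ineq[of "\<phi> t - \<psi> t" "kern sin \<rho> y t / \<rho> - kern sin \<sigma> y t / \<sigma>"]
      unfolding \<theta>_def by linarith
  qed
  ultimately show ?thesis using volterra_bound[OF \<sigma>, of \<theta> "\<lambda>x. y x - z x" "9 * norm (\<rho> - \<sigma>)" x] x by simp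
qed

end

section \<open>Fundamental solutions and the boundary determinant\<close>

context potential
begin

text \<open>\<open>fund cos \<rho>\<close> solves the differential equation with initial values \<open>y 0 = 1\<close>, \<open>y' 0 = 0\<close>, and
  \<open>fund sin \<rho>\<close> with \<open>y 0 = 0\<close>, \<open>y' 0 = \<rho>\<close>; the second is scaled so that both are of size one.\<close>
definition fund :: "(complex \<Rightarrow> complex) \<Rightarrow> complex \<Rightarrow> real \<Rightarrow> complex" where
  "fund T \<rho> = (SOME y. volterra (\<lambda>x. T (\<rho> * of_real x)) \<rho> y)"

lemma fund_volterra:
  assumes "T \<in> {sin, cos}" "admissible \<rho>"
  shows "volterra (\<lambda>x. T (\<rho> * of_real x)) \<rho> (fund T \<rho>)"
  unfolding fund_def
  by (rule someI_ex[of "volterra (\<lambda>x. T (\<rho> * of_real x)) \<rho>"], rule volterra_exists) (use assms in \<open>auto intro!: continuous_intros\<close>)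

lemma fund_continuous:
  assumes "T \<in> {sin, cos}" "admissible \<rho>"
  shows "continuous_on {0..1} (fund T \<rho>)"
  using fund_volterra[OF assms] by (simp add: volterra_def)

lemma norm_trig_mult_le:
  assumes "T \<in> {sin, cos}" "\<bar>Im \<rho>\<bar> \<le> 1" "x \<in> {0..1::real}"
  shows "norm (T (\<rho> * of_real x)) \<le> 3"
  using norm_trig_le[OF Im_mult_of_real_le[OF assms(2,3)]] assms(1) by auto

lemma norm_trig_mult_diff_le:
  assumes "T \<in> {sin, cos}" "\<bar>Im \<rho>\<bar> \<le> 1" "\<bar>Im \<sigma>\<bar> \<le> 1" "x \<in> {0..1::real}"
  shows "norm (T (\<rho> * of_real x) - T (\<sigma> * of_real x)) \<le> 3 * norm (\<rho> - \<sigma>)"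
proof -
  have "norm (T (\<rho> * of_real x) - T (\<sigma> * of_real x)) \<le> 3 * norm (\<rho> * of_real x - \<sigma> * of_real x)"
    using norm_trig_diff_le[OF Im_mult_of_real_le[OF assms(2,4)] Im_mult_of_real_le[OF assms(3,4)]] assms(1) by auto
  also have "\<dots> = 3 * (norm (\<rho> - \<sigma>) * \<bar>x\<bar>)"
    by (metis left_diff_distrib norm_mult norm_of_real)
  also have "\<dots> \<le> 3 * norm (\<rho> - \<sigma>)" using assms(4) by (simp add: mult_left_le)
  finally show ?thesis .
qed

lemma fund_bound:
  assumes "T \<in> {sin, cos}" "admissible \<rho>" "x \<in> {0..1}"
  shows "norm (fund T \<rho> x) \<le> 6"
  using volterra_bound[OF assms(2) fund_volterra[OF assms(1,2)] _ assms(3), of 3]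
    norm_trig_mult_le[OF assms(1)] admissibleD(1)[OF assms(2)] by auto

lemma fund_lipschitz:
  assumes "T \<in> {sin, cos}" "admissible \<rho>" "admissible \<sigma>" "x \<in> {0..1}"
  shows "norm (fund T \<rho> x - fund T \<sigma> x) \<le> 18 * norm (\<rho> - \<sigma>)"
  by (rule volterra_lipschitz[OF assms(2,3) fund_volterra[OF assms(1,2)] fund_volterra[OF assms(1,3)] _ _ assms(4)])
    (use norm_trig_mult_le[OF assms(1)] norm_trig_mult_diff_le[OF assms(1)] admissibleD(1) assms in auto)

lemma fund_near_trig:
  assumes "T \<in> {sin, cos}" "admissible \<rho>" "x \<in> {0..1}"
  shows "norm (fund T \<rho> x - T (\<rho> * of_real x)) \<le> 18 * qnorm / norm \<rho>"
proof -
  have "fund T \<rho> x - T (\<rho> * of_real x) = kern sin \<rho> (fund T \<rho>) x / \<rho>"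
    using fund_volterra[OF assms(1,2)] assms(3) by (simp add: volterra_def)
  moreover have "norm (kern sin \<rho> (fund T \<rho>) x) \<le> 3 * 6 * qnorm"
    by (rule kern_bound) (use assms fund_bound fund_continuous admissibleD(1) in auto)
  ultimately show ?thesis by (simp add: norm_divide divide_right_mono)
qed

text \<open>The amount by which \<open>q\<close> changes \<open>y 1\<close> (for \<open>K = sin\<close>) and \<open>y' 1 / \<rho>\<close> (for \<open>K = cos\<close>) of the
  solution \<open>y = fund T \<rho>\<close>.\<close>
definition bdry :: "(complex \<Rightarrow> complex) \<Rightarrow> (complex \<Rightarrow> complex) \<Rightarrow> complex \<Rightarrow> complex" where
  "bdry K T \<rho> = kern K \<rho> (fund T \<rho>) 1 / \<rho>"

lemma bdry_bound:
  assumes "K \<in> {sin, cos}" "T \<in> {sin, cos}" "admissible \<rho>"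
  shows "norm (bdry K T \<rho>) \<le> 18 * qnorm / norm \<rho>"
proof -
  have "norm (kern K \<rho> (fund T \<rho>) 1) \<le> 3 * 6 * qnorm"
    by (rule kern_bound) (use assms fund_bound fund_continuous admissibleD(1) in auto)
  then show ?thesis by (simp add: bdry_def norm_divide divide_right_mono)
qed

lemma bdry_lipschitz:
  assumes K: "K \<in> {sin, cos}" and T: "T \<in> {sin, cos}" and \<rho>: "admissible \<rho>" and \<sigma>: "admissible \<sigma>"
  shows "norm (bdry K T \<rho> - bdry K T \<sigma>) \<le> 90 * qnorm / norm \<rho> * norm (\<rho> - \<sigma>)"
proof -
  note f = fund_continuous[OF T \<rho>] fund_continuous[OF T \<sigma>]
  note I = admissibleD(1)[OF \<rho>] admissibleD(1)[OF \<sigma>]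
  have 1: "norm (kern K \<rho> (fund T \<rho>) 1 - kern K \<sigma> (fund T \<rho>) 1) \<le> 3 * norm (\<rho> - \<sigma>) * 6 * qnorm"
    by (rule kern_lipschitz[OF K I f(1)]) (use fund_bound[OF T \<rho>] in auto)
  have 2: "norm (kern K \<sigma> (\<lambda>x. fund T \<rho> x - fund T \<sigma> x) 1) \<le> 3 * (18 * norm (\<rho> - \<sigma>)) * qnorm"
    by (rule kern_bound[OF K I(2)]) (use fund_lipschitz[OF T \<rho> \<sigma>] f in \<open>auto intro: continuous_intros\<close>)
  have "kern K \<rho> (fund T \<rho>) 1 - kern K \<sigma> (fund T \<sigma>) 1 =
     (kern K \<rho> (fund T \<rho>) 1 - kern K \<sigma> (fund T \<rho>) 1) + kern K \<sigma> (\<lambda>x. fund T \<rho> x - fund T \<sigma> x) 1"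
    using kern_diff[OF K f, of 1 \<sigma>] by simp
  then have A: "norm (kern K \<rho> (fund T \<rho>) 1 - kern K \<sigma> (fund T \<sigma>) 1) \<le> 72 * qnorm * norm (\<rho> - \<sigma>)"
    using norm_triangle_mono[OF 1 2] by (simp add: algebra_simps)
  have B: "norm (kern K \<sigma> (fund T \<sigma>) 1) \<le> 18 * qnorm"
    using kern_bound[OF K I(2) f(2), of 6 1] fund_bound[OF T \<sigma>] by auto
  show ?thesis using norm_div_diff_le[OF \<rho> \<sigma> A B] by (simp add: bdry_def)
qed

lemma integral_trig_bound:
  assumes T: "T \<in> {sin, cos}" and \<rho>: "\<bar>Im \<rho>\<bar> \<le> 1" and v: "continuous_on {0..1} v"
    and V: "\<And>t. t \<in> {0..1} \<Longrightarrow> norm (v t) \<le> V" and x: "x \<in> {0..1::real}"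
  shows "norm (conv T \<rho> v x) \<le> 3 * V"
proof -
  have V0: "V \<ge> 0" using V[of 0] norm_ge_zero[of "v 0"] by (auto intro: order_trans simp del: norm_ge_zero)
  have "norm (conv T \<rho> v x) \<le> 3 * V * (x - 0)"
  proof (rule integral_bound)
    show "continuous_on {0..x} (\<lambda>t. T (\<rho> * of_real (x - t)) * v t)"
      by (rule continuous_on_subset[of "{0..1}"]) (use x T v in \<open>auto intro!: continuous_intros\<close>)
    fix t assume t: "t \<in> {0..x}"
    have "norm (T (\<rho> * of_real (x - t))) \<le> 3"
      using norm_trig_mult_le[OF T \<rho>, of "x - t"] t x by auto
    then show "norm (T (\<rho> * of_real (x - t)) * v t) \<le> 3 * V"
      using V[of t] t x by (auto simp: norm_mult intro: mult_mono)
  qed (use x in auto)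
  also have "\<dots> \<le> 3 * V" using x V0 by (simp add: mult_left_le)
  finally show ?thesis .
qed

text \<open>The graph of the operator in a form without null sets.  The term \<open>h\<close> is \<open>0\<close> for
  eigenfunctions and the preceding root function for associated functions.\<close>
lemma T2D:
  assumes T: "T2 q \<beta> y (\<lambda>x. \<mu> * y x + h x)" and h: "continuous_on {0..1} h"
  obtains y1 where
    "\<And>x. x \<notin> {0..1} \<Longrightarrow> y x = 0"
    "\<And>x. x \<in> {0..1} \<Longrightarrow> (y has_vector_derivative y1 x) (at x within {0..1})"
    "\<And>x. x \<in> {0..1} \<Longrightarrow> y1 x = y1 0 + integral {0..x} (\<lambda>t. y t * q t - \<mu> * y t - h t)"
    "y1 0 + \<beta> * y1 1 = 0" "y 0 + y 1 = 0"
proof -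
  have a: "(\<forall>x. x \<notin> {0..1} \<longrightarrow> y x = 0) \<and>
     (\<exists>y1 y2.
        (\<forall>x\<in>{0..1}. (y has_vector_derivative y1 x) (at x within {0..1})) \<and>
        ac_derivative y1 y2 \<and>
        (AE x in leb01. \<mu> * y x + h x = - y2 x + q x * y x) \<and>
        y1 0 + \<beta> * y1 1 = 0 \<and> y 0 + y 1 = 0)"
    using T unfolding T2_def by simp
  then obtain y1 y2 where y': 
    "\<forall>x\<in>{0..1}. (y has_vector_derivative y1 x) (at x within {0..1})"
    "ac_derivative y1 y2" and y: "AE x in leb01. \<mu> * y x + h x = - y2 x + q x * y x" 
    "y1 0 + \<beta> * y1 1 = 0" "y 0 + y 1 = 0"
    by (elim exE conjE)
  have y2: "y2 absolutely_integrable_on {0..1}" "\<And>x. x \<in> {0..1} \<Longrightarrow> y1 x = y1 0 + (LINT t|lebesgue_on {0..x}. y2 t)"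
    using y'(2) unfolding ac_derivative_def integrable_leb01_iff by blast+
  have "AE x in lebesgue. x \<in> {0..1} \<longrightarrow> \<mu> * y x + h x = - y2 x + q x * y x"
    using y(1) by (simp add: AE_restrict_space_iff)
  then obtain N where N: "N \<in> null_sets lebesgue" "\<And>x. x \<in> {0..1} - N \<Longrightarrow> \<mu> * y x + h x = - y2 x + q x * y x"
    by (auto elim!: AE_E3)
  have neg: "negligible N" using N(1) by (simp add: negligible_iff_null_sets)
  have "y1 x = y1 0 + integral {0..x} (\<lambda>t. y t * q t - \<mu> * y t - h t)" if x: "x \<in> {0..1}" for x
  proof -
    have "(LINT t|lebesgue_on {0..x}. y2 t) = integral {0..x} y2"
      using lebesgue_integral_subinterval[OF y2(1), of 0 x] x by simp
    also have "\<dots> = integral {0..x} (\<lambda>t. y t * q t - \<mu> * y t - h t)"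
      by (rule integral_spike[OF neg]) (use N(2) x in \<open>force simp: algebra_simps\<close>)
    finally show ?thesis using y2(2)[OF x] by simp
  qed
  then show ?thesis using that[of y1] a y' y(2,3) by blast
qed

lemma continuous_in_L2:
  assumes "continuous_on {0..1} f"
  shows "f \<in> L2"
proof -
  have "f \<in> borel_measurable leb01"
    using assms by (intro continuous_imp_measurable_on_sets_lebesgue) auto
  moreover have "integrable leb01 (\<lambda>x. (norm (f x))\<^sup>2)"
    by (intro continuous_imp_integrable_real continuous_intros assms)
  ultimately show ?thesis by (simp add: L2_def)
qed

lemma T2I:
  assumes out: "\<And>x. x \<notin> {0..1} \<Longrightarrow> y x = 0"
    and y: "\<And>x. x \<in> {0..1} \<Longrightarrow> (y has_vector_derivative y1 x) (at x within {0..1})"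
    and y1: "\<And>x. x \<in> {0..1} \<Longrightarrow> y1 x = y1 0 + integral {0..x} (\<lambda>t. y t * q t - \<mu> * y t)"
    and bc: "y1 0 + \<beta> * y1 1 = 0" "y 0 + y 1 = 0"
  shows "T2 q \<beta> y (\<lambda>x. \<mu> * y x)"
proof -
  have c: "continuous_on {0..1} y" using y continuous_on_vector_derivative by blast
  have i: "(\<lambda>t. y t * q t - \<mu> * y t) absolutely_integrable_on {0..1}"
    by (intro set_integral_diff(1) absint_continuous_mult q_absint absint_continuous continuous_intros c)
  have "ac_derivative y1 (\<lambda>t. y t * q t - \<mu> * y t)"
    unfolding ac_derivative_def integrable_leb01_iff
  proof (intro conjI ballI i)
    fix x :: real assume x: "x \<in> {0..1}"
    show "y1 x = y1 0 + (LINT t|lebesgue_on {0..x}. y t * q t - \<mu> * y t)"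
      using y1[OF x] lebesgue_integral_subinterval[OF i, of 0 x] x by simp
  qed
  moreover have "(\<lambda>x. \<mu> * y x) \<in> L2" by (intro continuous_in_L2 continuous_intros c)
  ultimately show ?thesis
    unfolding T2_def using out y bc
    by (intro conjI exI[of _ y1] exI[of _ "\<lambda>t. y t * q t - \<mu> * y t"]) (auto simp: mult.commute)
qed

end

locale boundary_problem = potential +
  fixes \<beta> :: complex
begin

text \<open>For \<open>y = a * fund cos \<rho> + b * fund sin \<rho>\<close> the condition \<open>y 0 + y 1 = 0\<close> reads
  \<open>m11 * a + m12 * b = 0\<close>, and \<open>y' 0 + \<beta> * y' 1 = 0\<close> divided by \<open>\<rho>\<close> reads
  \<open>m21 * a + m22 * b = 0\<close>.\<close>
definition m11 :: "complex \<Rightarrow> complex" where "m11 \<rho> = 1 + (cos \<rho> + bdry sin cos \<rho>)"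
definition m12 :: "complex \<Rightarrow> complex" where "m12 \<rho> = sin \<rho> + bdry sin sin \<rho>"
definition m21 :: "complex \<Rightarrow> complex" where "m21 \<rho> = \<beta> * (- sin \<rho> + bdry cos cos \<rho>)"
definition m22 :: "complex \<Rightarrow> complex" where "m22 \<rho> = 1 + \<beta> * (cos \<rho> + bdry cos sin \<rho>)"

definition char_det :: "complex \<Rightarrow> complex" where
  "char_det \<rho> = m11 \<rho> * m22 \<rho> - m12 \<rho> * m21 \<rho>"

definition comb :: "complex \<Rightarrow> complex \<Rightarrow> complex \<Rightarrow> real \<Rightarrow> complex" where
  "comb \<rho> a b x = a * fund cos \<rho> x + b * fund sin \<rho> x"

lemma comb_volterra:
  assumes "admissible \<rho>"
  shows "volterra (\<lambda>x. a * cos (\<rho> * of_real x) + b * sin (\<rho> * of_real x)) \<rho> (comb \<rho> a b)"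
  using volterra_linear[OF fund_volterra[of cos \<rho>] fund_volterra[of sin \<rho>], of a b] assms
  by (simp add: comb_def[abs_def])

lemma comb_kern:
  assumes "K \<in> {sin, cos}" "admissible \<rho>"
  shows "kern K \<rho> (comb \<rho> a b) 1 / \<rho> = a * bdry K cos \<rho> + b * bdry K sin \<rho>"
  using kern_linear[OF assms(1) fund_continuous fund_continuous, of cos \<rho> sin \<rho> 1 \<rho> a b] assms(2)
  by (simp add: comb_def[abs_def] bdry_def add_divide_distrib)

lemma comb_0:
  assumes "admissible \<rho>"
  shows "comb \<rho> a b 0 = a"
  using comb_volterra[OF assms, of a b] by (auto simp: volterra_def kern_def)

lemma comb_1:
  assumes "admissible \<rho>"
  shows "comb \<rho> a b 1 = a * (m11 \<rho> - 1) + b * m12 \<rho>"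
  using comb_volterra[OF assms, of a b] comb_kern[OF _ assms, of sin a b]
  by (simp add: volterra_def m11_def m12_def algebra_simps)

text \<open>An eigenfunction solves the same Volterra equation as \<open>comb \<rho> (y 0) b\<close> with
  \<open>b = y' 0 / \<rho>\<close>, so uniqueness identifies the two.\<close>
lemma eigenfunction_comb:
  assumes \<rho>: "admissible \<rho>" and y: "eigenfunction q \<beta> (\<rho>\<^sup>2) y"
  obtains b where "\<And>x. x \<in> {0..1} \<Longrightarrow> y x = comb \<rho> (y 0) b x" "\<And>x. x \<notin> {0..1} \<Longrightarrow> y x = 0"
    "m11 \<rho> * y 0 + m12 \<rho> * b = 0" "m21 \<rho> * y 0 + m22 \<rho> * b = 0"
proof -
  have \<rho>0: "\<rho> \<noteq> 0" using admissibleD(4)[OF \<rho>] .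
  have "T2 q \<beta> y (\<lambda>x. \<rho>\<^sup>2 * y x + 0)" using y by (simp add: eigenfunction_def)
  then obtain y1 where y1:
    "\<And>x. x \<notin> {0..1} \<Longrightarrow> y x = 0"
    "\<And>x. x \<in> {0..1} \<Longrightarrow> (y has_vector_derivative y1 x) (at x within {0..1})"
    "\<And>x. x \<in> {0..1} \<Longrightarrow> y1 x = y1 0 + integral {0..x} (\<lambda>t. y t * q t - \<rho>\<^sup>2 * y t - 0)"
    "y1 0 + \<beta> * y1 1 = 0" "y 0 + y 1 = 0"
    by (rule T2D[OF _ continuous_on_const]) (rule that; assumption)
  have c: "continuous_on {0..1} y" using y1(2) continuous_on_vector_derivative by blast
  have y1': "y1 x = y1 0 + integral {0..x} (\<lambda>t. y t * q t - \<rho>\<^sup>2 * y t)" if "x \<in> {0..1}" for x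
    using y1(3)[OF that] by simp
  note voc = variation_of_constants[OF absint_continuous_mult[OF c q_absint] \<rho>0 y1(2) y1']
  define b where "b = y1 0 / \<rho>"
  have "volterra (\<lambda>x. y 0 * cos (\<rho> * of_real x) + b * sin (\<rho> * of_real x)) \<rho> y"
    unfolding volterra_def kern_def b_def using voc(1) c by blast
  then have eq: "y x = comb \<rho> (y 0) b x" if "x \<in> {0..1}" for x
    using volterra_unique[OF \<rho> _ comb_volterra[OF \<rho>] that] by blast
  have "y1 1 = y1 0 * cos \<rho> - \<rho> * y 0 * sin \<rho> + kern cos \<rho> y 1"
    using voc(2)[of 1] by (simp add: kern_def)
  also have "kern cos \<rho> y 1 = kern cos \<rho> (comb \<rho> (y 0) b) 1"
    by (rule kern_cong[OF eq]) auto
  also have "\<dots> = \<rho> * (y 0 * bdry cos cos \<rho> + b * bdry cos sin \<rho>)"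
    using comb_kern[OF _ \<rho>, of cos "y 0" b] \<rho>0 by (simp add: field_simps)
  finally have y11: "y1 1 = \<rho> * (y 0 * (- sin \<rho> + bdry cos cos \<rho>) + b * (cos \<rho> + bdry cos sin \<rho>))"
    using \<rho>0 by (simp add: b_def field_simps)
  have y10: "y1 0 = \<rho> * b" using \<rho>0 by (simp add: b_def)
  have "\<rho> * (m21 \<rho> * y 0 + m22 \<rho> * b) = 0"
    using y1(4) unfolding y10 y11 m21_def m22_def by (simp add: algebra_simps)
  then have "m21 \<rho> * y 0 + m22 \<rho> * b = 0" using \<rho>0 by simp
  moreover have "m11 \<rho> * y 0 + m12 \<rho> * b = 0"
    using y1(5) eq[of 1] comb_1[OF \<rho>, of "y 0" b] by (simp add: algebra_simps)
  ultimately show ?thesis using that eq y1(1) by blast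
qed

text \<open>The combination \<open>comb \<rho> a b\<close> is an eigenfunction; \<open>a\<close> is its value at \<open>0\<close>, which makes it
  nontrivial.\<close>
lemma eigenfunction_exists:
  assumes \<rho>: "admissible \<rho>" and a: "a \<noteq> 0"
    and bc: "m11 \<rho> * a + m12 \<rho> * b = 0" "m21 \<rho> * a + m22 \<rho> * b = 0"
  shows "\<exists>y. eigenfunction q \<beta> (\<rho>\<^sup>2) y"
proof -
  have \<rho>0: "\<rho> \<noteq> 0" using admissibleD(4)[OF \<rho>] .
  define y where "y = (\<lambda>x. if x \<in> {0..1} then comb \<rho> a b x else 0)"
  have yc: "y x = comb \<rho> a b x" if "x \<in> {0..1}" for x using that by (simp add: y_def)
  have "continuous_on {0..1} (comb \<rho> a b)" using comb_volterra[OF \<rho>] by (simp add: volterra_def)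
  then have c: "continuous_on {0..1} y" using yc continuous_on_cong[OF refl, of "{0..1}" y "comb \<rho> a b"] by blast
  have k: "kern K \<rho> y x = kern K \<rho> (comb \<rho> a b) x" if "x \<in> {0..1}" for x K
    by (rule kern_cong[OF yc that])
  have e1: "y x = a * cos (\<rho> * of_real x) + b * sin (\<rho> * of_real x)
       + conv sin \<rho> (\<lambda>t. y t * q t) x / \<rho>" if x: "x \<in> {0..1}" for x
  proof -
    have "comb \<rho> a b x = a * cos (\<rho> * of_real x) + b * sin (\<rho> * of_real x) + kern sin \<rho> (comb \<rho> a b) x / \<rho>"
      using comb_volterra[OF \<rho>, of a b] x unfolding volterra_def by blast
    then show ?thesis unfolding yc[OF x] k[OF x, symmetric] by (simp add: kern_def)
  qed
  define y1 where "y1 = (\<lambda>x. \<rho> * b * cos (\<rho> * of_real x) - \<rho> * a * sin (\<rho> * of_real x)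
               + conv cos \<rho> (\<lambda>t. y t * q t) x)"
  note ode = variation_of_constants_converse[OF absint_continuous_mult[OF c q_absint] \<rho>0 e1, of y1]
  have d: "(y has_vector_derivative y1 x) (at x within {0..1})" 
    and i: "y1 x = y1 0 + integral {0..x} (\<lambda>t. y t * q t - \<rho>\<^sup>2 * y t)" if "x \<in> {0..1}" for x
    using ode that unfolding y1_def by blast+
  have "y1 1 = \<rho> * b * cos \<rho> - \<rho> * a * sin \<rho> + kern cos \<rho> y 1"
    by (simp add: y1_def kern_def)
  also have "kern cos \<rho> y 1 = \<rho> * (a * bdry cos cos \<rho> + b * bdry cos sin \<rho>)"
    using k[of 1] comb_kern[OF _ \<rho>, of cos a b] \<rho>0 by (simp add: field_simps)
  finally have "y1 0 + \<beta> * y1 1 = \<rho> * (m21 \<rho> * a + m22 \<rho> * b)"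
    by (simp add: y1_def m21_def m22_def algebra_simps)
  then have bc1: "y1 0 + \<beta> * y1 1 = 0" using bc by simp
  have bc0: "y 0 + y 1 = 0" 
    using yc[of 0] yc[of 1] comb_0[OF \<rho>] comb_1[OF \<rho>] bc(1) by (simp add: algebra_simps)
  have "T2 q \<beta> y (\<lambda>x. \<rho>\<^sup>2 * y x)" by (rule T2I[OF _ d i bc1 bc0]) (auto simp: y_def)
  moreover have "y 0 \<noteq> 0" using yc[of 0] comb_0[OF \<rho>] a by simp
  ultimately show ?thesis unfolding eigenfunction_def by blast
qed

lemma char_det_zero_imp_eigenfunction:
  assumes "admissible \<rho>" "m22 \<rho> \<noteq> 0" "char_det \<rho> = 0"
  shows "\<exists>y. eigenfunction q \<beta> (\<rho>\<^sup>2) y"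
  by (rule eigenfunction_exists[of \<rho> "m22 \<rho>" "- m21 \<rho>"])
    (use assms in \<open>auto simp: char_det_def algebra_simps\<close>)

lemma eigenfunction_0_nonzero:
  assumes \<rho>: "admissible \<rho>" and m: "m22 \<rho> \<noteq> 0" and y: "eigenfunction q \<beta> (\<rho>\<^sup>2) y"
  shows "y 0 \<noteq> 0" 
proof
  obtain b where b: "\<And>x. x \<in> {0..1} \<Longrightarrow> y x = comb \<rho> (y 0) b x" "\<And>x. x \<notin> {0..1} \<Longrightarrow> y x = 0"
    "m11 \<rho> * y 0 + m12 \<rho> * b = 0" "m21 \<rho> * y 0 + m22 \<rho> * b = 0"
    by (rule eigenfunction_comb[OF \<rho> y]) (rule that; assumption)
  assume "y 0 = 0"
  then have "b = 0" using b(4) m by simp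
  then have "y x = 0" for x using b(1,2)[of x] \<open>y 0 = 0\<close> by (cases "x \<in> {0..1}") (auto simp: comb_def)
  then show False using y by (simp add: eigenfunction_def)
qed

lemma eigenfunction_imp_char_det_zero:
  assumes \<rho>: "admissible \<rho>" and m: "m22 \<rho> \<noteq> 0" and y: "eigenfunction q \<beta> (\<rho>\<^sup>2) y"
  shows "char_det \<rho> = 0"
proof -
  obtain b where b: "m11 \<rho> * y 0 + m12 \<rho> * b = 0" "m21 \<rho> * y 0 + m22 \<rho> * b = 0"
    by (rule eigenfunction_comb[OF \<rho> y]) (rule that; assumption)
  have "char_det \<rho> * y 0 = m22 \<rho> * (m11 \<rho> * y 0 + m12 \<rho> * b) - m12 \<rho> * (m21 \<rho> * y 0 + m22 \<rho> * b)"
    by (simp add: char_det_def algebra_simps)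
  then show ?thesis using b eigenfunction_0_nonzero[OF assms] by simp
qed

text \<open>If \<open>m22 \<noteq> 0\<close>, the second boundary equation determines \<open>b\<close> from \<open>a = y 0\<close>; this is why
  eigenspaces are one-dimensional.\<close>
lemma eigenfunction_eq_comb:
  assumes \<rho>: "admissible \<rho>" and m: "m22 \<rho> \<noteq> 0" and y: "eigenfunction q \<beta> (\<rho>\<^sup>2) y" and x: "x \<in> {0..1}"
  shows "y x = y 0 * comb \<rho> 1 (- m21 \<rho> / m22 \<rho>) x"
proof -
  obtain b where b: "\<And>x. x \<in> {0..1} \<Longrightarrow> y x = comb \<rho> (y 0) b x" "m21 \<rho> * y 0 + m22 \<rho> * b = 0"
    by (rule eigenfunction_comb[OF \<rho> y]) (rule that; assumption)
  have "b = y 0 * (- m21 \<rho> / m22 \<rho>)" using b(2) m by (simp add: field_simps add_eq_0_iff)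
  then show ?thesis using b(1)[OF x] by (simp add: comb_def algebra_simps)
qed

lemma eigenfunctions_proportional:
  assumes \<rho>: "admissible \<rho>" and m: "m22 \<rho> \<noteq> 0" and y: "eigenfunction q \<beta> (\<rho>\<^sup>2) y" and z: "eigenfunction q \<beta> (\<rho>\<^sup>2) z"
  shows "z = (\<lambda>x. z 0 / y 0 * y x)"
proof
  fix x
  have "y x = 0 \<and> z x = 0" if "x \<notin> {0..1}"
    using y z that unfolding eigenfunction_def T2_def by simp
  then show "z x = z 0 / y 0 * y x"
    using eigenfunction_eq_comb[OF \<rho> m y, of x] eigenfunction_eq_comb[OF \<rho> m z, of x] eigenfunction_0_nonzero[OF \<rho> m y]
    by (cases "x \<in> {0..1}") (auto simp: mult_ac)
qed

end

section \<open>Simple eigenvalues\<close>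

context boundary_problem
begin

lemma bdry_le:
  assumes "K \<in> {sin, cos}" "T \<in> {sin, cos}" "admissible \<rho>"
  shows "norm (bdry K T \<rho>) \<le> 18 * qnorm"
proof -
  have "18 * qnorm / norm \<rho> \<le> 18 * qnorm / 1"
    using admissibleD(2)[OF assms(3)] qnorm_nonneg by (intro divide_left_mono) auto
  then show ?thesis using bdry_bound[OF assms] by simp
qed

text \<open>The function \<open>w = u + \<epsilon> v\<close> with \<open>\<epsilon> = \<rho>\<^sup>2 - \<mu>\<close> satisfies the boundary conditions exactly and
  the equation at \<open>\<rho>\<^sup>2\<close> up to the term \<open>\<epsilon>\<^sup>2 v\<close>.  Hence it differs from the true solution with the
  same initial values by \<open>O(\<bar>\<epsilon>\<bar>\<^sup>2)\<close>, the boundary system applied to these initial values is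
  \<open>O(\<bar>\<epsilon>\<bar>\<^sup>2)\<close>, and Cramer's rule gives the bound for the determinant times \<open>w 0\<close>.\<close>
lemma perturbed_eigenfunction_residual:
  assumes u: "eigenfunction q \<beta> \<mu> u" and v: "T2 q \<beta> v (\<lambda>x. \<mu> * v x + u x)"
  shows "\<exists>K. \<forall>\<rho>. admissible \<rho> \<longrightarrow>
           norm (char_det \<rho>) * norm (u 0 + (\<rho>\<^sup>2 - \<mu>) * v 0) \<le> K * (norm (\<rho>\<^sup>2 - \<mu>))\<^sup>2"
proof -
  have "T2 q \<beta> u (\<lambda>x. \<mu> * u x + 0)" using u by (simp add: eigenfunction_def)
  then obtain u1 where u1:
    "\<And>x. x \<in> {0..1} \<Longrightarrow> (u has_vector_derivative u1 x) (at x within {0..1})"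
    "\<And>x. x \<in> {0..1} \<Longrightarrow> u1 x = u1 0 + integral {0..x} (\<lambda>t. u t * q t - \<mu> * u t - 0)"
    "u1 0 + \<beta> * u1 1 = 0" "u 0 + u 1 = 0"
    by (rule T2D[OF _ continuous_on_const]) (rule that; assumption)
  have cu: "continuous_on {0..1} u" using u1(1) continuous_on_vector_derivative by blast
  obtain v1 where v1:
    "\<And>x. x \<in> {0..1} \<Longrightarrow> (v has_vector_derivative v1 x) (at x within {0..1})"
    "\<And>x. x \<in> {0..1} \<Longrightarrow> v1 x = v1 0 + integral {0..x} (\<lambda>t. v t * q t - \<mu> * v t - u t)"
    "v1 0 + \<beta> * v1 1 = 0" "v 0 + v 1 = 0"
    by (rule T2D[OF v cu]) (rule that; assumption)
  have cv: "continuous_on {0..1} v" using v1(1) continuous_on_vector_derivative by blast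
  have "bounded (v ` {0..1})" by (intro compact_imp_bounded compact_continuous_image cv) auto
  then obtain V where V: "\<And>t. t \<in> {0..1} \<Longrightarrow> norm (v t) \<le> V" unfolding bounded_iff by blast
  have V0: "V \<ge> 0" using order_trans[OF norm_ge_zero V[of 0]] by simp
  define C where "C = 3 + 18 * qnorm"
  have C0: "C \<ge> 0" using qnorm_nonneg by (simp add: C_def)
  define K where "K = (1 + norm \<beta> * C) * (6 * V) + C * (norm \<beta> * ((18 * qnorm + 3) * V))"
  have "norm (char_det \<rho>) * norm (u 0 + (\<rho>\<^sup>2 - \<mu>) * v 0) \<le> K * (norm (\<rho>\<^sup>2 - \<mu>))\<^sup>2"
    if \<rho>: "admissible \<rho>" for \<rho>
  proof -
    have \<rho>0: "\<rho> \<noteq> 0" and I: "\<bar>Im \<rho>\<bar> \<le> 1" and \<rho>1: "1 \<le> norm \<rho>" using admissibleD[OF \<rho>] by auto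
    define \<epsilon> where "\<epsilon> = \<rho>\<^sup>2 - \<mu>"
    define e where "e = (norm \<epsilon>)\<^sup>2"
    have e0: "e \<ge> 0" by (simp add: e_def)
    define w where "w = (\<lambda>x. u x + \<epsilon> * v x)"
    define w1 where "w1 = (\<lambda>x. u1 x + \<epsilon> * v1 x)"
    have cw: "continuous_on {0..1} w" unfolding w_def by (intro continuous_intros cu cv)
    define g where "g = (\<lambda>t. w t * q t + \<epsilon>\<^sup>2 * v t)"
    have g: "g absolutely_integrable_on {0..1}"
      unfolding g_def by (intro set_integral_add(1) absint_continuous_mult q_absint absint_continuous continuous_intros cw cv)
    have dw: "(w has_vector_derivative w1 x) (at x within {0..1})" if "x \<in> {0..1}" for x
      unfolding w_def w1_def
      by (intro has_vector_derivative_add has_vector_derivative_mult_right u1(1) v1(1) that)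
    have iw: "w1 x = w1 0 + integral {0..x} (\<lambda>t. g t - \<rho>\<^sup>2 * w t)" if x: "x \<in> {0..1}" for x
    proof -
      have i: "(\<lambda>t. u t * q t - \<mu> * u t - 0) integrable_on {0..x}" "(\<lambda>t. v t * q t - \<mu> * v t - u t) integrable_on {0..x}"
        by (intro absint_imp_integrable_on[OF _ x] set_integral_diff(1) absint_continuous_mult q_absint absint_continuous
            continuous_intros cu cv)+
      have "w1 x = w1 0 + (integral {0..x} (\<lambda>t. u t * q t - \<mu> * u t - 0) + \<epsilon> * integral {0..x} (\<lambda>t. v t * q t - \<mu> * v t - u t))"
        unfolding w1_def by (subst u1(2)[OF x], subst v1(2)[OF x]) (simp add: algebra_simps)
      also have "integral {0..x} (\<lambda>t. u t * q t - \<mu> * u t - 0) + \<epsilon> * integral {0..x} (\<lambda>t. v t * q t - \<mu> * v t - u t)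
        = integral {0..x} (\<lambda>t. (u t * q t - \<mu> * u t - 0) + \<epsilon> * (v t * q t - \<mu> * v t - u t))"
        using integral_add[OF i(1) integrable_on_mult_right[OF i(2), of \<epsilon>]] by simp
      also have "(\<lambda>t. (u t * q t - \<mu> * u t - 0) + \<epsilon> * (v t * q t - \<mu> * v t - u t)) = (\<lambda>t. g t - \<rho>\<^sup>2 * w t)"
      proof
        fix t
        have "\<rho>\<^sup>2 = \<mu> + \<epsilon>" by (simp add: \<epsilon>_def)
        then show "(u t * q t - \<mu> * u t - 0) + \<epsilon> * (v t * q t - \<mu> * v t - u t) = g t - \<rho>\<^sup>2 * w t"
          unfolding g_def w_def by (simp add: algebra_simps power2_eq_square)
      qed
      finally show ?thesis .
    qed
    note voc = variation_of_constants[OF g \<rho>0 dw iw]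
    have split: "conv T \<rho> g x =
        kern T \<rho> w x + \<epsilon>\<^sup>2 * conv T \<rho> v x"
      if T: "T \<in> {sin, cos}" and x: "x \<in> {0..1}" for T x
    proof -
      have i: "(\<lambda>t. T (\<rho> * of_real (x - t)) * v t) integrable_on {0..x}"
        by (intro absint_imp_integrable_on[OF _ x] absint_continuous_mult absint_continuous cv trig_continuous T)
      have "kern T \<rho> w x + \<epsilon>\<^sup>2 * conv T \<rho> v x =
        integral {0..x} (\<lambda>t. T (\<rho> * of_real (x - t)) * (w t * q t) + \<epsilon>\<^sup>2 * (T (\<rho> * of_real (x - t)) * v t))"
        unfolding kern_def
        using integral_add[OF kern_integrable[OF T cw x] integrable_on_mult_right[OF i, of "\<epsilon>\<^sup>2"], of \<rho>] by simp
      then show ?thesis unfolding g_def by (simp add: algebra_simps)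
    qed
    have vb: "norm (\<epsilon>\<^sup>2 * conv T \<rho> v x) \<le> 3 * V * e"
      if T: "T \<in> {sin, cos}" and x: "x \<in> {0..1}" for T x
      using mult_left_mono[OF integral_trig_bound[OF T I cv V x], of "(norm \<epsilon>)\<^sup>2"]
      by (simp add: norm_mult norm_power e_def mult_ac)
    define a where "a = w 0"
    define b where "b = w1 0 / \<rho>"
    have w10: "w1 0 = \<rho> * b" using \<rho>0 by (simp add: b_def)
    define \<phi> where "\<phi> = (\<lambda>x. a * cos (\<rho> * of_real x) + b * sin (\<rho> * of_real x)
        + \<epsilon>\<^sup>2 * conv sin \<rho> v x / \<rho>)"
    have "volterra \<phi> \<rho> w"
      unfolding volterra_def
    proof (intro conjI ballI cw)
      fix x :: real assume x: "x \<in> {0..1}"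
      show "w x = \<phi> x + kern sin \<rho> w x / \<rho>"
        using voc(1)[OF _ _ x] split[OF _ x, of sin] unfolding \<phi>_def a_def b_def
        by (simp add: add_divide_distrib)
    qed
    note vd = volterra_linear[OF this comb_volterra[OF \<rho>, of a b], of 1 "-1"]
    \<comment> \<open>The error made by replacing \<open>w\<close> by the exact solution with its initial values.\<close>
    define d where "d = (\<lambda>x. 1 * w x + - 1 * comb \<rho> a b x)"
    have cd: "continuous_on {0..1} d" using vd unfolding volterra_def d_def by blast
    have db: "norm (d x) \<le> 2 * (3 * V * e)" if x: "x \<in> {0..1}" for x
      unfolding d_def
    proof (rule volterra_bound[OF \<rho> vd _ x])
      fix t :: real assume t: "t \<in> {0..1}"
      have "norm (\<epsilon>\<^sup>2 * conv sin \<rho> v t / \<rho>) \<le> 3 * V * e / 1"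
        unfolding norm_divide using vb[OF _ t, of sin] \<rho>1 V0 e0 by (intro frac_le) auto
      then show "norm (1 * \<phi> t + - 1 * (a * cos (\<rho> * of_real t) + b * sin (\<rho> * of_real t))) \<le> 3 * V * e"
        by (simp add: \<phi>_def)
    qed
    have "m11 \<rho> * a + m12 \<rho> * b = - d 1"
    proof -
      have "w 0 + w 1 = (u 0 + u 1) + \<epsilon> * (v 0 + v 1)" by (simp add: w_def algebra_simps)
      then have "a + w 1 = 0" using u1(4) v1(4) by (simp add: a_def)
      then show ?thesis using comb_1[OF \<rho>, of a b] by (simp add: d_def algebra_simps add_eq_0_iff)
    qed
    then have r1: "norm (m11 \<rho> * a + m12 \<rho> * b) \<le> 6 * V * e" using db[of 1] by simp
    have r2: "norm (m21 \<rho> * a + m22 \<rho> * b) \<le> norm \<beta> * ((18 * qnorm + 3) * V) * e"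
    proof -
      define X where "X = \<epsilon>\<^sup>2 * conv cos \<rho> v 1"
      have "w1 1 = w1 0 * cos \<rho> - \<rho> * w 0 * sin \<rho> + (kern cos \<rho> w 1 + X)"
        using voc(2)[of 1] split[of cos 1] by (simp add: X_def)
      moreover have "kern cos \<rho> d 1 = kern cos \<rho> w 1 - kern cos \<rho> (comb \<rho> a b) 1"
        using kern_diff[OF _ cw, of cos "comb \<rho> a b" 1 \<rho>] comb_volterra[OF \<rho>, of a b] by (simp add: d_def volterra_def)
      moreover have "kern cos \<rho> (comb \<rho> a b) 1 = \<rho> * (a * bdry cos cos \<rho> + b * bdry cos sin \<rho>)"
        using comb_kern[OF _ \<rho>, of cos a b] \<rho>0 by (simp add: field_simps)
      ultimately have w11: "w1 1 = \<rho> * (a * (- sin \<rho> + bdry cos cos \<rho>) + b * (cos \<rho> + bdry cos sin \<rho>)) + (kern cos \<rho> d 1 + X)"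
        unfolding w10 a_def[symmetric] by (simp add: algebra_simps)
      have "w1 0 + \<beta> * w1 1 = (u1 0 + \<beta> * u1 1) + \<epsilon> * (v1 0 + \<beta> * v1 1)" by (simp add: w1_def algebra_simps)
      then have "w1 0 + \<beta> * w1 1 = 0" using u1(3) v1(3) by simp
      then have "\<rho> * (m21 \<rho> * a + m22 \<rho> * b) = - \<beta> * (kern cos \<rho> d 1 + X)"
        unfolding w10 w11 m21_def m22_def by (simp add: algebra_simps add_eq_0_iff)
      then have "norm \<rho> * norm (m21 \<rho> * a + m22 \<rho> * b) = norm \<beta> * norm (kern cos \<rho> d 1 + X)"
        by (metis norm_minus_cancel norm_mult)
      moreover have "norm (kern cos \<rho> d 1 + X) \<le> 3 * (2 * (3 * V * e)) * qnorm + 3 * V * e"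
        using kern_bound[of cos \<rho> d "2 * (3 * V * e)" 1] I cd db vb[of cos 1] unfolding X_def
        by (intro norm_triangle_mono) auto
      ultimately have "norm \<rho> * norm (m21 \<rho> * a + m22 \<rho> * b) \<le> norm \<beta> * (3 * (2 * (3 * V * e)) * qnorm + 3 * V * e)"
        by (simp add: mult_left_mono)
      moreover have "1 * norm (m21 \<rho> * a + m22 \<rho> * b) \<le> norm \<rho> * norm (m21 \<rho> * a + m22 \<rho> * b)"
        using \<rho>1 by (intro mult_right_mono) auto
      ultimately show ?thesis by (simp add: algebra_simps)
    qed
    have n12: "norm (m12 \<rho>) \<le> C"
      unfolding m12_def C_def using norm_trig_le(1)[OF I] bdry_le[OF _ _ \<rho>, of sin sin]
      by (intro norm_triangle_mono) auto
    have n22: "norm (m22 \<rho>) \<le> 1 + norm \<beta> * C"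
    proof -
      have "norm (cos \<rho> + bdry cos sin \<rho>) \<le> C"
        unfolding C_def using norm_trig_le(2)[OF I] bdry_le[OF _ _ \<rho>, of cos sin]
        by (intro norm_triangle_mono) auto
      then have "norm (\<beta> * (cos \<rho> + bdry cos sin \<rho>)) \<le> norm \<beta> * C" by (simp add: norm_mult mult_left_mono)
      then show ?thesis unfolding m22_def using norm_triangle_mono[of 1 1 "\<beta> * (cos \<rho> + bdry cos sin \<rho>)"] by simp
    qed
    have "char_det \<rho> * a = m22 \<rho> * (m11 \<rho> * a + m12 \<rho> * b) - m12 \<rho> * (m21 \<rho> * a + m22 \<rho> * b)"
      by (simp add: char_det_def algebra_simps)
    then have "norm (char_det \<rho> * a) \<le> norm (m22 \<rho>) * norm (m11 \<rho> * a + m12 \<rho> * b) + norm (m12 \<rho>) * norm (m21 \<rho> * a + m22 \<rho> * b)"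
      by (metis norm_mult norm_triangle_ineq4)
    also have "\<dots> \<le> (1 + norm \<beta> * C) * (6 * V * e) + C * (norm \<beta> * ((18 * qnorm + 3) * V) * e)"
      using n12 n22 r1 r2 C0 by (intro add_mono mult_mono) auto
    also have "\<dots> = K * e" by (simp add: K_def algebra_simps)
    finally show ?thesis by (simp add: norm_mult a_def w_def e_def \<epsilon>_def)
  qed
  then show ?thesis by blast
qed

text \<open>The determinant vanishes to first order at \<open>\<rho>\<close> only, by the lower bound, but an associated
  function would make it \<open>O(t\<^sup>2)\<close> at \<open>\<rho> + t\<close>.  Division by \<open>t\<close> and \<open>t \<rightarrow> 0\<close> give \<open>u 0 = 0\<close>.\<close>
lemma no_associated_function:
  assumes u: "eigenfunction q \<beta> (\<rho>\<^sup>2) u" and \<rho>: "admissible \<rho>" "m22 \<rho> \<noteq> 0"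
    and c: "c > 0" and r: "r > 0"
    and low: "\<And>\<sigma>. norm (\<sigma> - \<rho>) < r \<Longrightarrow> admissible \<sigma> \<and> c * norm (\<sigma> - \<rho>) \<le> norm (char_det \<sigma>)"
  shows "\<not> T2 q \<beta> v (\<lambda>x. \<rho>\<^sup>2 * v x + u x)"
proof
  assume v: "T2 q \<beta> v (\<lambda>x. \<rho>\<^sup>2 * v x + u x)"
  obtain K where K: "\<And>\<sigma>. admissible \<sigma> \<Longrightarrow> 
      norm (char_det \<sigma>) * norm (u 0 + (\<sigma>\<^sup>2 - \<rho>\<^sup>2) * v 0) \<le> K * (norm (\<sigma>\<^sup>2 - \<rho>\<^sup>2))\<^sup>2"
    using perturbed_eigenfunction_residual[OF u v] by blast
  define L where "L = (\<lambda>t::real. c * norm (u 0 + ((\<rho> + of_real t)\<^sup>2 - \<rho>\<^sup>2) * v 0))"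
  define R where "R = (\<lambda>t::real. K * t * (norm (2 * \<rho> + of_real t))\<^sup>2)"
  have le: "L t \<le> R t" if t: "0 < t" "t < r" for t
  proof -
    define \<sigma> where "\<sigma> = \<rho> + of_real t"
    have n: "norm (\<sigma> - \<rho>) = t" using t by (simp add: \<sigma>_def)
    have eq: "\<sigma>\<^sup>2 - \<rho>\<^sup>2 = of_real t * (2 * \<rho> + of_real t)" by (simp add: \<sigma>_def power2_eq_square algebra_simps)
    have "c * t * norm (u 0 + (\<sigma>\<^sup>2 - \<rho>\<^sup>2) * v 0) \<le> norm (char_det \<sigma>) * norm (u 0 + (\<sigma>\<^sup>2 - \<rho>\<^sup>2) * v 0)"
      using low[of \<sigma>] n t by (intro mult_right_mono) auto
    also have "\<dots> \<le> K * (norm (\<sigma>\<^sup>2 - \<rho>\<^sup>2))\<^sup>2" using K low[of \<sigma>] n t by auto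
    also have "(norm (\<sigma>\<^sup>2 - \<rho>\<^sup>2))\<^sup>2 = t * (t * (norm (2 * \<rho> + of_real t))\<^sup>2)"
      unfolding eq using t by (simp add: norm_mult power_mult_distrib power2_eq_square)
    finally have "t * L t \<le> t * R t"
      unfolding L_def R_def \<sigma>_def[symmetric] by (simp only: mult.assoc mult.left_commute)
    then show ?thesis using t by simp
  qed
  have "(L \<longlongrightarrow> c * norm (u 0 + ((\<rho> + of_real 0)\<^sup>2 - \<rho>\<^sup>2) * v 0)) (at_right 0)"
    unfolding L_def by (intro tendsto_intros)
  moreover have "(R \<longlongrightarrow> K * 0 * (norm (2 * \<rho> + of_real 0))\<^sup>2) (at_right 0)"
    unfolding R_def by (intro tendsto_intros)
  moreover have "eventually (\<lambda>t. L t \<le> R t) (at_right 0)"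
    using eventually_at_right_less[of 0] eventually_at_right_real[OF r]
    by eventually_elim (use le in auto)
  ultimately have "c * norm (u 0 + ((\<rho> + of_real 0)\<^sup>2 - \<rho>\<^sup>2) * v 0) \<le> K * 0 * (norm (2 * \<rho> + of_real 0))\<^sup>2"
    by (intro tendsto_le[OF trivial_limit_at_right_real]) 
  then have "norm (u 0) \<le> 0" using c by (simp add: mult_le_0_iff)
  then show False using eigenfunction_0_nonzero[OF \<rho> u] by simp
qed

lemma eigenfunction_scale:
  assumes y: "eigenfunction q \<beta> \<mu> y" and k: "k \<noteq> 0"
  shows "eigenfunction q \<beta> \<mu> (\<lambda>x. k * y x)"
proof -
  have "T2 q \<beta> y (\<lambda>x. \<mu> * y x + 0)" using y by (simp add: eigenfunction_def)
  then obtain y1 where y1: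
    "\<And>x. x \<notin> {0..1} \<Longrightarrow> y x = 0"
    "\<And>x. x \<in> {0..1} \<Longrightarrow> (y has_vector_derivative y1 x) (at x within {0..1})"
    "\<And>x. x \<in> {0..1} \<Longrightarrow> y1 x = y1 0 + integral {0..x} (\<lambda>t. y t * q t - \<mu> * y t - 0)"
    "y1 0 + \<beta> * y1 1 = 0" "y 0 + y 1 = 0"
    by (rule T2D[OF _ continuous_on_const]) (rule that; assumption)
  have "T2 q \<beta> (\<lambda>x. k * y x) (\<lambda>x. \<mu> * (k * y x))"
  proof (rule T2I[where ?y1.0 = "\<lambda>x. k * y1 x"])
    fix x :: real assume x: "x \<in> {0..1}"
    show "((\<lambda>x. k * y x) has_vector_derivative k * y1 x) (at x within {0..1})"
      by (intro has_vector_derivative_mult_right y1(2) x)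
    have "k * y1 x = k * y1 0 + integral {0..x} (\<lambda>t. k * (y t * q t - \<mu> * y t - 0))"
      by (subst y1(3)[OF x]) (simp add: distrib_left)
    moreover have "(\<lambda>t. k * (y t * q t - \<mu> * y t - 0)) = (\<lambda>t. k * y t * q t - \<mu> * (k * y t))"
      by (simp add: fun_eq_iff algebra_simps)
    ultimately show "k * y1 x = k * y1 0 + integral {0..x} (\<lambda>t. k * y t * q t - \<mu> * (k * y t))"
      by (simp only:)
  next
    have "k * (y1 0 + \<beta> * y1 1) = 0" "k * (y 0 + y 1) = 0" using y1(4,5) by simp_all
    then show "k * y1 0 + \<beta> * (k * y1 1) = 0" "k * y 0 + k * y 1 = 0" by (simp_all add: algebra_simps)
  qed (use y1(1) in simp)
  then show ?thesis using y k unfolding eigenfunction_def by auto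
qed

lemma simple_eigenvalueI:
  assumes u: "eigenfunction q \<beta> (\<rho>\<^sup>2) u" and \<rho>: "admissible \<rho>" "m22 \<rho> \<noteq> 0"
    and c: "c > 0" and r: "r > 0"
    and low: "\<And>\<sigma>. norm (\<sigma> - \<rho>) < r \<Longrightarrow> admissible \<sigma> \<and> c * norm (\<sigma> - \<rho>) \<le> norm (char_det \<sigma>)"
  shows "simple_eigenvalue q \<beta> (\<rho>\<^sup>2)" 
    and "root_function q \<beta> (\<rho>\<^sup>2) y \<Longrightarrow> eigenfunction q \<beta> (\<rho>\<^sup>2) y"
proof -
  show root: "eigenfunction q \<beta> (\<rho>\<^sup>2) y" if "root_function q \<beta> (\<rho>\<^sup>2) y" for y
    using that
  proof (induction rule: root_function.induct)
    case (assoc u v)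
    then show ?case using no_associated_function[OF _ \<rho> c r low] by blast
  qed
  have u0: "u \<noteq> 0" using u by (auto simp: eigenfunction_def)
  have "root_space q \<beta> (\<rho>\<^sup>2) = range (\<lambda>k x. k * u x)"
  proof (intro equalityI subsetI)
    fix z assume "z \<in> root_space q \<beta> (\<rho>\<^sup>2)"
    then consider "z = (\<lambda>x. 0)" | "eigenfunction q \<beta> (\<rho>\<^sup>2) z" using root by (auto simp: root_space_def)
    then show "z \<in> range (\<lambda>k x. k * u x)"
    proof cases
      case 1 then show ?thesis by (intro image_eqI[of _ _ 0]) auto
    next
      case 2 then show ?thesis using eigenfunctions_proportional[OF \<rho> u] by blast
    qed
  next
    fix z assume "z \<in> range (\<lambda>k x. k * u x)"
    then obtain k where k: "z = (\<lambda>x. k * u x)" by blast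
    show "z \<in> root_space q \<beta> (\<rho>\<^sup>2)"
    proof (cases "k = 0")
      case True
      then show ?thesis by (simp add: k root_space_def)
    next
      case False
      then have "root_function q \<beta> (\<rho>\<^sup>2) z"
        unfolding k by (intro root_function.eigen eigenfunction_scale u)
      then show ?thesis by (simp add: root_space_def)
    qed
  qed
  then have "root_space q \<beta> (\<rho>\<^sup>2) = cfun.span {u}" by (simp add: cfun.span_singleton)
  moreover have "cfun.independent {u}" using u0 by simp
  ultimately have "cfun.dim (root_space q \<beta> (\<rho>\<^sup>2)) = 1"
    by (simp add: cfun.dim_eq_card_independent)
  then show "simple_eigenvalue q \<beta> (\<rho>\<^sup>2)"
    using u by (auto simp: simple_eigenvalue_def algebraic_multiplicity_def)
qed

end

section \<open>The determinant near odd multiples of \<open>\<pi>\<close>\<close>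

text \<open>One constant serves for the bound and for the Lipschitz condition, so that a product inherits
  the smallness of each of its factors; the remainder of the determinant is a sum of such products.\<close>
definition bounded_lipschitz :: "real \<Rightarrow> complex set \<Rightarrow> (complex \<Rightarrow> complex) \<Rightarrow> bool" where
  "bounded_lipschitz A S f \<longleftrightarrow> 0 \<le> A \<and> (\<forall>\<rho>\<in>S. norm (f \<rho>) \<le> A) \<and>
     (\<forall>\<rho>\<in>S. \<forall>\<sigma>\<in>S. norm (f \<rho> - f \<sigma>) \<le> A * norm (\<rho> - \<sigma>))"

lemma bounded_lipschitz_add:
  assumes "bounded_lipschitz A S f" "bounded_lipschitz B S g"
  shows "bounded_lipschitz (A + B) S (\<lambda>\<rho>. f \<rho> + g \<rho>)"
proof -
  have "norm (f \<rho> + g \<rho> - (f \<sigma> + g \<sigma>)) \<le> (A + B) * norm (\<rho> - \<sigma>)" if "\<rho> \<in> S" "\<sigma> \<in> S" for \<rho> \<sigma>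
    using assms that norm_triangle_mono[of "f \<rho> - f \<sigma>" "A * norm (\<rho> - \<sigma>)" "g \<rho> - g \<sigma>" "B * norm (\<rho> - \<sigma>)"]
    by (simp add: bounded_lipschitz_def algebra_simps)
  moreover have "norm (f \<rho> + g \<rho>) \<le> A + B" if "\<rho> \<in> S" for \<rho>
    using assms that by (intro norm_triangle_mono) (auto simp: bounded_lipschitz_def)
  ultimately show ?thesis using assms by (simp add: bounded_lipschitz_def)
qed

lemma bounded_lipschitz_mult:
  assumes "bounded_lipschitz A S f" "bounded_lipschitz B S g"
  shows "bounded_lipschitz (2 * A * B) S (\<lambda>\<rho>. f \<rho> * g \<rho>)"
proof -
  have A: "0 \<le> A" "0 \<le> B" using assms by (auto simp: bounded_lipschitz_def)
  have "norm (f \<rho> * g \<rho> - f \<sigma> * g \<sigma>) \<le> 2 * A * B * norm (\<rho> - \<sigma>)" if "\<rho> \<in> S" "\<sigma> \<in> S" for \<rho> \<sigma>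
  proof -
    have "norm (f \<rho> * (g \<rho> - g \<sigma>)) \<le> A * (B * norm (\<rho> - \<sigma>))"
      unfolding norm_mult using assms that A by (intro mult_mono) (auto simp: bounded_lipschitz_def)
    moreover have "norm ((f \<rho> - f \<sigma>) * g \<sigma>) \<le> (A * norm (\<rho> - \<sigma>)) * B"
      unfolding norm_mult using assms that A by (intro mult_mono) (auto simp: bounded_lipschitz_def)
    ultimately have "norm (f \<rho> * (g \<rho> - g \<sigma>) + (f \<rho> - f \<sigma>) * g \<sigma>) \<le> A * (B * norm (\<rho> - \<sigma>)) + (A * norm (\<rho> - \<sigma>)) * B"
      by (rule norm_triangle_mono)
    then show ?thesis by (simp add: algebra_simps)
  qed
  moreover have "norm (f \<rho> * g \<rho>) \<le> 2 * A * B" if "\<rho> \<in> S" for \<rho>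
  proof -
    have "norm (f \<rho> * g \<rho>) \<le> A * B"
      unfolding norm_mult using assms that A by (intro mult_mono) (auto simp: bounded_lipschitz_def)
    also have "\<dots> \<le> 2 * A * B" using mult_nonneg_nonneg[OF A] by simp
    finally show ?thesis .
  qed
  ultimately show ?thesis using A by (simp add: bounded_lipschitz_def)
qed

lemma bounded_lipschitz_const: "bounded_lipschitz (norm c) S (\<lambda>\<rho>. c)"
  by (simp add: bounded_lipschitz_def)

lemma bounded_lipschitz_mono: "bounded_lipschitz A S f \<Longrightarrow> A \<le> B \<Longrightarrow> bounded_lipschitz B S f"
  unfolding bounded_lipschitz_def
  by (meson mult_right_mono norm_ge_zero order_trans)

lemma norm_sin_ge:
  fixes z :: complex
  assumes "norm z \<le> 1/2"
  shows "norm z / 2 \<le> norm (sin z)"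
proof -
  have I: "\<bar>Im z\<bar> \<le> 1" using assms abs_Im_le_cmod[of z] by linarith
  have "norm (sin z - z) \<le> exp \<bar>Im z\<bar> * norm z ^ 3 / 2"
    using Taylor_sin[of z 2] by (simp add: sin_coeff_def numeral_2_eq_2 numeral_3_eq_3)
  also have "\<dots> \<le> 3 * (norm z * (1/2)^2) / 2"
  proof -
    have "exp \<bar>Im z\<bar> \<le> 3" using I exp_le by (auto intro: order_trans[of _ "exp 1"])
    moreover have "norm z ^ 3 \<le> norm z * (1/2)^2"
      unfolding power3_eq_cube power2_eq_square mult.assoc[symmetric] using assms by (intro mult_mono) auto
    ultimately show ?thesis by (intro divide_right_mono mult_mono) auto
  qed
  also have "\<dots> \<le> norm z / 2" by (simp add: power2_eq_square)
  finally have "norm (sin z - z) \<le> norm z / 2" .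
  then show ?thesis using norm_triangle_ineq2[of z "sin z"] by (simp add: norm_minus_commute)
qed

text \<open>\<open>cos z - cos w\<close> is a product of two sines, and \<open>\<bar>sin \<zeta>\<bar> \<ge> \<bar>\<zeta>\<bar> / 2\<close> for small \<open>\<zeta>\<close>.\<close>
lemma norm_cos_diff_ge:
  fixes z w :: complex
  assumes "norm z \<le> 1/2" "norm w \<le> 1/2"
  shows "norm (z + w) * norm (z - w) / 4 \<le> norm (2 * cos z - 2 * cos w)"
proof -
  have "norm ((z + w) / 2) / 2 \<le> norm (sin ((z + w) / 2))" "norm ((w - z) / 2) / 2 \<le> norm (sin ((w - z) / 2))"
    using assms norm_triangle_ineq[of z w] norm_triangle_ineq4[of w z]
    by (intro norm_sin_ge; simp add: norm_divide)+
  then have "(norm ((z + w) / 2) / 2) * (norm ((w - z) / 2) / 2) \<le> norm (sin ((z + w) / 2)) * norm (sin ((w - z) / 2))"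
    by (intro mult_mono) auto
  then show ?thesis
    using cos_diff_cos[of z w] by (simp add: right_diff_distrib[symmetric] norm_mult norm_divide norm_minus_commute)
qed

lemma norm_cos_Taylor_le:
  fixes z :: complex
  assumes "norm z \<le> 1"
  shows "norm (2 - 2 * cos z - z\<^sup>2) \<le> 3 * norm z ^ 3"
proof -
  have I: "\<bar>Im z\<bar> \<le> 1" using assms abs_Im_le_cmod[of z] by linarith
  have e: "exp \<bar>Im z\<bar> \<le> 3" using I exp_le by (auto intro: order_trans[of _ "exp 1"])
  have "norm (cos z - (1 - z\<^sup>2 / 2)) \<le> exp \<bar>Im z\<bar> * norm z ^ 3 / 2"
    using Taylor_cos[of z 2] by (simp add: cos_coeff_def numeral_2_eq_2 numeral_3_eq_3)
  also have "\<dots> \<le> 3 * norm z ^ 3 / 2"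
    using e by (intro divide_right_mono mult_right_mono) auto
  finally have "norm (- 2 * (cos z - (1 - z\<^sup>2 / 2))) \<le> 2 * (3 * norm z ^ 3 / 2)"
    unfolding norm_mult by simp
  then show ?thesis by (simp add: algebra_simps)
qed

context boundary_problem
begin

text \<open>The square roots of the eigenvalues for \<open>q = 0\<close>.\<close>
definition rn :: "nat \<Rightarrow> complex" where
  "rn n = of_real ((2 * real n + 1) * pi)"

lemma cos_rn: "cos (rn n) = -1" and sin_rn: "sin (rn n) = 0"
proof -
  have "cos ((2 * real n + 1) * pi) = -1" "sin ((2 * real n + 1) * pi) = 0"
    using cos_npi[of "2 * n + 1"] sin_npi[of "2 * n + 1"] by (simp_all add: algebra_simps)
  then show "cos (rn n) = -1" "sin (rn n) = 0"
    by (simp_all add: rn_def cos_of_real sin_of_real del: of_real_mult)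
qed

lemma rn_lower: "2 * (real n + 1) \<le> (2 * real n + 1) * pi - 1"
proof -
  have "(2 * real n + 1) * 3 \<le> (2 * real n + 1) * pi" using pi_gt3 by (intro mult_left_mono) auto
  then show ?thesis by simp
qed

lemma norm_rn: "norm (rn n) = (2 * real n + 1) * pi"
  unfolding rn_def norm_of_real by simp

text \<open>As \<open>\<pi> > 3\<close>, points at distance at most \<open>1\<close> from \<open>rn n\<close> have modulus at least \<open>n + 1\<close>; errors
  \<open>O(1 / norm \<rho>)\<close> are stated as \<open>O(1 / (n + 1))\<close> from here on.\<close>
lemma near_rn:
  assumes "6 * qnorm \<le> real n" "norm (\<rho> - rn n) \<le> 1"
  shows "admissible \<rho>" "real n + 1 \<le> norm \<rho>" "\<bar>Im \<rho>\<bar> \<le> 1"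
proof -
  have "norm (rn n) - norm (\<rho> - rn n) \<le> norm \<rho>" using norm_triangle_ineq2[of "rn n" "rn n - \<rho>"] 
    by (simp add: norm_minus_commute)
  then show n: "real n + 1 \<le> norm \<rho>" using rn_lower[of n] assms(2) by (simp add: norm_rn)
  have "Im (\<rho> - rn n) = Im \<rho>" by (simp add: rn_def)
  then show I: "\<bar>Im \<rho>\<bar> \<le> 1" using assms(2) abs_Im_le_cmod[of "\<rho> - rn n"] by linarith
  show "admissible \<rho>" using n I assms(1) by (simp add: admissible_def)
qed

lemma bdry_near_rn:
  assumes "6 * qnorm \<le> real n" "K \<in> {sin, cos}" "T \<in> {sin, cos}"
  shows "bounded_lipschitz (90 * qnorm / (real n + 1)) (cball (rn n) 1) (bdry K T)"
  unfolding bounded_lipschitz_def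
proof (intro conjI ballI)
  show "0 \<le> 90 * qnorm / (real n + 1)" using qnorm_nonneg by simp
  have b: "c * qnorm / norm \<rho> \<le> c * qnorm / (real n + 1)" if "\<rho> \<in> cball (rn n) 1" "c \<ge> 0" for \<rho> c
    using near_rn(2)[OF assms(1), of \<rho>] that qnorm_nonneg
    by (intro frac_le) (auto simp: dist_norm norm_minus_commute)
  fix \<rho> assume \<rho>: "\<rho> \<in> cball (rn n) 1"
  then have a: "admissible \<rho>" using near_rn(1)[OF assms(1)] by (simp add: dist_norm norm_minus_commute)
  have "18 * qnorm / (real n + 1) \<le> 90 * qnorm / (real n + 1)" using qnorm_nonneg by (intro divide_right_mono) auto
  then show "norm (bdry K T \<rho>) \<le> 90 * qnorm / (real n + 1)"
    using bdry_bound[OF assms(2,3) a] b[OF \<rho>, of 18] by linarith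
  fix \<sigma> assume \<sigma>: "\<sigma> \<in> cball (rn n) 1"
  then have a': "admissible \<sigma>" using near_rn(1)[OF assms(1)] by (simp add: dist_norm norm_minus_commute)
  show "norm (bdry K T \<rho> - bdry K T \<sigma>) \<le> 90 * qnorm / (real n + 1) * norm (\<rho> - \<sigma>)"
    using bdry_lipschitz[OF assms(2,3) a a'] mult_right_mono[OF b[OF \<rho>, of 90], of "norm (\<rho> - \<sigma>)"] by simp
qed

lemma trig_near_rn:
  assumes "6 * qnorm \<le> real n" "T \<in> {sin, cos}"
  shows "bounded_lipschitz 3 (cball (rn n) 1) T"
  unfolding bounded_lipschitz_def
  using assms(2) near_rn(3)[OF assms(1)] norm_trig_le norm_trig_diff_le
  by (auto simp: dist_norm norm_minus_commute)

definition char_rem :: "complex \<Rightarrow> complex" where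
  "char_rem \<rho> = char_det \<rho> - (1 + \<beta>) * (1 + cos \<rho>)"

text \<open>The part free of \<open>bdry\<close> is \<open>(1 + cos \<rho>) (1 + \<beta> cos \<rho>) + \<beta> (sin \<rho>)\<^sup>2 = (1 + \<beta>) (1 + cos \<rho>)\<close>.
  Every other term contains a factor \<open>bdry\<close>, which is small, and all of them except
  \<open>(1 - \<beta>) * bdry sin cos \<rho>\<close>, contained in the first, have a second small factor near \<open>rn n\<close>.\<close>
lemma char_rem_eq:
  "char_rem \<rho> = bdry sin cos \<rho> * (1 + \<beta> * cos \<rho>) + (\<beta> * bdry cos sin \<rho>) * (1 + cos \<rho>)
     + (\<beta> * bdry sin cos \<rho>) * bdry cos sin \<rho> + ((- \<beta>) * bdry cos cos \<rho>) * sin \<rho>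
     + (\<beta> * bdry sin sin \<rho>) * sin \<rho> + ((- \<beta>) * bdry sin sin \<rho>) * bdry cos cos \<rho>"
proof -
  define c s where "c = cos \<rho>" and "s = sin \<rho>"
  have "c\<^sup>2 = 1 - s\<^sup>2" using sin_cos_squared_add[of \<rho>] by (simp add: c_def s_def algebra_simps)
  then have "\<beta> * (c * c) = \<beta> * (1 - s * s)" by (simp add: power2_eq_square)
  then have "\<beta> * (c * c) = \<beta> - \<beta> * (s * s)" by (simp add: algebra_simps)
  then show ?thesis
    unfolding char_rem_def char_det_def m11_def m12_def m21_def m22_def c_def[symmetric] s_def[symmetric]
    by (simp add: algebra_simps)
qed

lemma char_rem_bounded_lipschitz:
  "\<exists>K\<ge>0. \<forall>n. 6 * qnorm \<le> real n \<longrightarrow> bounded_lipschitz (K / (real n + 1)) (cball (rn n) 1) char_rem"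
proof -
  define b where "b = norm \<beta>"
  define Q where "Q = 90 * qnorm"
  define K where "K = 2 * Q * (1 + 2 * b * 3) + 2 * (2 * b * Q) * (1 + 3) + 2 * (2 * b * Q) * Q + 2 * (2 * b * Q) * 3
      + 2 * (2 * b * Q) * 3 + 2 * (2 * b * Q) * Q"
  have b0: "b \<ge> 0" and Q0: "Q \<ge> 0" using qnorm_nonneg by (simp_all add: b_def Q_def)
  have "bounded_lipschitz (K / (real n + 1)) (cball (rn n) 1) char_rem" if n: "6 * qnorm \<le> real n" for n
  proof -
    define A where "A = Q / (real n + 1)"
    define S where "S = cball (rn n) 1"
    have AQ: "A \<le> Q" "A \<ge> 0" using Q0 by (auto simp: A_def divide_le_eq mult_le_cancel_left1)
    have bd: "bounded_lipschitz A S (bdry K T)" if "K \<in> {sin, cos}" "T \<in> {sin, cos}" for K T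
      using bdry_near_rn[OF n that] by (simp add: A_def S_def Q_def)
    have tr: "bounded_lipschitz 3 S T" if "T \<in> {sin, cos}" for T
      using trig_near_rn[OF n that] by (simp add: S_def)
    have c: "bounded_lipschitz b S (\<lambda>\<rho>. \<beta>)" "bounded_lipschitz b S (\<lambda>\<rho>. - \<beta>)" "bounded_lipschitz 1 S (\<lambda>\<rho>. 1)"
      using bounded_lipschitz_const[of \<beta> S] bounded_lipschitz_const[of "-\<beta>" S] bounded_lipschitz_const[of 1 S]
      by (simp_all add: b_def)
    have bd': "bounded_lipschitz Q S (bdry K T)" if "K \<in> {sin, cos}" "T \<in> {sin, cos}" for K T
      using bounded_lipschitz_mono[OF bd[OF that] AQ(1)] .
    note add = bounded_lipschitz_add and mult = bounded_lipschitz_mult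
    have "bounded_lipschitz (2 * A * (1 + 2 * b * 3) + 2 * (2 * b * A) * (1 + 3) + 2 * (2 * b * A) * Q + 2 * (2 * b * A) * 3
      + 2 * (2 * b * A) * 3 + 2 * (2 * b * A) * Q) S (\<lambda>\<rho>. bdry sin cos \<rho> * (1 + \<beta> * cos \<rho>) + (\<beta> * bdry cos sin \<rho>) * (1 + cos \<rho>)
     + (\<beta> * bdry sin cos \<rho>) * bdry cos sin \<rho> + ((- \<beta>) * bdry cos cos \<rho>) * sin \<rho>
     + (\<beta> * bdry sin sin \<rho>) * sin \<rho> + ((- \<beta>) * bdry sin sin \<rho>) * bdry cos cos \<rho>)"
      by (intro add mult bd bd' c tr[of sin] tr[of cos]) auto
    moreover have "2 * A * (1 + 2 * b * 3) + 2 * (2 * b * A) * (1 + 3) + 2 * (2 * b * A) * Q + 2 * (2 * b * A) * 3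
      + 2 * (2 * b * A) * 3 + 2 * (2 * b * A) * Q = K / (real n + 1)"
    proof -
      have "A = Q * (1 / (real n + 1))" "K / (real n + 1) = K * (1 / (real n + 1))" by (simp_all add: A_def)
      then show ?thesis unfolding K_def by (simp only:) (simp only: algebra_simps)
    qed
    ultimately show ?thesis unfolding char_rem_eq[abs_def] S_def by simp
  qed
  moreover have "K \<ge> 0" using b0 Q0 by (simp add: K_def)
  ultimately show ?thesis by blast
qed

lemma sine_coeff_integral:
  "sine_coeff q (2 * n + 1) = integral {0..1} (\<lambda>t. sin (2 * rn n * of_real t) * q t)"
proof -
  have a: "(\<lambda>t. sin (2 * rn n * of_real t) * q t) absolutely_integrable_on {0..1}"
    by (intro absint_continuous_mult q_absint continuous_intros)
  have "sin (2 * rn n * of_real t) * q t = q t * of_real (sin (2 * pi * real (2 * n + 1) * t))" for t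
  proof -
    have "2 * rn n * of_real t = of_real (2 * pi * real (2 * n + 1) * t)" by (simp add: rn_def algebra_simps)
    then show ?thesis by (simp only: sin_of_real mult.commute)
  qed
  then show ?thesis
    using lebesgue_integral_subinterval[OF a, of 0 1] unfolding sine_coeff_def by (simp only: order_refl zero_le_one)
qed

lemma norm_sine_coeff_le: "norm (sine_coeff q (2 * n + 1)) \<le> qnorm"
proof -
  have "norm (integral {0..1} (\<lambda>t. sin (2 * rn n * of_real t) * q t)) \<le> 1 * qnorm"
  proof (rule norm_integral_mult_q_le)
    fix t :: real
    have "2 * rn n * of_real t = of_real (2 * ((2 * real n + 1) * pi) * t)" by (simp add: rn_def)
    then show "norm (sin (2 * rn n * of_real t)) \<le> 1" by (simp only: sin_of_real norm_of_real) simp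
  qed (auto intro!: continuous_intros)
  then show ?thesis unfolding sine_coeff_integral by simp
qed

text \<open>The origin of the sine coefficient: \<open>sin (\<rho>\<^sub>n (1 - t)) = sin (\<rho>\<^sub>n t)\<close> since \<open>\<rho>\<^sub>n\<close> is an odd
  multiple of \<open>\<pi>\<close>, and \<open>2 sin (\<rho>\<^sub>n t) cos (\<rho>\<^sub>n t) = sin (2 \<rho>\<^sub>n t)\<close>.\<close>
lemma kern_sin_cos_rn:
  "kern sin (rn n) (\<lambda>t. cos (rn n * of_real t)) 1 = sine_coeff q (2 * n + 1) / 2"
proof -
  have "sin (rn n * of_real (1 - t)) * (cos (rn n * of_real t) * q t) = (1/2) * (sin (2 * rn n * of_real t) * q t)" for t
  proof -
    have "sin (rn n * of_real (1 - t)) = sin (rn n * of_real t)"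
      by (simp add: right_diff_distrib sin_diff sin_rn cos_rn)
    then show ?thesis using sin_double[of "rn n * of_real t"] by (simp add: mult.assoc)
  qed
  then have "kern sin (rn n) (\<lambda>t. cos (rn n * of_real t)) 1 = integral {0..1} (\<lambda>t. (1/2) * (sin (2 * rn n * of_real t) * q t))"
    unfolding kern_def by (simp only:)
  then show ?thesis unfolding sine_coeff_integral by simp
qed

text \<open>Three replacements lead to the sine coefficient: the solution by its leading term
  \<open>cos (\<rho> t)\<close>, then \<open>\<rho>\<close> by \<open>rn n\<close> in this cosine and in the kernel, and finally \<open>1 / \<rho>\<close> by
  \<open>1 / rn n\<close>.\<close>
lemma bdry_sin_cos_approx:
  assumes n: "6 * qnorm \<le> real n" and \<rho>: "norm (\<rho> - rn n) \<le> 1"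
  shows "norm (bdry sin cos \<rho> - sine_coeff q (2 * n + 1) / (2 * rn n))
           \<le> 19 * qnorm * norm (\<rho> - rn n) / (real n + 1) + 54 * qnorm\<^sup>2 / (real n + 1)\<^sup>2"
proof -
  define d where "d = norm (\<rho> - rn n)"
  define h where "h = 1 / (real n + 1)"
  note near = near_rn[OF n \<rho>]
  have rn: "admissible (rn n)" "\<bar>Im (rn n)\<bar> \<le> 1" using near_rn[OF n, of "rn n"] by auto
  define c where "c = (\<lambda>\<rho> t::real. cos (\<rho> * of_real t) :: complex)"
  have cc: "continuous_on {0..1} (c \<sigma>)" for \<sigma> unfolding c_def by (intro continuous_intros)
  have inv: "1 / norm \<rho> \<le> h" using near(2) by (simp add: h_def frac_le)
  have cf: "continuous_on {0..1} (fund cos \<rho>)" by (rule fund_continuous[OF _ near(1)]) simp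
  have 1: "norm (kern sin \<rho> (\<lambda>t. fund cos \<rho> t - c \<rho> t) 1) \<le> 3 * (18 * qnorm * h) * qnorm"
  proof (rule kern_bound)
    fix t :: real assume t: "t \<in> {0..1}"
    have "norm (fund cos \<rho> t - c \<rho> t) \<le> 18 * qnorm * (1 / norm \<rho>)"
      using fund_near_trig[OF _ near(1) t, of cos] by (simp add: c_def)
    also have "\<dots> \<le> 18 * qnorm * h" using inv qnorm_nonneg by (intro mult_left_mono) auto
    finally show "norm (fund cos \<rho> t - c \<rho> t) \<le> 18 * qnorm * h" .
  qed (use near cf cc in \<open>auto intro: continuous_intros\<close>)
  have 2: "norm (kern sin \<rho> (\<lambda>t. c \<rho> t - c (rn n) t) 1) \<le> 3 * (3 * d) * qnorm"
    by (rule kern_bound) (use near cc norm_trig_mult_diff_le[of cos \<rho> "rn n"] rn in \<open>auto simp: c_def d_def intro!: continuous_intros\<close>)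
  have 3: "norm (kern sin \<rho> (c (rn n)) 1 - kern sin (rn n) (c (rn n)) 1) \<le> 3 * d * 3 * qnorm"
    unfolding d_def
    by (rule kern_lipschitz) (use near cc rn norm_trig_mult_le[of cos "rn n"] in \<open>auto simp: c_def\<close>)
  define E where "E = kern sin \<rho> (fund cos \<rho>) 1 - sine_coeff q (2 * n + 1) / 2"
  have "E = kern sin \<rho> (\<lambda>t. fund cos \<rho> t - c \<rho> t) 1 + (kern sin \<rho> (\<lambda>t. c \<rho> t - c (rn n) t) 1 
       + (kern sin \<rho> (c (rn n)) 1 - kern sin (rn n) (c (rn n)) 1))"
    using kern_diff[OF _ cf cc, of sin 1 \<rho> \<rho>] kern_diff[OF _ cc cc, of sin 1 \<rho> \<rho> "rn n"] kern_sin_cos_rn[of n]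
    by (simp add: E_def c_def)
  then have E: "norm E \<le> 3 * (18 * qnorm * h) * qnorm + (3 * (3 * d) * qnorm + 3 * d * 3 * qnorm)"
    by (simp only:) (intro norm_triangle_mono 1 2 3)
  have "bdry sin cos \<rho> - sine_coeff q (2 * n + 1) / (2 * rn n)
       = E / \<rho> + sine_coeff q (2 * n + 1) / 2 * (1 / \<rho> - 1 / rn n)"
    by (simp add: bdry_def E_def diff_divide_distrib algebra_simps)
  also have "norm \<dots> \<le> (3 * (18 * qnorm * h) * qnorm + (3 * (3 * d) * qnorm + 3 * d * 3 * qnorm)) * h + qnorm * (d * h)"
  proof (rule norm_triangle_mono)
    have "norm (E / \<rho>) = norm E * (1 / norm \<rho>)" by (simp add: norm_divide)
    also have "\<dots> \<le> (3 * (18 * qnorm * h) * qnorm + (3 * (3 * d) * qnorm + 3 * d * 3 * qnorm)) * h"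
      using E inv order_trans[OF norm_ge_zero E] by (intro mult_mono) auto
    finally show "norm (E / \<rho>) \<le> (3 * (18 * qnorm * h) * qnorm + (3 * (3 * d) * qnorm + 3 * d * 3 * qnorm)) * h" .
    have "norm (1 / \<rho> - 1 / rn n) \<le> d * (1 / norm \<rho>)"
      using norm_inverse_diff_le[OF near(1) rn(1)] by (simp add: d_def)
    also have "\<dots> \<le> d * h" using inv by (intro mult_left_mono) (auto simp: d_def)
    finally have "norm (1 / \<rho> - 1 / rn n) \<le> d * h" .
    moreover have "norm (sine_coeff q (2 * n + 1) / 2) \<le> qnorm"
      using norm_sine_coeff_le[of n] qnorm_nonneg by (simp add: norm_divide)
    ultimately show "norm (sine_coeff q (2 * n + 1) / 2 * (1 / \<rho> - 1 / rn n)) \<le> qnorm * (d * h)"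
      unfolding norm_mult using qnorm_nonneg by (intro mult_mono) auto
  qed
  also have "\<dots> = 19 * qnorm * d * h + 54 * qnorm\<^sup>2 * h\<^sup>2" by (simp add: algebra_simps power2_eq_square)
  finally show ?thesis by (simp add: d_def h_def power_divide)
qed

lemma char_rem_approx:
  "\<exists>K\<ge>0. \<forall>n \<rho>. 6 * qnorm \<le> real n \<longrightarrow> norm (\<rho> - rn n) \<le> 1 \<longrightarrow>
     norm (char_rem \<rho> - (1 - \<beta>) * (sine_coeff q (2 * n + 1) / (2 * rn n)))
       \<le> K * (norm (\<rho> - rn n) / (real n + 1) + 1 / (real n + 1)\<^sup>2)"
proof -
  define b where "b = norm \<beta>"
  define Q where "Q = 90 * qnorm"
  define K where "K = (1 + b) * (Q + Q\<^sup>2) + 4 * b * (Q * 3) + 2 * b * Q\<^sup>2"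
  have b0: "b \<ge> 0" and Q0: "Q \<ge> 0" using qnorm_nonneg by (simp_all add: b_def Q_def)
  have K0: "K \<ge> 0" using b0 Q0 by (simp add: K_def)
  have "norm (char_rem \<rho> - (1 - \<beta>) * (sine_coeff q (2 * n + 1) / (2 * rn n)))
       \<le> K * (norm (\<rho> - rn n) / (real n + 1) + 1 / (real n + 1)\<^sup>2)"
    if n: "6 * qnorm \<le> real n" and \<rho>: "norm (\<rho> - rn n) \<le> 1" for n \<rho>
  proof -
    define d where "d = norm (\<rho> - rn n)"
    define h where "h = 1 / (real n + 1)"
    have h0: "h \<ge> 0" and d0: "d \<ge> 0" by (simp_all add: h_def d_def)
    note near = near_rn[OF n \<rho>]
    have rn: "\<bar>Im (rn n)\<bar> \<le> 1" using near_rn[OF n, of "rn n"] by auto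
    have bd: "norm (bdry K T \<rho>) \<le> Q * h" if "K \<in> {sin, cos}" "T \<in> {sin, cos}" for K T
      using bdry_near_rn[OF n that] \<rho> by (auto simp: bounded_lipschitz_def dist_norm norm_minus_commute Q_def h_def)
    have c3: "norm (1 + cos \<rho>) \<le> 3 * d" and s3: "norm (sin \<rho>) \<le> 3 * d"
      using norm_trig_diff_le[OF near(3) rn] by (simp_all add: d_def cos_rn sin_rn add.commute)
    define p where "p = bdry sin cos \<rho> - sine_coeff q (2 * n + 1) / (2 * rn n)"
    have p: "norm p \<le> Q * d * h + Q\<^sup>2 * h\<^sup>2"
    proof -
      have "norm p \<le> 19 * qnorm * d * h + 54 * qnorm\<^sup>2 * h\<^sup>2"
        using bdry_sin_cos_approx[OF n \<rho>] by (simp add: p_def d_def h_def power_divide)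
      also have "\<dots> \<le> Q * d * h + Q\<^sup>2 * h\<^sup>2"
        using qnorm_nonneg d0 h0 unfolding Q_def by (intro add_mono mult_right_mono) (auto simp: power_mult_distrib)
      finally show ?thesis .
    qed
    have eq: "char_rem \<rho> - (1 - \<beta>) * (sine_coeff q (2 * n + 1) / (2 * rn n)) = (1 - \<beta>) * p
     + (\<beta> * (bdry sin cos \<rho> * (1 + cos \<rho>)) + (\<beta> * (bdry cos sin \<rho> * (1 + cos \<rho>))
     + (\<beta> * (bdry sin cos \<rho> * bdry cos sin \<rho>) + ((- \<beta>) * (bdry cos cos \<rho> * sin \<rho>)
     + (\<beta> * (bdry sin sin \<rho> * sin \<rho>) + ((- \<beta>) * (bdry sin sin \<rho> * bdry cos cos \<rho>)))))))"
      unfolding char_rem_eq p_def by (simp add: algebra_simps)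
    have m: "norm (\<beta> * (u * v)) \<le> b * (U * V)" "norm ((- \<beta>) * (u * v)) \<le> b * (U * V)"
      if "norm u \<le> U" "norm v \<le> V" for u v U V
      using that order_trans[OF norm_ge_zero that(1)] order_trans[OF norm_ge_zero that(2)]
      by (auto simp: norm_mult b_def intro!: mult_left_mono mult_mono)
    have "norm ((1 - \<beta>) * p) \<le> (1 + b) * (Q * d * h + Q\<^sup>2 * h\<^sup>2)"
      unfolding norm_mult using p norm_triangle_ineq4[of 1 \<beta>] b0 by (intro mult_mono) (auto simp: b_def)
    then have "norm (char_rem \<rho> - (1 - \<beta>) * (sine_coeff q (2 * n + 1) / (2 * rn n))) \<le> (1 + b) * (Q * d * h + Q\<^sup>2 * h\<^sup>2)
      + (b * ((Q * h) * (3 * d)) + (b * ((Q * h) * (3 * d)) + (b * ((Q * h) * (Q * h)) + (b * ((Q * h) * (3 * d)) 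
      + (b * ((Q * h) * (3 * d)) + b * ((Q * h) * (Q * h)))))))"
      unfolding eq by (intro norm_triangle_mono m bd c3 s3) auto
    also have "\<dots> = (1 + b) * (Q * (d * h) + Q\<^sup>2 * h\<^sup>2) + 4 * b * (Q * 3) * (d * h) + 2 * b * Q\<^sup>2 * h\<^sup>2"
      by (simp add: algebra_simps power2_eq_square)
    also have "\<dots> \<le> (1 + b) * (Q * (d * h + h\<^sup>2) + Q\<^sup>2 * (d * h + h\<^sup>2)) + 4 * b * (Q * 3) * (d * h + h\<^sup>2) + 2 * b * Q\<^sup>2 * (d * h + h\<^sup>2)"
      using b0 Q0 d0 h0 by (intro add_mono mult_left_mono) auto
    also have "\<dots> = K * (d * h + h\<^sup>2)" by (simp add: K_def algebra_simps)
    finally show ?thesis by (simp add: d_def h_def power_divide)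
  qed
  then show ?thesis using K0 by blast
qed

end

section \<open>Zeros of the determinant\<close>

text \<open>For \<open>w = \<bar>\<delta> / z\<bar>\<close> the hypotheses give \<open>\<bar>(\<delta> / z)\<^sup>2 - 1\<bar> \<le> K \<eta> (w\<^sup>2 + w + 1)\<close>.  As
  \<open>K \<eta>\<close> is small, this first bounds \<open>w\<close> and then makes the right-hand side small.\<close>
lemma perturbed_square_root:
  fixes z \<delta> :: complex
  assumes z: "z \<noteq> 0" and K: "K \<ge> 0" and \<eta>: "0 \<le> \<eta>" "\<eta> \<le> 1" "8 * K * \<eta> \<le> 1"
    and \<delta>: "norm \<delta> \<le> \<eta>" and h: "0 \<le> h" "h \<le> \<eta> * norm z"
    and approx: "norm (\<delta>\<^sup>2 - z\<^sup>2) \<le> K * (norm \<delta> ^ 3 + norm \<delta> * h + h\<^sup>2)"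
  shows "norm ((\<delta> / z)\<^sup>2 - 1) \<le> 6 * K * \<eta>"
proof -
  define w where "w = norm (\<delta> / z)"
  have z0: "norm z > 0" using z by simp
  have w0: "w \<ge> 0" and \<delta>w: "norm \<delta> = w * norm z" using z0 by (simp_all add: w_def norm_divide)
  have "norm ((\<delta> / z)\<^sup>2 - 1) * (norm z)\<^sup>2 = norm (\<delta>\<^sup>2 - z\<^sup>2)"
  proof -
    have "((\<delta> / z)\<^sup>2 - 1) * z\<^sup>2 = \<delta>\<^sup>2 - z\<^sup>2" using z by (simp add: field_simps)
    then show ?thesis by (metis norm_mult norm_power)
  qed
  also have "\<dots> \<le> K * (\<eta> * (w * norm z)\<^sup>2 + (w * norm z) * (\<eta> * norm z) + \<eta> * (norm z)\<^sup>2)"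
  proof (rule order_trans[OF approx], intro mult_left_mono add_mono K)
    show "norm \<delta> ^ 3 \<le> \<eta> * (w * norm z)\<^sup>2"
      unfolding \<delta>w[symmetric] power3_eq_cube power2_eq_square mult.assoc using \<delta> by (intro mult_right_mono) auto
    show "norm \<delta> * h \<le> (w * norm z) * (\<eta> * norm z)" unfolding \<delta>w[symmetric] using h by (intro mult_left_mono) auto
    have "h\<^sup>2 \<le> (\<eta> * norm z)\<^sup>2" using h by (intro power_mono)
    also have "\<dots> = \<eta> * (\<eta> * (norm z)\<^sup>2)" by (simp add: power2_eq_square)
    also have "\<dots> \<le> 1 * (\<eta> * (norm z)\<^sup>2)" using \<eta> by (intro mult_right_mono) auto
    finally show "h\<^sup>2 \<le> \<eta> * (norm z)\<^sup>2" by simp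
  qed
  also have "\<dots> = K * \<eta> * (w\<^sup>2 + w + 1) * (norm z)\<^sup>2" by (simp add: power2_eq_square algebra_simps)
  finally have 1: "norm ((\<delta> / z)\<^sup>2 - 1) \<le> K * \<eta> * (w\<^sup>2 + w + 1)" using z0 by simp
  have "(w - 1)\<^sup>2 \<ge> 0" by simp
  then have "2 * w \<le> w\<^sup>2 + 1" by (simp add: power2_eq_square algebra_simps)
  then have "K * \<eta> * (w\<^sup>2 + w + 1) \<le> K * \<eta> * (2 * (w\<^sup>2 + 1))"
    using K \<eta> w0 by (intro mult_left_mono) auto
  with 1 have 2: "norm ((\<delta> / z)\<^sup>2 - 1) \<le> 2 * K * \<eta> * (w\<^sup>2 + 1)" by (simp add: algebra_simps)
  have "w\<^sup>2 = norm ((\<delta> / z)\<^sup>2)" by (simp add: w_def norm_power)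
  then have "w\<^sup>2 \<le> 1 + norm ((\<delta> / z)\<^sup>2 - 1)"
    using norm_triangle_ineq2[of "(\<delta> / z)\<^sup>2" 1] by simp
  moreover have "2 * K * \<eta> * (w\<^sup>2 + 1) \<le> (1/4) * (w\<^sup>2 + 1)"
    using \<eta>(3) by (intro mult_right_mono) auto
  ultimately have "w\<^sup>2 \<le> 1 + (1/4) * (w\<^sup>2 + 1)" using 2 by linarith
  moreover have "X + 1 \<le> 3" if "X \<le> 1 + (1/4) * (X + 1)" for X :: real using that by (simp add: field_simps)
  ultimately have "w\<^sup>2 + 1 \<le> 3" by blast
  then have "2 * K * \<eta> * (w\<^sup>2 + 1) \<le> 2 * K * \<eta> * 3"
    using K \<eta> by (intro mult_left_mono) auto
  then show ?thesis using 2 by simp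
qed

text \<open>The simplified Newton map \<open>\<delta> \<mapsto> \<delta> - G \<delta> / (2 z)\<close> sends the ball into itself, so that Brouwer's
  theorem applies; continuity of \<open>G\<close> is enough.\<close>
lemma perturbed_square_zero_exists:
  fixes z :: complex and G :: "complex \<Rightarrow> complex"
  assumes z: "z \<noteq> 0" and K: "K \<ge> 0" and \<eta>: "12 * K * \<eta> \<le> 1"
    and z\<eta>: "norm z \<le> \<eta>" and \<eta>1: "\<eta> \<le> 1" and h: "0 \<le> h" "h \<le> \<eta> * norm z"
    and cont: "continuous_on (cball z (norm z / 2)) G"
    and approx: "\<And>\<delta>. \<delta> \<in> cball z (norm z / 2) \<Longrightarrow>
       norm (G \<delta> - (\<delta>\<^sup>2 - z\<^sup>2)) \<le> K * (norm \<delta> ^ 3 + norm \<delta> * h + h\<^sup>2)"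
  shows "\<exists>\<delta>\<in>cball z (norm z / 2). G \<delta> = 0"
proof -
  define N where "N = norm z"
  have N0: "N > 0" using z by (simp add: N_def)
  have "\<exists>\<delta>\<in>cball z (N / 2). G \<delta> / (2 * z) = 0"
  proof (rule brouwer_surjective_cball[where S = "{0}"])
    show "continuous_on (cball z (N / 2)) (\<lambda>\<delta>. G \<delta> / (2 * z))"
      using cont z by (intro continuous_intros) (auto simp: N_def)
    fix x y assume "x \<in> {0::complex}" and y: "y \<in> cball z (N / 2)"
    then have x: "x = 0" by simp
    have yz: "norm (y - z) \<le> N / 2" using y by (simp add: dist_norm norm_minus_commute)
    have yn: "norm y \<le> 3/2 * N" using norm_triangle_ineq[of "y - z" z] yz by (simp add: N_def)
    have err: "norm (G y - (y\<^sup>2 - z\<^sup>2)) \<le> N\<^sup>2 / 2"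
    proof -
      have "norm y ^ 3 \<le> (3/2 * N) ^ 3" using yn by (intro power_mono) auto
      also have "\<dots> = 27/8 * (N * N\<^sup>2)" by (simp add: power_mult_distrib power2_eq_square power3_eq_cube)
      also have "\<dots> \<le> 27/8 * (\<eta> * N\<^sup>2)" using z\<eta> by (intro mult_left_mono mult_right_mono) (auto simp: N_def)
      finally have a: "norm y ^ 3 \<le> 27/8 * (\<eta> * N\<^sup>2)" .
      have "norm y * h \<le> (3/2 * N) * (\<eta> * N)" using yn h N0 by (intro mult_mono) (auto simp: N_def)
      then have b: "norm y * h \<le> 3/2 * (\<eta> * N\<^sup>2)" by (simp add: power2_eq_square algebra_simps)
      have "h\<^sup>2 \<le> (\<eta> * N)\<^sup>2" using h by (intro power_mono) (auto simp: N_def)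
      also have "\<dots> = \<eta> * (\<eta> * N\<^sup>2)" by (simp add: power2_eq_square)
      also have "\<dots> \<le> 1 * (\<eta> * N\<^sup>2)" using \<eta>1 order_trans[OF norm_ge_zero z\<eta>] by (intro mult_right_mono) auto
      finally have c: "h\<^sup>2 \<le> \<eta> * N\<^sup>2" by simp
      have "\<eta> * N\<^sup>2 \<ge> 0" using order_trans[OF norm_ge_zero z\<eta>] by simp
      then have "norm y ^ 3 + norm y * h + h\<^sup>2 \<le> 6 * (\<eta> * N\<^sup>2)" using a b c by linarith
      then have "norm (G y - (y\<^sup>2 - z\<^sup>2)) \<le> K * (6 * (\<eta> * N\<^sup>2))"
        using approx[of y] y K by (auto simp: N_def intro: order_trans mult_left_mono)
      also have "\<dots> = (12 * K * \<eta>) * (N\<^sup>2 / 2)" by simp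
      also have "\<dots> \<le> 1 * (N\<^sup>2 / 2)" using \<eta> by (intro mult_right_mono) auto
      finally show ?thesis by simp
    qed
    \<comment> \<open>Newton's step at \<open>z\<close> for \<open>\<delta> \<mapsto> \<delta>\<^sup>2 - z\<^sup>2\<close> leaves a quadratic remainder.\<close>
    have "x + (y - G y / (2 * z)) - z = - ((y - z)\<^sup>2 + (G y - (y\<^sup>2 - z\<^sup>2))) / (2 * z)"
      using z x by (simp add: field_simps power2_eq_square)
    also have "norm \<dots> = norm ((y - z)\<^sup>2 + (G y - (y\<^sup>2 - z\<^sup>2))) / (2 * N)"
      unfolding norm_divide norm_minus_cancel by (simp add: norm_mult N_def)
    also have "\<dots> \<le> ((N / 2)\<^sup>2 + N\<^sup>2 / 2) / (2 * N)"
    proof (intro divide_right_mono norm_triangle_mono err)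
      show "norm ((y - z)\<^sup>2) \<le> (N / 2)\<^sup>2" unfolding norm_power using yz by (intro power_mono) auto
    qed (use N0 in auto)
    also have "\<dots> \<le> N / 2" using N0 by (simp add: power2_eq_square divide_simps)
    finally show "x + (y - G y / (2 * z)) \<in> cball z (N / 2)" by (simp add: dist_norm norm_minus_commute)
  qed (use N0 in auto)
  then show ?thesis using z by (auto simp: N_def)
qed

locale nondegenerate_problem = boundary_problem +
  assumes beta: "\<beta> \<noteq> 1" "\<beta> \<noteq> -1"
begin

lemma beta': "1 + \<beta> \<noteq> 0" "1 - \<beta> \<noteq> 0" "norm (1 + \<beta>) > 0" "norm (1 - \<beta>) > 0"
  using beta by (auto simp: add_eq_0_iff)

text \<open>The determinant as a function of the shift \<open>\<delta> = \<rho> - \<rho>\<^sub>n\<close>, divided by \<open>(1 + \<beta>) / 2\<close>: it is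
  \<open>2 - 2 cos \<delta> \<approx> \<delta>\<^sup>2\<close> for \<open>q = 0\<close>.\<close>
definition redet :: "nat \<Rightarrow> complex \<Rightarrow> complex" where
  "redet n \<delta> = 2 * char_det (rn n + \<delta>) / (1 + \<beta>)"

text \<open>The square of the leading term of the shift.\<close>
definition shift_sq :: "nat \<Rightarrow> complex" where
  "shift_sq n = (\<beta> - 1) / (\<beta> + 1) * sine_coeff q (2 * n + 1) / rn n"

lemma redet_eq: "redet n \<delta> = 2 - 2 * cos \<delta> + 2 / (1 + \<beta>) * char_rem (rn n + \<delta>)"
proof -
  have "cos (rn n + \<delta>) = - cos \<delta>" by (simp add: cos_add cos_rn sin_rn)
  then show ?thesis using beta' by (simp add: redet_def char_rem_def field_simps)
qed

lemma redet_0_iff: "redet n \<delta> = 0 \<longleftrightarrow> char_det (rn n + \<delta>) = 0"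
  using beta' by (simp add: redet_def)

lemma redet_lipschitz:
  "\<exists>K\<ge>0. \<forall>n \<delta> \<epsilon>. 6 * qnorm \<le> real n \<longrightarrow> norm \<delta> \<le> 1 \<longrightarrow> norm \<epsilon> \<le> 1 \<longrightarrow>
     norm ((redet n \<delta> + 2 * cos \<delta>) - (redet n \<epsilon> + 2 * cos \<epsilon>)) \<le> K * (1 / (real n + 1)) * norm (\<delta> - \<epsilon>)"
proof -
  obtain K where K: "K \<ge> 0" "\<And>n. 6 * qnorm \<le> real n \<Longrightarrow> bounded_lipschitz (K / (real n + 1)) (cball (rn n) 1) char_rem"
    using char_rem_bounded_lipschitz by blast
  have "norm ((redet n \<delta> + 2 * cos \<delta>) - (redet n \<epsilon> + 2 * cos \<epsilon>)) \<le> norm (2 / (1 + \<beta>)) * K * (1 / (real n + 1)) * norm (\<delta> - \<epsilon>)"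
    if "6 * qnorm \<le> real n" "norm \<delta> \<le> 1" "norm \<epsilon> \<le> 1" for n \<delta> \<epsilon>
  proof -
    define k where "k = 2 / (1 + \<beta>)"
    have eq: "(redet n \<delta> + 2 * cos \<delta>) - (redet n \<epsilon> + 2 * cos \<epsilon>) = k * (char_rem (rn n + \<delta>) - char_rem (rn n + \<epsilon>))"
      unfolding redet_eq k_def[symmetric] by (simp add: algebra_simps)
    have "norm (char_rem (rn n + \<delta>) - char_rem (rn n + \<epsilon>)) \<le> K * (1 / (real n + 1)) * norm ((rn n + \<delta>) - (rn n + \<epsilon>))"
      using K(2)[OF that(1)] that(2,3) unfolding bounded_lipschitz_def
      by (elim conjE ballE[where x = "rn n + \<delta>"] ballE[where x = "rn n + \<epsilon>"]) (auto simp: dist_norm)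
    then show ?thesis
      unfolding eq k_def[symmetric] norm_mult mult.assoc by (intro mult_left_mono) (simp_all add: mult.assoc)
  qed
  then show ?thesis using K(1) by (intro exI[of _ "norm (2 / (1 + \<beta>)) * K"]) auto
qed

lemma redet_approx:
  "\<exists>K\<ge>0. \<forall>n \<delta>. 6 * qnorm \<le> real n \<longrightarrow> norm \<delta> \<le> 1 \<longrightarrow>
     norm (redet n \<delta> - (\<delta>\<^sup>2 - shift_sq n)) \<le> K * (norm \<delta> ^ 3 + norm \<delta> * (1 / (real n + 1)) + (1 / (real n + 1))\<^sup>2)"
proof -
  obtain K where K: "K \<ge> 0" "\<And>n \<rho>. 6 * qnorm \<le> real n \<Longrightarrow> norm (\<rho> - rn n) \<le> 1 \<Longrightarrow>
     norm (char_rem \<rho> - (1 - \<beta>) * (sine_coeff q (2 * n + 1) / (2 * rn n)))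
       \<le> K * (norm (\<rho> - rn n) / (real n + 1) + 1 / (real n + 1)\<^sup>2)"
    using char_rem_approx by blast
  define L where "L = norm (2 / (1 + \<beta>)) * K"
  have L0: "L \<ge> 0" using K(1) by (simp add: L_def)
  have "norm (redet n \<delta> - (\<delta>\<^sup>2 - shift_sq n)) \<le> (3 + L) * (norm \<delta> ^ 3 + norm \<delta> * (1 / (real n + 1)) + (1 / (real n + 1))\<^sup>2)"
    if n: "6 * qnorm \<le> real n" and \<delta>: "norm \<delta> \<le> 1" for n \<delta>
  proof -
    define h where "h = 1 / (real n + 1)"
    have h0: "h \<ge> 0" by (simp add: h_def)
    define R where "R = char_rem (rn n + \<delta>) - (1 - \<beta>) * (sine_coeff q (2 * n + 1) / (2 * rn n))"
    have s: "shift_sq n = - (2 / (1 + \<beta>)) * ((1 - \<beta>) * (sine_coeff q (2 * n + 1) / (2 * rn n)))"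
    proof -
      have "(\<beta> - 1) / (\<beta> + 1) = - ((1 - \<beta>) / (1 + \<beta>))" by (simp add: minus_divide_left add.commute)
      then show ?thesis by (simp add: shift_sq_def)
    qed
    have "redet n \<delta> - (\<delta>\<^sup>2 - shift_sq n) = (2 - 2 * cos \<delta> - \<delta>\<^sup>2) + 2 / (1 + \<beta>) * R"
    proof -
      define k where "k = 2 / (1 + \<beta>)"
      define X where "X = sine_coeff q (2 * n + 1) / (2 * rn n)"
      show ?thesis unfolding redet_eq s R_def k_def[symmetric] X_def[symmetric] by (simp add: algebra_simps)
    qed
    also have "norm \<dots> \<le> 3 * norm \<delta> ^ 3 + L * (norm \<delta> * h + h\<^sup>2)"
    proof (rule norm_triangle_mono[OF norm_cos_Taylor_le[OF \<delta>]])
      have "norm R \<le> K * (norm \<delta> * h + h\<^sup>2)"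
        using K(2)[OF n, of "rn n + \<delta>"] \<delta> by (simp add: R_def h_def power_divide)
      then show "norm (2 / (1 + \<beta>) * R) \<le> L * (norm \<delta> * h + h\<^sup>2)"
        unfolding norm_mult L_def mult.assoc by (intro mult_left_mono) auto
    qed
    also have "\<dots> \<le> (3 + L) * (norm \<delta> ^ 3 + norm \<delta> * h + h\<^sup>2)"
      using L0 h0 by (simp add: algebra_simps)
    finally show ?thesis by (simp add: h_def)
  qed
  then show ?thesis using L0 by (intro exI[of _ "3 + L"]) auto
qed

text \<open>The difference of the unperturbed parts is at least \<open>\<bar>\<delta> + \<epsilon>\<bar> \<bar>\<delta> - \<epsilon>\<bar> / 4\<close>, and the perturbation
  has Lipschitz constant \<open>O(1/n)\<close>.\<close>
lemma redet_diff_ge: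
  "\<exists>K\<ge>0. \<forall>n \<delta> \<epsilon>. 6 * qnorm \<le> real n \<longrightarrow> norm \<delta> \<le> 1/2 \<longrightarrow> norm \<epsilon> \<le> 1/2 \<longrightarrow>
     (norm (\<delta> + \<epsilon>) / 4 - K * (1 / (real n + 1))) * norm (\<delta> - \<epsilon>) \<le> norm (redet n \<delta> - redet n \<epsilon>)"
proof -
  obtain K where K: "K \<ge> 0" "\<And>n \<delta> \<epsilon>. 6 * qnorm \<le> real n \<Longrightarrow> norm \<delta> \<le> 1 \<Longrightarrow> norm \<epsilon> \<le> 1 \<Longrightarrow>
     norm ((redet n \<delta> + 2 * cos \<delta>) - (redet n \<epsilon> + 2 * cos \<epsilon>)) \<le> K * (1 / (real n + 1)) * norm (\<delta> - \<epsilon>)"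
    using redet_lipschitz by blast
  have "(norm (\<delta> + \<epsilon>) / 4 - K * (1 / (real n + 1))) * norm (\<delta> - \<epsilon>) \<le> norm (redet n \<delta> - redet n \<epsilon>)"
    if "6 * qnorm \<le> real n" "norm \<delta> \<le> 1/2" "norm \<epsilon> \<le> 1/2" for n \<delta> \<epsilon>
  proof -
    have "norm (2 * cos \<delta> - 2 * cos \<epsilon>) - norm (redet n \<delta> - redet n \<epsilon>) \<le> norm ((2 * cos \<delta> - 2 * cos \<epsilon>) + (redet n \<delta> - redet n \<epsilon>))"
      using norm_triangle_ineq2[of "2 * cos \<delta> - 2 * cos \<epsilon>" "- (redet n \<delta> - redet n \<epsilon>)"] by (simp only: norm_minus_cancel diff_minus_eq_add)
    also have "(2 * cos \<delta> - 2 * cos \<epsilon>) + (redet n \<delta> - redet n \<epsilon>) = (redet n \<delta> + 2 * cos \<delta>) - (redet n \<epsilon> + 2 * cos \<epsilon>)"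
      by simp
    also have "norm \<dots> \<le> K * (1 / (real n + 1)) * norm (\<delta> - \<epsilon>)" using K(2)[OF that(1)] that by simp
    finally show ?thesis using norm_cos_diff_ge[OF that(2,3)] by (simp only: left_diff_distrib)
  qed
  then show ?thesis using K(1) by blast
qed

lemma redet_continuous:
  assumes "6 * qnorm \<le> real n" "S \<subseteq> cball 0 1"
  shows "continuous_on S (redet n)"
proof -
  obtain K where K: "\<And>\<delta> \<epsilon>. norm \<delta> \<le> 1 \<Longrightarrow> norm \<epsilon> \<le> 1 \<Longrightarrow>
     norm ((redet n \<delta> + 2 * cos \<delta>) - (redet n \<epsilon> + 2 * cos \<epsilon>)) \<le> K * norm (\<delta> - \<epsilon>)"
    using redet_lipschitz assms(1) by blast
  have "continuous_on S (\<lambda>\<delta>. redet n \<delta> + 2 * cos \<delta>)"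
  proof (rule lipschitz_on_continuous_on)
    show "(max K 0)-lipschitz_on S (\<lambda>\<delta>. redet n \<delta> + 2 * cos \<delta>)"
    proof (rule lipschitz_onI)
      fix x y assume "x \<in> S" "y \<in> S"
      then have "norm x \<le> 1" "norm y \<le> 1" using assms(2) by auto
      from K[OF this] have "norm ((redet n x + 2 * cos x) - (redet n y + 2 * cos y)) \<le> max K 0 * norm (x - y)"
        by (rule order_trans) (intro mult_right_mono, auto)
      then show "dist (redet n x + 2 * cos x) (redet n y + 2 * cos y) \<le> max K 0 * dist x y" by (simp add: dist_norm)
    qed simp
  qed
  then have "continuous_on S (\<lambda>\<delta>. (redet n \<delta> + 2 * cos \<delta>) - 2 * cos \<delta>)"
    by (rule continuous_on_diff) (intro continuous_intros)
  then show ?thesis by simp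
qed

text \<open>The hypothesis \<open>M \<le> (n + 1) \<bar>z\<bar>\<close> makes the errors of \<open>redet_approx\<close> small relative to
  \<open>\<bar>z\<bar>\<^sup>2\<close>.\<close>
lemma redet_zero_asymptotics:
  assumes "\<epsilon> > 0"
  shows "\<exists>M\<ge>1. \<forall>n \<delta> z. M \<le> real n \<longrightarrow> z\<^sup>2 = shift_sq n \<longrightarrow> M \<le> (real n + 1) * norm z \<longrightarrow> norm \<delta> \<le> 1 / M \<longrightarrow>
     redet n \<delta> = 0 \<longrightarrow> norm ((\<delta> / z)\<^sup>2 - 1) \<le> \<epsilon>"
proof -
  obtain K where K: "K \<ge> 0" "\<And>n \<delta>. 6 * qnorm \<le> real n \<Longrightarrow> norm \<delta> \<le> 1 \<Longrightarrow>
     norm (redet n \<delta> - (\<delta>\<^sup>2 - shift_sq n)) \<le> K * (norm \<delta> ^ 3 + norm \<delta> * (1 / (real n + 1)) + (1 / (real n + 1))\<^sup>2)"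
    using redet_approx by blast
  define M where "M = max 1 (max (6 * qnorm) (max (8 * K) (6 * K / \<epsilon>)))"
  have M: "M \<ge> 1" "6 * qnorm \<le> M" "8 * K \<le> M" "6 * K / \<epsilon> \<le> M" by (auto simp: M_def)
  have "norm ((\<delta> / z)\<^sup>2 - 1) \<le> \<epsilon>" if "M \<le> real n" "z\<^sup>2 = shift_sq n" "M \<le> (real n + 1) * norm z" "norm \<delta> \<le> 1 / M" "redet n \<delta> = 0" for n \<delta> z
  proof -
    have "1 / M \<le> 1" using M(1) by simp
    with that(4) have d1: "norm \<delta> \<le> 1" by linarith
    have "norm ((\<delta> / z)\<^sup>2 - 1) \<le> 6 * K * (1 / M)"
    proof (rule perturbed_square_root[where h = "1 / (real n + 1)"])
      show "z \<noteq> 0" using that(3) M(1) by auto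
      show "8 * K * (1 / M) \<le> 1" using M by (simp add: divide_le_eq)
      show "1 / (real n + 1) \<le> 1 / M * norm z" using that(3) M(1) by (simp add: field_simps)
      have "norm (\<delta>\<^sup>2 - z\<^sup>2) = norm (redet n \<delta> - (\<delta>\<^sup>2 - shift_sq n))" using that by (simp add: norm_minus_commute)
      also have "\<dots> \<le> K * (norm \<delta> ^ 3 + norm \<delta> * (1 / (real n + 1)) + (1 / (real n + 1))\<^sup>2)"
        using K(2)[of n \<delta>] that M d1 by simp
      finally show "norm (\<delta>\<^sup>2 - z\<^sup>2) \<le> K * (norm \<delta> ^ 3 + norm \<delta> * (1 / (real n + 1)) + (1 / (real n + 1))\<^sup>2)" .
    qed (use that K M in auto)
    also have "\<dots> \<le> \<epsilon>" using M(1,4) assms by (simp add: field_simps)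
    finally show ?thesis .
  qed
  then show ?thesis using M(1) by blast
qed

lemma redet_zero_exists:
  "\<exists>M\<ge>1. \<forall>n z. M \<le> real n \<longrightarrow> z\<^sup>2 = shift_sq n \<longrightarrow> M \<le> (real n + 1) * norm z \<longrightarrow> norm z \<le> 1 / M \<longrightarrow>
     (\<exists>\<delta>\<in>cball z (norm z / 2). redet n \<delta> = 0)"
proof -
  obtain K where K: "K \<ge> 0" "\<And>n \<delta>. 6 * qnorm \<le> real n \<Longrightarrow> norm \<delta> \<le> 1 \<Longrightarrow>
     norm (redet n \<delta> - (\<delta>\<^sup>2 - shift_sq n)) \<le> K * (norm \<delta> ^ 3 + norm \<delta> * (1 / (real n + 1)) + (1 / (real n + 1))\<^sup>2)"
    using redet_approx by blast
  define M where "M = max 2 (max (6 * qnorm) (12 * K))"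
  have M: "M \<ge> 2" "6 * qnorm \<le> M" "12 * K \<le> M" by (auto simp: M_def)
  have "\<exists>\<delta>\<in>cball z (norm z / 2). redet n \<delta> = 0"
    if "M \<le> real n" "z\<^sup>2 = shift_sq n" "M \<le> (real n + 1) * norm z" "norm z \<le> 1 / M" for n z
  proof (rule perturbed_square_zero_exists[where h = "1 / (real n + 1)" and \<eta> = "1 / M"])
    have n: "6 * qnorm \<le> real n" using M that by linarith
    have "1 / M \<le> 1 / 2" using M by (intro divide_left_mono) auto
    then have z2: "norm z \<le> 1/2" using that by linarith
    have sub: "norm \<delta> \<le> 1" if "\<delta> \<in> cball z (norm z / 2)" for \<delta>
      using norm_triangle_ineq[of "\<delta> - z" z] that z2 by (simp add: dist_norm norm_minus_commute)
    show "z \<noteq> 0" using that(3) M(1) by auto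
    show "12 * K * (1 / M) \<le> 1" using M by (simp add: divide_le_eq)
    show "1 / (real n + 1) \<le> 1 / M * norm z" using that(3) M(1) by (simp add: field_simps)
    show "continuous_on (cball z (norm z / 2)) (redet n)" using sub by (intro redet_continuous n) auto
    show "norm (redet n \<delta> - (\<delta>\<^sup>2 - z\<^sup>2)) \<le> K * (norm \<delta> ^ 3 + norm \<delta> * (1 / (real n + 1)) + (1 / (real n + 1))\<^sup>2)"
      if "\<delta> \<in> cball z (norm z / 2)" for \<delta>
      using K(2)[OF n sub[OF that]] \<open>z\<^sup>2 = shift_sq n\<close> by simp
  qed (use that K M in auto)
  then show ?thesis using M(1) by (intro exI[of _ M]) auto
qed

text \<open>With \<open>a = y 0\<close>, the second boundary equation bounds the sine component by
  \<open>\<bar>m21 / m22\<bar> \<bar>a\<bar>\<close>.  Here \<open>m21 = O(\<bar>\<delta>\<bar> + 1/n)\<close>, because \<open>sin \<rho>\<^sub>n = 0\<close>, and \<open>m22 \<approx> 1 - \<beta>\<close>,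
  because \<open>cos \<rho>\<^sub>n = -1\<close>.\<close>
lemma eigenfunction_near_cos:
  "\<exists>M\<ge>1. \<exists>K\<ge>0. \<forall>n \<delta>. M \<le> real n \<longrightarrow> norm \<delta> \<le> 1 / M \<longrightarrow>
     admissible (rn n + \<delta>) \<and> m22 (rn n + \<delta>) \<noteq> 0 \<and>
     (\<forall>y. eigenfunction q \<beta> ((rn n + \<delta>)\<^sup>2) y \<longrightarrow>
        (\<forall>x\<in>{0..1}. norm (y x - y 0 * cos (rn n * of_real x)) \<le> K * (norm \<delta> + 1 / (real n + 1)) * norm (y 0)))"
proof -
  define b where "b = norm \<beta>"
  define Q where "Q = 3 + 18 * qnorm"
  define B where "B = norm (1 - \<beta>)"
  have b0: "b \<ge> 0" and Q0: "Q \<ge> 3" and B0: "B > 0" using qnorm_nonneg beta' by (simp_all add: b_def Q_def B_def)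
  define M where "M = max 1 (max (6 * qnorm) (4 * b * Q / B))"
  have M: "M \<ge> 1" "6 * qnorm \<le> M" "4 * b * Q / B \<le> M" by (auto simp: M_def)
  define K where "K = 2 * Q + 12 * b * Q / B"
  have K0: "K \<ge> 0" using b0 Q0 B0 by (simp add: K_def)
  have main: "admissible (rn n + \<delta>) \<and> m22 (rn n + \<delta>) \<noteq> 0 \<and>
     (\<forall>y. eigenfunction q \<beta> ((rn n + \<delta>)\<^sup>2) y \<longrightarrow>
        (\<forall>x\<in>{0..1}. norm (y x - y 0 * cos (rn n * of_real x)) \<le> K * (norm \<delta> + 1 / (real n + 1)) * norm (y 0)))"
    if n: "M \<le> real n" and \<delta>: "norm \<delta> \<le> 1 / M" for n \<delta>
  proof -
    define \<rho> where "\<rho> = rn n + \<delta>"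
    define h where "h = 1 / (real n + 1)"
    define t where "t = norm \<delta> + h"
    have n': "6 * qnorm \<le> real n" using n M by linarith
    have "1 / M \<le> 1" using M by simp
    then have \<delta>1: "norm \<delta> \<le> 1" using \<delta> by linarith
    have d: "norm (\<rho> - rn n) = norm \<delta>" by (simp add: \<rho>_def)
    note near = near_rn[OF n' \<delta>1[folded d]]
    have rn: "\<bar>Im (rn n)\<bar> \<le> 1" using near_rn[OF n', of "rn n"] by auto
    have h0: "h > 0" by (simp add: h_def)
    have t0: "t \<ge> 0" using h0 by (simp add: t_def)
    have "h \<le> 1 / M" unfolding h_def using n M by (intro frac_le) auto
    then have tM: "t \<le> 2 / M" using \<delta> by (simp add: t_def)
    have inv: "18 * qnorm / norm \<rho> \<le> 18 * qnorm * h"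
      using near(2) qnorm_nonneg frac_le[of "18 * qnorm" "18 * qnorm" "real n + 1" "norm \<rho>"] by (simp add: h_def)
    have QT: "3 * norm \<delta> + 18 * qnorm * h \<le> Q * t"
      using qnorm_nonneg h0 by (simp add: Q_def t_def algebra_simps)
    have bd: "norm (bdry K T \<rho>) \<le> 18 * qnorm * h" if "K \<in> {sin, cos}" "T \<in> {sin, cos}" for K T
      using bdry_bound[OF that near(1)] inv by linarith
    have c3: "norm (1 + cos \<rho>) \<le> 3 * norm \<delta>" and s3: "norm (sin \<rho>) \<le> 3 * norm \<delta>"
      using norm_trig_diff_le[OF near(3) rn] by (simp_all add: d cos_rn sin_rn add.commute)
    have m22: "norm (m22 \<rho> - (1 - \<beta>)) \<le> B / 2"
    proof -
      have "m22 \<rho> - (1 - \<beta>) = \<beta> * ((1 + cos \<rho>) + bdry cos sin \<rho>)" by (simp add: m22_def algebra_simps)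
      also have "norm \<dots> \<le> b * (3 * norm \<delta> + 18 * qnorm * h)"
        unfolding norm_mult b_def[symmetric] using b0 by (intro mult_left_mono norm_triangle_mono c3 bd) auto
      also have "\<dots> \<le> b * (Q * (2 / M))"
        using QT mult_left_mono[OF tM, of Q] Q0 b0 by (intro mult_left_mono) linarith+
      also have "\<dots> \<le> B / 2" using M(1,3) B0 by (simp add: field_simps)
      finally show ?thesis .
    qed
    have m22': "norm (m22 \<rho>) \<ge> B / 2"
      using norm_triangle_ineq2[of "1 - \<beta>" "(1 - \<beta>) - m22 \<rho>"] m22 by (simp add: B_def norm_minus_commute)
    then have m220: "m22 \<rho> \<noteq> 0" using B0 by auto
    have m21: "norm (m21 \<rho>) \<le> b * (Q * t)"
    proof -
      have "norm (m21 \<rho>) \<le> b * (3 * norm \<delta> + 18 * qnorm * h)"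
        unfolding m21_def norm_mult b_def[symmetric] using b0 s3 by (intro mult_left_mono norm_triangle_mono bd) auto
      also have "\<dots> \<le> b * (Q * t)" using QT b0 by (intro mult_left_mono)
      finally show ?thesis .
    qed
    define r where "r = - m21 \<rho> / m22 \<rho>"
    have r: "norm r \<le> 2 * b * Q / B * t"
    proof -
      have "norm r \<le> b * (Q * t) / (B / 2)"
        unfolding r_def norm_divide norm_minus_cancel using m21 m22' B0 b0 Q0 t0 by (intro frac_le) auto
      then show ?thesis by (simp add: algebra_simps)
    qed
    have "norm (y x - y 0 * cos (rn n * of_real x)) \<le> K * t * norm (y 0)"
      if y: "eigenfunction q \<beta> (\<rho>\<^sup>2) y" and x: "x \<in> {0..1}" for y x
    proof -
      have "comb \<rho> 1 r x - cos (rn n * of_real x) = (fund cos \<rho> x - cos (\<rho> * of_real x))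
         + ((cos (\<rho> * of_real x) - cos (rn n * of_real x)) + r * fund sin \<rho> x)"
        by (simp add: comb_def)
      also have "norm \<dots> \<le> 18 * qnorm * h + (3 * norm \<delta> + 2 * b * Q / B * t * 6)"
      proof (intro norm_triangle_mono)
        show "norm (fund cos \<rho> x - cos (\<rho> * of_real x)) \<le> 18 * qnorm * h"
          using fund_near_trig[OF _ near(1) x, of cos] inv by simp
        show "norm (cos (\<rho> * of_real x) - cos (rn n * of_real x)) \<le> 3 * norm \<delta>"
          using norm_trig_mult_diff_le[OF _ near(3) rn x, of cos] d by simp
        show "norm (r * fund sin \<rho> x) \<le> 2 * b * Q / B * t * 6"
          unfolding norm_mult using r fund_bound[OF _ near(1) x, of sin] order_trans[OF norm_ge_zero r] by (intro mult_mono) auto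
      qed
      also have "\<dots> \<le> K * t"
      proof -
        have "0 \<le> Q * t" using Q0 t0 by (intro mult_nonneg_nonneg) linarith+
        with QT show ?thesis by (simp add: K_def algebra_simps)
      qed
      finally have c: "norm (comb \<rho> 1 r x - cos (rn n * of_real x)) \<le> K * t" .
      have "y x - y 0 * cos (rn n * of_real x) = (comb \<rho> 1 r x - cos (rn n * of_real x)) * y 0"
        using eigenfunction_eq_comb[OF near(1) m220 y x] by (simp add: r_def algebra_simps)
      then show ?thesis unfolding norm_mult[symmetric] using c by (simp add: norm_mult mult_right_mono)
    qed
    then show ?thesis using near(1) m220 by (simp add: \<rho>_def t_def h_def)
  qed
  then show ?thesis using K0 M(1) by blast
qed

text \<open>For \<open>\<epsilon>\<close> with \<open>\<bar>\<epsilon> - \<delta>\<bar> < \<bar>\<delta>\<bar>\<close> one has \<open>\<bar>\<epsilon> + \<delta>\<bar> \<ge> \<bar>\<delta>\<bar>\<close>, so \<open>redet_diff_ge\<close> bounds the determinant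
  from below by a multiple of \<open>\<bar>\<delta>\<bar> \<bar>\<epsilon> - \<delta>\<bar>\<close> as soon as \<open>n \<bar>\<delta>\<bar>\<close> is large.\<close>
lemma simple_near_rn:
  "\<exists>M\<ge>1. \<forall>n \<delta> u. M \<le> real n \<longrightarrow> norm \<delta> \<le> 1 / M \<longrightarrow> M \<le> (real n + 1) * norm \<delta> \<longrightarrow>
     eigenfunction q \<beta> ((rn n + \<delta>)\<^sup>2) u \<longrightarrow>
     simple_eigenvalue q \<beta> ((rn n + \<delta>)\<^sup>2) \<and>
     (\<forall>y. root_function q \<beta> ((rn n + \<delta>)\<^sup>2) y \<longrightarrow> eigenfunction q \<beta> ((rn n + \<delta>)\<^sup>2) y)"
proof -
  obtain K where K: "K \<ge> 0" "\<And>n \<delta> \<epsilon>. 6 * qnorm \<le> real n \<Longrightarrow> norm \<delta> \<le> 1/2 \<Longrightarrow> norm \<epsilon> \<le> 1/2 \<Longrightarrow>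
     (norm (\<delta> + \<epsilon>) / 4 - K * (1 / (real n + 1))) * norm (\<delta> - \<epsilon>) \<le> norm (redet n \<delta> - redet n \<epsilon>)"
    using redet_diff_ge by blast
  obtain M0 where M0: "M0 \<ge> 1" "\<And>n \<delta>. M0 \<le> real n \<Longrightarrow> norm \<delta> \<le> 1 / M0 \<Longrightarrow> admissible (rn n + \<delta>) \<and> m22 (rn n + \<delta>) \<noteq> 0"
    using eigenfunction_near_cos by blast
  define M where "M = max (4 * M0) (max (6 * qnorm) (8 * K))"
  have M: "M \<ge> 4 * M0" "6 * qnorm \<le> M" "8 * K \<le> M" by (auto simp: M_def)
  have main: "simple_eigenvalue q \<beta> ((rn n + \<delta>)\<^sup>2) \<and>
     (\<forall>y. root_function q \<beta> ((rn n + \<delta>)\<^sup>2) y \<longrightarrow> eigenfunction q \<beta> ((rn n + \<delta>)\<^sup>2) y)"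
    if n: "M \<le> real n" and \<delta>: "norm \<delta> \<le> 1 / M" "M \<le> (real n + 1) * norm \<delta>" and u: "eigenfunction q \<beta> ((rn n + \<delta>)\<^sup>2) u" for n \<delta> u
  proof -
    define \<rho> where "\<rho> = rn n + \<delta>"
    have n': "6 * qnorm \<le> real n" "M0 \<le> real n" using n M M0(1) by linarith+
    have "1 / M \<le> 1 / (4 * M0)" using M M0(1) by (intro divide_left_mono) auto
    then have "norm \<delta> \<le> 1 / (4 * M0)" using \<delta> by linarith
    then have "4 * norm \<delta> \<le> 1 / M0" using M0 by (simp add: field_simps)
    moreover have "1 / M0 \<le> 1" "0 \<le> 1 / M0" using M0 by simp_all
    ultimately have d: "norm \<delta> \<le> 1/4" "2 * norm \<delta> \<le> 1 / M0" by (linarith, linarith)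
    have \<delta>0: "norm \<delta> > 0" using \<delta>(2) M M0(1) by (cases "\<delta> = 0") auto
    have a: "admissible \<rho>" "m22 \<rho> \<noteq> 0" using M0(2)[OF n'(2), of \<delta>] d \<delta>0 by (auto simp: \<rho>_def)
    have z: "redet n \<delta> = 0"
      using eigenfunction_imp_char_det_zero[OF a u[folded \<rho>_def]] by (simp add: redet_0_iff \<rho>_def)
    define c where "c = norm (1 + \<beta>) * norm \<delta> / 16"
    have c0: "c > 0" using \<delta>0 beta' by (simp add: c_def)
    have low: "admissible \<sigma> \<and> c * norm (\<sigma> - \<rho>) \<le> norm (char_det \<sigma>)" if \<sigma>: "norm (\<sigma> - \<rho>) < norm \<delta>" for \<sigma>
    proof -
      define \<epsilon> where "\<epsilon> = \<sigma> - rn n"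
      have e: "\<epsilon> - \<delta> = \<sigma> - \<rho>" by (simp add: \<epsilon>_def \<rho>_def)
      have \<sigma>': "norm (\<epsilon> - \<delta>) < norm \<delta>" using \<sigma> unfolding e .
      have "norm \<epsilon> \<le> norm (\<epsilon> - \<delta>) + norm \<delta>" using norm_triangle_ineq[of "\<epsilon> - \<delta>" \<delta>] by simp
      with \<sigma>' have \<epsilon>: "norm \<epsilon> \<le> 2 * norm \<delta>" by linarith
      have adm: "admissible \<sigma>" using M0(2)[OF n'(2), of \<epsilon>] \<epsilon> d by (simp add: \<epsilon>_def)
      have "2 * \<delta> = (\<epsilon> + \<delta>) - (\<epsilon> - \<delta>)" by simp
      then have "2 * norm \<delta> \<le> norm (\<epsilon> + \<delta>) + norm (\<epsilon> - \<delta>)"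
        by (metis norm_mult norm_numeral norm_triangle_ineq4)
      with \<sigma>' have sum: "norm \<delta> \<le> norm (\<epsilon> + \<delta>)" by linarith
      have "K * (1 / (real n + 1)) \<le> norm \<delta> / 8" using \<delta>(2) M(3) by (simp add: field_simps)
      then have "norm \<delta> / 8 * norm (\<epsilon> - \<delta>) \<le> (norm (\<epsilon> + \<delta>) / 4 - K * (1 / (real n + 1))) * norm (\<epsilon> - \<delta>)"
        using sum by (intro mult_right_mono) auto
      also have "\<dots> \<le> norm (redet n \<epsilon> - redet n \<delta>)" using \<epsilon> d by (intro K(2) n'(1)) auto
      also have "\<dots> = 2 * norm (char_det \<sigma>) / norm (1 + \<beta>)" unfolding z by (simp add: redet_def \<epsilon>_def norm_divide norm_mult)
      finally have "c * norm (\<sigma> - \<rho>) \<le> norm (char_det \<sigma>)" using beta' unfolding e c_def by (simp add: field_simps)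
      then show ?thesis using adm by simp
    qed
    show ?thesis
      using simple_eigenvalueI[OF u[folded \<rho>_def] a c0 \<delta>0 low] unfolding \<rho>_def by blast
  qed
  have "M \<ge> 1" using M M0(1) by linarith
  with main show ?thesis by blast
qed

lemma distinct_zeros:
  "\<exists>K\<ge>0. \<forall>n \<delta> \<epsilon>. 6 * qnorm \<le> real n \<longrightarrow> norm \<delta> \<le> 1/2 \<longrightarrow> norm \<epsilon> \<le> 1/2 \<longrightarrow> redet n \<delta> = 0 \<longrightarrow> redet n \<epsilon> = 0 \<longrightarrow>
    \<delta> \<noteq> \<epsilon> \<longrightarrow> (real n + 1) * norm (\<delta> + \<epsilon>) \<le> K"
proof -
  obtain K where K: "K \<ge> 0" "\<And>n \<delta> \<epsilon>. 6 * qnorm \<le> real n \<Longrightarrow> norm \<delta> \<le> 1/2 \<Longrightarrow> norm \<epsilon> \<le> 1/2 \<Longrightarrow>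
     (norm (\<delta> + \<epsilon>) / 4 - K * (1 / (real n + 1))) * norm (\<delta> - \<epsilon>) \<le> norm (redet n \<delta> - redet n \<epsilon>)"
    using redet_diff_ge by blast
  have "(real n + 1) * norm (\<delta> + \<epsilon>) \<le> 4 * K" 
    if "6 * qnorm \<le> real n" "norm \<delta> \<le> 1/2" "norm \<epsilon> \<le> 1/2" "redet n \<delta> = 0" "redet n \<epsilon> = 0" "\<delta> \<noteq> \<epsilon>" for n \<delta> \<epsilon>
  proof -
    have "(norm (\<delta> + \<epsilon>) / 4 - K * (1 / (real n + 1))) * norm (\<delta> - \<epsilon>) \<le> 0" using K(2)[OF that(1-3)] that by simp
    then have "norm (\<delta> + \<epsilon>) / 4 - K * (1 / (real n + 1)) \<le> 0" using that(6) by (simp add: mult_le_0_iff)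
    then show ?thesis by (simp add: field_simps)
  qed
  then show ?thesis using K(1) by (intro exI[of _ "4 * K"]) auto
qed

end

section \<open>Bounds satisfied by a Riesz basis\<close>

lemma L2D:
  assumes "f \<in> L2"
  shows "f \<in> borel_measurable leb01" "integrable leb01 (\<lambda>x. (norm (f x))\<^sup>2)"
  using assms by (auto simp: L2_def)

lemma L2_lincomb:
  assumes "f \<in> L2" "g \<in> L2"
  shows "(\<lambda>x. a * f x + b * g x) \<in> L2"
proof -
  note f = L2D[OF assms(1)] and g = L2D[OF assms(2)]
  have m: "(\<lambda>x. a * f x + b * g x) \<in> borel_measurable leb01" using f(1) g(1) by measurable
  have "integrable leb01 (\<lambda>x. (norm (a * f x + b * g x))\<^sup>2)"
  proof (rule Bochner_Integration.integrable_bound)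
    show "integrable leb01 (\<lambda>x. 2 * (norm a)\<^sup>2 * (norm (f x))\<^sup>2 + 2 * (norm b)\<^sup>2 * (norm (g x))\<^sup>2)"
      using f(2) g(2) by simp
    show "(\<lambda>x. (norm (a * f x + b * g x))\<^sup>2) \<in> borel_measurable leb01" using m by measurable
    have "(norm (u + v))\<^sup>2 \<le> 2 * (norm u)\<^sup>2 + 2 * (norm v)\<^sup>2" for u v :: complex
    proof -
      have "(norm (u + v))\<^sup>2 \<le> (norm u + norm v)\<^sup>2" by (intro power_mono norm_triangle_ineq) auto
      also have "\<dots> \<le> 2 * (norm u)\<^sup>2 + 2 * (norm v)\<^sup>2"
        using sum_squares_bound[of "norm u" "norm v"] by (simp add: power2_sum)
      finally show ?thesis .
    qed
    from this[of "a * f x" "b * g x" for x]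
    show "AE x in leb01. norm ((norm (a * f x + b * g x))\<^sup>2) \<le> norm (2 * (norm a)\<^sup>2 * (norm (f x))\<^sup>2 + 2 * (norm b)\<^sup>2 * (norm (g x))\<^sup>2)"
      by (intro AE_I2) (simp add: norm_mult power_mult_distrib mult.assoc)
  qed
  then show ?thesis using m by (simp add: L2_def)
qed

lemma L2_mult_cnj_integrable:
  assumes "f \<in> L2" "g \<in> L2"
  shows "integrable leb01 (\<lambda>x. f x * cnj (g x))"
proof (rule Bochner_Integration.integrable_bound)
  note f = L2D[OF assms(1)] and g = L2D[OF assms(2)]
  show "integrable leb01 (\<lambda>x. (norm (f x))\<^sup>2 + (norm (g x))\<^sup>2)" using f(2) g(2) by simp
  show "(\<lambda>x. f x * cnj (g x)) \<in> borel_measurable leb01" 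
    using f(1) borel_measurable_continuous_onI[OF continuous_on_cnj[OF continuous_on_id]] g(1) 
    by (intro borel_measurable_times) (auto intro: measurable_compose)
  have "norm u * norm v \<le> (norm u)\<^sup>2 + (norm v)\<^sup>2" for u v :: complex
  proof -
    have "2 * (norm u * norm v) \<le> (norm u)\<^sup>2 + (norm v)\<^sup>2"
      using sum_squares_bound[of "norm u" "norm v"] by (simp add: mult.assoc)
    moreover have "0 \<le> norm u * norm v" by simp
    ultimately show ?thesis by linarith
  qed
  then show "AE x in leb01. norm (f x * cnj (g x)) \<le> norm ((norm (f x))\<^sup>2 + (norm (g x))\<^sup>2)"
    by (intro AE_I2) (simp add: norm_mult)
qed

lemma l2_inner_self: "l2_inner f f = of_real ((l2_norm f)\<^sup>2)"
proof -
  have "l2_inner f f = (LINT x|leb01. complex_of_real ((norm (f x))\<^sup>2))"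
    unfolding l2_inner_def by (simp add: complex_norm_square[symmetric])
  also have "\<dots> = of_real (LINT x|leb01. (norm (f x))\<^sup>2)" by (rule integral_complex_of_real)
  also have "(LINT x|leb01. (norm (f x))\<^sup>2) = (l2_norm f)\<^sup>2" by (simp add: l2_norm_def)
  finally show ?thesis .
qed

lemma l2_norm_nonneg: "l2_norm f \<ge> 0"
  by (simp add: l2_norm_def)

lemma l2_norm_cong_AE:
  assumes "f \<in> L2" "g \<in> L2" "AE x in leb01. f x = g x"
  shows "l2_norm f = l2_norm g"
proof -
  have "(LINT x|leb01. (norm (f x))\<^sup>2) = (LINT x|leb01. (norm (g x))\<^sup>2)"
    using L2D[OF assms(1)] L2D[OF assms(2)] assms(3) by (intro integral_cong_AE) auto
  then show ?thesis by (simp add: l2_norm_def)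
qed

lemma l2_norm_orthonormal_pair:
  assumes g: "orthonormal_basis g" and ij: "i \<noteq> j"
  shows "(l2_norm (\<lambda>x. a * g i x + b * g j x))\<^sup>2 = (norm a)\<^sup>2 + (norm b)\<^sup>2"
proof -
  have L: "g k \<in> L2" for k using g by (simp add: orthonormal_basis_def)
  have ip: "l2_inner (g k) (g l) = (if k = l then 1 else 0)" for k l using g by (simp add: orthonormal_basis_def)
  note i = L2_mult_cnj_integrable[OF L L]
  let ?h = "\<lambda>x. a * g i x + b * g j x"
  have "l2_inner ?h ?h = (LINT x|leb01. ((a * cnj a) * (g i x * cnj (g i x)) + (a * cnj b) * (g i x * cnj (g j x)))
      + ((b * cnj a) * (g j x * cnj (g i x)) + (b * cnj b) * (g j x * cnj (g j x))))"
    unfolding l2_inner_def by (intro Bochner_Integration.integral_cong) (simp_all add: algebra_simps)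
  also have "\<dots> = ((a * cnj a) * l2_inner (g i) (g i) + (a * cnj b) * l2_inner (g i) (g j))
      + ((b * cnj a) * l2_inner (g j) (g i) + (b * cnj b) * l2_inner (g j) (g j))"
    unfolding l2_inner_def using i by simp
  also have "\<dots> = of_real ((norm a)\<^sup>2 + (norm b)\<^sup>2)"
    using ij by (simp add: ip complex_norm_square[symmetric])
  finally show ?thesis unfolding l2_inner_self of_real_eq_iff .
qed

text \<open>The operator mapping an orthonormal basis to \<open>e\<close> gives the bound \<open>A\<close>.  Its inverse maps
  \<open>a e\<^sub>i + b e\<^sub>j\<close> back to \<open>a g\<^sub>i + b g\<^sub>j\<close>, whose squared norm is \<open>\<bar>a\<bar>\<^sup>2 + \<bar>b\<bar>\<^sup>2\<close>.\<close>
lemma riesz_basis_bounds: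
  assumes "riesz_basis e"
  obtains A B where "\<And>i. l2_norm (e i) \<le> A" 
    "\<And>i j a b. i \<noteq> j \<Longrightarrow> (norm a)\<^sup>2 + (norm b)\<^sup>2 \<le> (B * l2_norm (\<lambda>x. a * e i x + b * e j x))\<^sup>2"
proof -
  obtain g U where e: "\<And>i. e i \<in> L2" and g: "orthonormal_basis g" and U: "boundedly_invertible U"
    and eU: "\<And>i. AE x in leb01. e i x = U (g i) x"
    using assms unfolding riesz_basis_def by blast
  obtain V where bU: "bounded_l2_operator U" and bV: "bounded_l2_operator V"
    and VU: "\<And>f. f \<in> L2 \<Longrightarrow> AE x in leb01. V (U f) x = f x"
    using U unfolding boundedly_invertible_def by blast
  have gL: "g i \<in> L2" for i using g by (simp add: orthonormal_basis_def)
  have UL: "U f \<in> L2" if "f \<in> L2" for f using bU that by (simp add: bounded_l2_operator_def)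
  have VL: "V f \<in> L2" if "f \<in> L2" for f using bV that by (simp add: bounded_l2_operator_def)
  obtain A where A: "\<And>f. f \<in> L2 \<Longrightarrow> l2_norm (U f) \<le> A * l2_norm f"
    using bU unfolding bounded_l2_operator_def by blast
  obtain B where B: "\<And>f. f \<in> L2 \<Longrightarrow> l2_norm (V f) \<le> B * l2_norm f"
    using bV unfolding bounded_l2_operator_def by blast
  have g1: "l2_norm (g i) = 1" for i
  proof -
    have "complex_of_real ((l2_norm (g i))\<^sup>2) = of_real 1" using g unfolding l2_inner_self[symmetric] by (simp add: orthonormal_basis_def)
    then have "(l2_norm (g i))\<^sup>2 = 1" unfolding of_real_eq_iff .
    then show ?thesis using l2_norm_nonneg[of "g i"] by (simp add: power2_eq_1_iff)
  qed
  have "l2_norm (e i) \<le> A" for i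
    using A[OF gL, of i] l2_norm_cong_AE[OF e UL[OF gL] eU, of i] by (simp add: g1)
  moreover have "(norm a)\<^sup>2 + (norm b)\<^sup>2 \<le> (B * l2_norm (\<lambda>x. a * e i x + b * e j x))\<^sup>2" if ij: "i \<noteq> j" for i j a b
  proof -
    let ?f = "\<lambda>x. a * U (g i) x + b * U (g j) x"
    have fL: "?f \<in> L2" by (intro L2_lincomb UL gL)
    have "AE x in leb01. V ?f x = a * V (U (g i)) x + b * V (U (g j)) x"
      using bV UL gL unfolding bounded_l2_operator_def by blast
    with VU[OF gL, of i] VU[OF gL, of j] have "AE x in leb01. V ?f x = a * g i x + b * g j x"
      by eventually_elim simp
    then have "l2_norm (V ?f) = l2_norm (\<lambda>x. a * g i x + b * g j x)"
      by (intro l2_norm_cong_AE VL fL L2_lincomb gL)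
    moreover have "l2_norm ?f = l2_norm (\<lambda>x. a * e i x + b * e j x)"
    proof (intro l2_norm_cong_AE fL L2_lincomb e)
      show "AE x in leb01. ?f x = a * e i x + b * e j x"
        using eU[of i] eU[of j] by eventually_elim simp
    qed
    ultimately have "l2_norm (\<lambda>x. a * g i x + b * g j x) \<le> B * l2_norm (\<lambda>x. a * e i x + b * e j x)"
      using B[OF fL] by simp
    then have "(l2_norm (\<lambda>x. a * g i x + b * g j x))\<^sup>2 \<le> (B * l2_norm (\<lambda>x. a * e i x + b * e j x))\<^sup>2"
      by (intro power_mono l2_norm_nonneg)
    then show ?thesis by (simp only: l2_norm_orthonormal_pair[OF g ij])
  qed
  ultimately show ?thesis using that by blast
qed

lemma l2_norm_continuous:
  assumes "continuous_on {0..1} f"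
  shows "(l2_norm f)\<^sup>2 = integral {0..1} (\<lambda>x. (norm (f x))\<^sup>2)"
proof -
  have "integrable leb01 (\<lambda>x. (norm (f x))\<^sup>2)"
    by (intro continuous_imp_integrable_real continuous_intros assms)
  then have "(LINT x|leb01. (norm (f x))\<^sup>2) = integral {0..1} (\<lambda>x. (norm (f x))\<^sup>2)"
    by (simp add: lebesgue_integral_eq_integral)
  moreover have "(l2_norm f)\<^sup>2 = (LINT x|leb01. (norm (f x))\<^sup>2)" by (simp add: l2_norm_def)
  ultimately show ?thesis by simp
qed

lemma l2_norm_le_sup:
  assumes f: "continuous_on {0..1} f" and B: "\<And>x. x \<in> {0..1} \<Longrightarrow> norm (f x) \<le> B"
  shows "l2_norm f \<le> B"
proof -
  have B0: "B \<ge> 0" using order_trans[OF norm_ge_zero B[of 0]] by simp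
  have "integral {0..1} (\<lambda>x. (norm (f x))\<^sup>2) \<le> integral {0..1} (\<lambda>x::real. B\<^sup>2)"
    using B by (intro integral_le integrable_continuous_real continuous_intros f power_mono) auto
  then have "(l2_norm f)\<^sup>2 \<le> B\<^sup>2" by (simp add: l2_norm_continuous[OF f])
  then show ?thesis using B0 by (rule power2_le_imp_le)
qed

context boundary_problem
begin

lemma cos_rn_of_real: "cos (rn n * of_real x) = of_real (cos ((2 * real n + 1) * pi * x))"
  unfolding rn_def of_real_mult[symmetric] cos_of_real ..

lemma integral_cos_rn_squared: "((\<lambda>x. (cos ((2 * real n + 1) * pi * x))\<^sup>2) has_integral 1/2) {0..1}"
proof -
  define k where "k = (2 * real n + 1) * pi"
  have k0: "k \<noteq> 0" "k > 0" by (simp_all add: k_def add_pos_nonneg add_nonneg_eq_0_iff)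
  have "k = real (2 * n + 1) * pi" by (simp add: k_def)
  then have sk: "sin k = 0" by (simp only: sin_npi)
  define r where "r = 1 / (2 * k)"
  have rk: "k * r = 1 / 2" using k0 by (simp add: r_def)
  define F where "F = (\<lambda>x. x / 2 + sin (k * x) * cos (k * x) * r)"
  have "((\<lambda>x. (cos (k * x))\<^sup>2) has_integral (F 1 - F 0)) {0..1}"
  proof (rule fundamental_theorem_of_calculus)
    fix x :: real
    have "(F has_real_derivative 1 / 2 + (k * r) * ((cos (k * x))\<^sup>2 - (sin (k * x))\<^sup>2)) (at x within {0..1})"
      unfolding F_def by (auto intro!: derivative_eq_intros simp: algebra_simps power2_eq_square)
    also have "1 / 2 + (k * r) * ((cos (k * x))\<^sup>2 - (sin (k * x))\<^sup>2) = (cos (k * x))\<^sup>2"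
      by (simp add: rk sin_squared_eq field_simps)
    finally have "(F has_real_derivative (cos (k * x))\<^sup>2) (at x within {0..1})" .
    then show "(F has_vector_derivative (cos (k * x))\<^sup>2) (at x within {0..1})"
      by (simp add: has_real_derivative_iff_has_vector_derivative)
  qed simp
  moreover have "F 1 - F 0 = 1/2" by (simp add: F_def sk)
  ultimately show ?thesis by (simp add: k_def)
qed

text \<open>The squared norm of \<open>a cos (\<rho>\<^sub>n x)\<close> is \<open>\<bar>a\<bar>\<^sup>2 / 2\<close>; pointwise
  \<open>\<bar>Y\<^sup>2 - C\<^sup>2\<bar> = \<bar>Y - C\<bar> (Y + C)\<close> for the moduli \<open>Y\<close>, \<open>C\<close> of the two functions.\<close>
lemma l2_norm_near_cos:
  assumes y: "continuous_on {0..1} y"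
    and near: "\<And>x. x \<in> {0..1} \<Longrightarrow> norm (y x - a * cos (rn n * of_real x)) \<le> \<kappa> * norm a"
    and \<kappa>: "0 \<le> \<kappa>" "\<kappa> \<le> 1"
  shows "\<bar>(l2_norm y)\<^sup>2 - (norm a)\<^sup>2 / 2\<bar> \<le> 3 * \<kappa> * (norm a)\<^sup>2"
proof -
  let ?c = "\<lambda>x. cos ((2 * real n + 1) * pi * x)"
  have 1: "((\<lambda>x. (norm (y x))\<^sup>2) has_integral (l2_norm y)\<^sup>2) {0..1}"
    unfolding l2_norm_continuous[OF y] by (intro integrable_integral integrable_continuous_real continuous_intros y)
  have 2: "((\<lambda>x. (norm a)\<^sup>2 * (?c x)\<^sup>2) has_integral (norm a)\<^sup>2 * (1/2)) {0..1}"
    by (intro has_integral_mult_right integral_cos_rn_squared)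
  note d = has_integral_diff[OF 1 2]
  have "norm (integral {0..1} (\<lambda>x. (norm (y x))\<^sup>2 - (norm a)\<^sup>2 * (?c x)\<^sup>2)) \<le> integral {0..1} (\<lambda>x::real. 3 * \<kappa> * (norm a)\<^sup>2)"
  proof (rule integral_norm_bound_integral[OF has_integral_integrable[OF d]])
    fix x :: real assume x: "x \<in> {0..1}"
    define Y C where "Y = norm (y x)" and "C = norm (a * cos (rn n * of_real x))"
    have C: "C = norm a * \<bar>?c x\<bar>" by (simp add: C_def norm_mult cos_rn_of_real)
    have Ca: "C \<le> norm a" unfolding C using mult_left_mono[OF abs_cos_le_one norm_ge_zero] by simp
    have YC: "\<bar>Y - C\<bar> \<le> \<kappa> * norm a"
      unfolding Y_def C_def using norm_triangle_ineq3 near[OF x] by (rule order_trans)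
    have "\<kappa> * norm a \<le> norm a" using \<kappa> by (simp add: mult_left_le_one_le)
    then have "Y + C \<le> 3 * norm a" using YC Ca by linarith
    have "\<bar>Y\<^sup>2 - C\<^sup>2\<bar> = \<bar>Y - C\<bar> * (Y + C)"
      by (simp add: power2_eq_square square_diff_square_factored abs_mult Y_def C_def)
    also have "\<dots> \<le> (\<kappa> * norm a) * (3 * norm a)"
      using YC \<open>Y + C \<le> 3 * norm a\<close> \<kappa> by (intro mult_mono) (auto simp: Y_def C_def)
    finally show "norm ((norm (y x))\<^sup>2 - (norm a)\<^sup>2 * (?c x)\<^sup>2) \<le> 3 * \<kappa> * (norm a)\<^sup>2"
      by (simp add: C Y_def power_mult_distrib power2_eq_square mult_ac)
  qed (rule integrable_const_ivl)
  then show ?thesis by (simp add: integral_unique[OF d])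
qed

end

section \<open>Failure of the Riesz basis property\<close>

context potential
begin

lemma eigenfunction_continuous:
  assumes "eigenfunction q \<beta> \<mu> y"
  shows "continuous_on {0..1} y"
proof -
  have "T2 q \<beta> y (\<lambda>x. \<mu> * y x + 0)" using assms by (simp add: eigenfunction_def)
  then obtain y1 where "\<And>x. x \<in> {0..1} \<Longrightarrow> (y has_vector_derivative y1 x) (at x within {0..1})"
    by (rule T2D[OF _ continuous_on_const]) (rule that; assumption)
  then show ?thesis using continuous_on_vector_derivative by blast
qed

text \<open>The continuous derivative of \<open>y\<close> is unique, so its two integral representations agree and
  \<open>(\<mu> - \<nu>) \<integral>\<^bsub>0\<^esub>\<^bsup>x\<^esup> y = 0\<close> for all \<open>x\<close>.\<close>
lemma eigenfunction_determines_eigenvalue: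
  assumes \<mu>: "eigenfunction q \<beta> \<mu> y" and \<nu>: "eigenfunction q \<beta> \<nu> y"
  shows "\<mu> = \<nu>"
proof (rule ccontr)
  assume ne: "\<mu> \<noteq> \<nu>"
  have "T2 q \<beta> y (\<lambda>x. \<mu> * y x + 0)" using \<mu> by (simp add: eigenfunction_def)
  then obtain u where u: "\<And>x. x \<notin> {0..1} \<Longrightarrow> y x = 0"
    "\<And>x. x \<in> {0..1} \<Longrightarrow> (y has_vector_derivative u x) (at x within {0..1})"
    "\<And>x. x \<in> {0..1} \<Longrightarrow> u x = u 0 + integral {0..x} (\<lambda>t. y t * q t - \<mu> * y t - 0)"
    by (rule T2D[OF _ continuous_on_const]) (rule that; assumption)
  have "T2 q \<beta> y (\<lambda>x. \<nu> * y x + 0)" using \<nu> by (simp add: eigenfunction_def)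
  then obtain v where v:
    "\<And>x. x \<in> {0..1} \<Longrightarrow> (y has_vector_derivative v x) (at x within {0..1})"
    "\<And>x. x \<in> {0..1} \<Longrightarrow> v x = v 0 + integral {0..x} (\<lambda>t. y t * q t - \<nu> * y t - 0)"
    by (rule T2D[OF _ continuous_on_const]) (rule that; assumption)
  have c: "continuous_on {0..1} y" using eigenfunction_continuous[OF \<mu>] .
  have uv: "u x = v x" if x: "x \<in> {0..1}" for x
    by (rule vector_derivative_unique_within_closed_interval[unfolded box_real, OF _ _ u(2)[OF x] v(1)[OF x]]) (use x in auto)
  have i: "(\<lambda>t. y t * q t - \<kappa> * y t - 0) integrable_on {0..x}" if "x \<in> {0..1}" for \<kappa> x
    by (intro absint_imp_integrable_on[OF _ that] set_integral_diff(1) absint_continuous_mult q_absint absint_continuous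
        continuous_intros c)
  have z: "integral {0..x} y = 0" if x: "x \<in> {0..1}" for x
  proof -
    have "integral {0..x} (\<lambda>t. y t * q t - \<mu> * y t - 0) = u x - u 0"
      using u(3)[OF x] by (simp only: add_diff_cancel_left')
    moreover have "integral {0..x} (\<lambda>t. y t * q t - \<nu> * y t - 0) = v x - v 0"
      using v(2)[OF x] by (simp only: add_diff_cancel_left')
    ultimately have "integral {0..x} (\<lambda>t. y t * q t - \<mu> * y t - 0) = integral {0..x} (\<lambda>t. y t * q t - \<nu> * y t - 0)"
      using uv[OF x] uv[of 0] by simp
    then have "0 = integral {0..x} (\<lambda>t. (y t * q t - \<nu> * y t - 0) - (y t * q t - \<mu> * y t - 0))"
      using integral_diff[OF i[OF x, of \<nu>] i[OF x, of \<mu>]] by simp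
    also have "(\<lambda>t. (y t * q t - \<nu> * y t - 0) - (y t * q t - \<mu> * y t - 0)) = (\<lambda>t. (\<mu> - \<nu>) * y t)"
      by (simp add: fun_eq_iff algebra_simps)
    finally show ?thesis using ne by simp
  qed
  have "y x = 0" if x: "x \<in> {0..1}" for x
  proof (rule vector_derivative_unique_within_closed_interval[unfolded box_real, of 0 1 x])
    show "((\<lambda>x. integral {0..x} y) has_vector_derivative y x) (at x within {0..1})"
      by (rule integral_has_vector_derivative[OF c x])
    show "((\<lambda>x. integral {0..x} y) has_vector_derivative 0) (at x within {0..1})"
      by (rule has_vector_derivative_transform[OF x z has_vector_derivative_const])
  qed (use x in auto)
  then have "y x = 0" for x using u(1) by blast
  then show False using \<mu> by (simp add: eigenfunction_def)
qed

end

lemma algebraic_multiplicity_eq_0: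
  assumes "\<nexists>y. eigenfunction q \<beta> \<mu> y"
  shows "algebraic_multiplicity q \<beta> \<mu> = 0"
proof -
  have "\<not> root_function q \<beta> \<mu> y" for y
  proof
    assume "root_function q \<beta> \<mu> y"
    then show False by (induction rule: root_function.induct) (use assms in auto)
  qed
  then have "root_space q \<beta> \<mu> = cfun.span {}" by (auto simp: root_space_def fun_eq_iff)
  then show ?thesis unfolding algebraic_multiplicity_def using cfun.dim_eq_card_independent[OF cfun.independent_empty] by (simp only: cfun.dim_span card.empty)
qed

text \<open>The members of the system in the root space of \<open>\<mu>\<close> span it, so there is at least one, and by
  linear independence it is not zero.\<close>
lemma root_function_system_contains_eigenfunction:
  assumes e: "root_function_system q \<beta> e" and u: "eigenfunction q \<beta> \<mu> u"
    and simple: "\<And>y. root_function q \<beta> \<mu> y \<Longrightarrow> eigenfunction q \<beta> \<mu> y"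
  obtains i where "eigenfunction q \<beta> \<mu> (e i)"
proof -
  let ?S = "range e \<inter> root_space q \<beta> \<mu>"
  have S: "cfun.independent ?S" "cfun.span ?S = root_space q \<beta> \<mu>" using e by (auto simp: root_function_system_def)
  have "u \<in> root_space q \<beta> \<mu>" using root_function.eigen[OF u] by (simp add: root_space_def)
  moreover have "u \<noteq> 0" using u by (auto simp: eigenfunction_def)
  ultimately have "?S \<noteq> {}" using S(2) by (metis cfun.span_empty singletonD)
  then obtain i where i: "e i \<in> root_space q \<beta> \<mu>" by blast
  moreover have "e i \<noteq> (\<lambda>x. 0)"
  proof
    assume "e i = (\<lambda>x. 0)"
    then have "0 \<in> ?S" using i rangeI[of e i] by (simp add: zero_fun_def)
    from cfun.dependent_zero[OF this] S(1) show False by contradiction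
  qed
  ultimately have "root_function q \<beta> \<mu> (e i)" by (simp add: root_space_def)
  then show ?thesis using simple that by blast
qed

context nondegenerate_problem
begin

text \<open>The square root of \<open>shift_sq n\<close> for which \<open>2 * rn n * branch n\<close> is half the product
  of the two principal square roots in the asymptotic formula of the eigenvalues.\<close>
definition branch :: "nat \<Rightarrow> complex" where
  "branch n = csqrt (2 * gamma2 \<beta>) / 2 * csqrt (of_nat (2 * n + 1) * sine_coeff q (2 * n + 1)) / (2 * rn n)"

lemma rn_nonzero: "rn n \<noteq> 0"
proof -
  have "(2 * real n + 1) * pi > 0" by (intro mult_pos_pos) auto
  then have "norm (rn n) > 0" by (simp only: norm_rn)
  then show ?thesis by auto
qed

lemma branch_squared: "(branch n)\<^sup>2 = shift_sq n"
proof -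
  define \<kappa> where "\<kappa> = (\<beta> - 1) / (\<beta> + 1)"
  define N :: complex where "N = of_nat (2 * n + 1)"
  have r: "N * complex_of_real pi = rn n" by (simp add: rn_def N_def)
  have g: "gamma2 \<beta> = 8 * (complex_of_real pi * \<kappa>)" by (simp add: gamma2_def \<kappa>_def)
  have "(branch n)\<^sup>2 = (2 * gamma2 \<beta>) / 4 * (N * sine_coeff q (2 * n + 1)) / (4 * (rn n)\<^sup>2)"
    unfolding branch_def power_divide power_mult_distrib power2_csqrt N_def by simp
  also have "\<dots> = \<kappa> * sine_coeff q (2 * n + 1) * (N * complex_of_real pi) / (rn n)\<^sup>2"
    unfolding g by simp
  also have "\<dots> = shift_sq n" unfolding r using rn_nonzero[of n] by (simp add: shift_sq_def \<kappa>_def power2_eq_square)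
  finally show ?thesis .
qed

lemma norm_branch_squared: "(norm (branch n))\<^sup>2 = norm ((\<beta> - 1) / (\<beta> + 1)) * norm (sine_coeff q (2 * n + 1)) / ((2 * real n + 1) * pi)"
  unfolding norm_power[symmetric] branch_squared shift_sq_def norm_divide norm_mult norm_rn ..

lemma inverse_Suc_tendsto_0: "(\<lambda>n. 1 / (real n + 1)) \<longlonglongrightarrow> 0"
  using LIMSEQ_inverse_real_of_nat by (simp add: inverse_eq_divide add.commute)

lemma branch_tendsto_0: "branch \<longlonglongrightarrow> 0"
proof -
  define c where "c = norm ((\<beta> - 1) / (\<beta> + 1)) * qnorm"
  have c0: "c \<ge> 0" using qnorm_nonneg by (simp add: c_def)
  have "(\<lambda>n. (norm (branch n))\<^sup>2) \<longlonglongrightarrow> 0"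
  proof (rule Lim_null_comparison)
    show "(\<lambda>n. c * (1 / (real n + 1))) \<longlonglongrightarrow> 0" using tendsto_mult_left[OF inverse_Suc_tendsto_0, of c] by simp
    show "\<forall>\<^sub>F n in sequentially. norm ((norm (branch n))\<^sup>2) \<le> c * (1 / (real n + 1))"
    proof (intro always_eventually allI)
      fix n
      have "norm ((\<beta> - 1) / (\<beta> + 1)) * norm (sine_coeff q (2 * n + 1)) / ((2 * real n + 1) * pi) \<le> c / (real n + 1)"
        using norm_sine_coeff_le[of n] rn_lower[of n] c0 unfolding c_def by (intro frac_le mult_left_mono) auto
      then show "norm ((norm (branch n))\<^sup>2) \<le> c * (1 / (real n + 1))" by (simp add: norm_branch_squared)
    qed
  qed
  from tendsto_real_sqrt[OF this] show ?thesis by (simp add: tendsto_norm_zero_iff)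
qed

text \<open>Since \<open>ln n \<ge> 1\<close> for \<open>n \<ge> 3\<close>, the hypothesis gives \<open>n \<bar>s\<bar> \<rightarrow> \<infinity>\<close> along the sequence, and
  \<open>((n + 1) \<bar>branch n\<bar>)\<^sup>2\<close> is comparable to \<open>n \<bar>s\<bar>\<close>.\<close>
lemma branch_dominates:
  assumes m: "filterlim m at_top sequentially" and log: "log_over_sine_coeff_tendsto_0 q m"
  shows "filterlim (\<lambda>k. (real (m k) + 1) * norm (branch (m k))) at_top sequentially"
  unfolding filterlim_at_top_gt[where c = 0]
proof (intro allI impI)
  fix Z :: real assume Z: "Z > 0"
  define \<kappa> where "\<kappa> = norm ((\<beta> - 1) / (\<beta> + 1))"
  have \<kappa>0: "\<kappa> > 0" using beta by (simp add: \<kappa>_def add_eq_0_iff2)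
  define B where "B = 8 * Z\<^sup>2 / \<kappa>"
  have B0: "B > 0" using Z \<kappa>0 by (simp add: B_def)
  have ne: "\<forall>\<^sub>F k in sequentially. sine_coeff q (2 * m k + 1) \<noteq> 0"
    and lim: "(\<lambda>k. of_real (ln (real (m k))) / (of_nat (m k) * sine_coeff q (2 * m k + 1))) \<longlonglongrightarrow> 0"
    using log by (auto simp: log_over_sine_coeff_tendsto_0_def)
  have "\<forall>\<^sub>F k in sequentially. norm (of_real (ln (real (m k))) / (of_nat (m k) * sine_coeff q (2 * m k + 1))) < 1 / B"
    using tendstoD[OF lim, of "1 / B"] B0 by (simp add: dist_norm)
  moreover have "\<forall>\<^sub>F k in sequentially. 3 \<le> m k" using m by (simp add: filterlim_at_top)
  ultimately show "\<forall>\<^sub>F k in sequentially. Z \<le> (real (m k) + 1) * norm (branch (m k))"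
    using ne
  proof eventually_elim
    case (elim k)
    define n where "n = m k"
    define s where "s = norm (sine_coeff q (2 * n + 1))"
    have n3: "real n \<ge> 3" using elim(2) by (simp add: n_def)
    have s0: "s > 0" using elim(3) by (simp add: s_def n_def)
    have ln1: "ln (real n) \<ge> 1"
      using n3 exp_le by (subst ln_ge_iff) auto
    have "norm (of_real (ln (real n)) / (of_nat n * sine_coeff q (2 * n + 1)) :: complex) = ln (real n) / (real n * s)"
      using ln1 by (simp add: norm_divide norm_mult s_def)
    then have "ln (real n) / (real n * s) < 1 / B" using elim(1) by (simp only: n_def)
    then have "B * ln (real n) < real n * s" using B0 s0 n3 by (simp add: field_simps)
    moreover have "B * 1 \<le> B * ln (real n)" using ln1 B0 by (intro mult_left_mono) auto
    ultimately have ns: "B \<le> real n * s" by simp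
    have "Z\<^sup>2 = \<kappa> * B / 8" using \<kappa>0 by (simp add: B_def)
    also have "\<dots> \<le> \<kappa> * (real n * s) / 8" using ns \<kappa>0 by (intro divide_right_mono mult_left_mono) auto
    also have "\<dots> \<le> (real n + 1)\<^sup>2 * (\<kappa> * s / ((2 * real n + 1) * pi))"
    proof -
      have "(2 * real n + 1) * pi \<le> (2 * (real n + 1)) * 4" using pi_less_4 n3 by (intro mult_mono) auto
      then have "\<kappa> * s / (8 * (real n + 1)) \<le> \<kappa> * s / ((2 * real n + 1) * pi)"
        using \<kappa>0 s0 n3 by (intro divide_left_mono) auto
      then have "(real n + 1)\<^sup>2 * (\<kappa> * s / (8 * (real n + 1))) \<le> (real n + 1)\<^sup>2 * (\<kappa> * s / ((2 * real n + 1) * pi))"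
        by (intro mult_left_mono) auto
      moreover have "(real n + 1)\<^sup>2 * (\<kappa> * s / (8 * (real n + 1))) = \<kappa> * s * (real n + 1) / 8"
        using n3 by (simp add: field_simps power2_eq_square)
      moreover have "\<kappa> * (real n * s) / 8 \<le> \<kappa> * s * (real n + 1) / 8"
        using \<kappa>0 s0 by (simp add: algebra_simps)
      ultimately show ?thesis by linarith
    qed
    also have "\<dots> = ((real n + 1) * norm (branch n))\<^sup>2"
      by (simp add: power_mult_distrib norm_branch_squared \<kappa>_def s_def)
    finally have "Z\<^sup>2 \<le> ((real n + 1) * norm (branch n))\<^sup>2" .
    then have "Z \<le> (real n + 1) * norm (branch n)" by (rule power2_le_imp_le) simp
    then show ?case by (simp add: n_def)
  qed
qed

text \<open>Near \<open>branch n\<close> and \<open>- branch n\<close> there are two zeros of the determinant, hence two different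
  eigenvalues, whose eigenfunctions \<open>e i\<close>, \<open>e j\<close> in the system satisfy
  \<open>e i / e i 0 \<approx> cos (\<rho>\<^sub>n x) \<approx> e j / e j 0\<close> up to \<open>X n \<rightarrow> 0\<close>.  As \<open>\<bar>e i 0\<bar>\<close> is bounded through the norm
  of \<open>e i\<close>, the lower bound of a Riesz basis for \<open>e i / e i 0 - e j / e j 0\<close> fails for large \<open>n\<close>.\<close>
lemma not_riesz_basis:
  assumes m: "filterlim m at_top sequentially" and log: "log_over_sine_coeff_tendsto_0 q m"
  shows "\<not> root_functions_form_riesz_basis q \<beta>"
proof
  assume "root_functions_form_riesz_basis q \<beta>"
  then obtain e where sys: "root_function_system q \<beta> e" and rb: "riesz_basis e"
    unfolding root_functions_form_riesz_basis_def by blast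
  obtain A B where A: "\<And>i. l2_norm (e i) \<le> A" 
    and B: "\<And>i j a b. i \<noteq> j \<Longrightarrow> (norm a)\<^sup>2 + (norm b)\<^sup>2 \<le> (B * l2_norm (\<lambda>x. a * e i x + b * e j x))\<^sup>2"
    using riesz_basis_bounds[OF rb] by blast
  obtain M1 K where M1: "M1 \<ge> 1" and K0: "K \<ge> 0" and near: "\<And>n \<delta>. M1 \<le> real n \<Longrightarrow> norm \<delta> \<le> 1 / M1 \<Longrightarrow>
     admissible (rn n + \<delta>) \<and> m22 (rn n + \<delta>) \<noteq> 0 \<and>
     (\<forall>y. eigenfunction q \<beta> ((rn n + \<delta>)\<^sup>2) y \<longrightarrow>
        (\<forall>x\<in>{0..1}. norm (y x - y 0 * cos (rn n * of_real x)) \<le> K * (norm \<delta> + 1 / (real n + 1)) * norm (y 0)))"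
    using eigenfunction_near_cos by blast
  obtain M2 where M2: "M2 \<ge> 1" and exist: "\<And>n z. M2 \<le> real n \<Longrightarrow> z\<^sup>2 = shift_sq n \<Longrightarrow> M2 \<le> (real n + 1) * norm z \<Longrightarrow>
     norm z \<le> 1 / M2 \<Longrightarrow> \<exists>\<delta>\<in>cball z (norm z / 2). redet n \<delta> = 0"
    using redet_zero_exists by blast
  obtain M3 where M3: "M3 \<ge> 1" and simple: "\<And>n \<delta> u. M3 \<le> real n \<Longrightarrow> norm \<delta> \<le> 1 / M3 \<Longrightarrow> M3 \<le> (real n + 1) * norm \<delta> \<Longrightarrow>
     eigenfunction q \<beta> ((rn n + \<delta>)\<^sup>2) u \<Longrightarrow> \<forall>y. root_function q \<beta> ((rn n + \<delta>)\<^sup>2) y \<longrightarrow> eigenfunction q \<beta> ((rn n + \<delta>)\<^sup>2) y"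
    using simple_near_rn by blast
  define M where "M = max M1 (max M2 M3)"
  have M: "M1 \<le> M" "M2 \<le> M" "M3 \<le> M" "M \<ge> 1" using M1 by (auto simp: M_def)
  define X where "X = (\<lambda>n. K * (3 / 2 * norm (branch n) + 1 / (real n + 1)))"
  have "X \<longlonglongrightarrow> K * (3 / 2 * norm (0::complex) + 0)"
    unfolding X_def by (intro tendsto_intros branch_tendsto_0 inverse_Suc_tendsto_0)
  then have X0: "X \<longlonglongrightarrow> 0" by simp
  have "(\<lambda>n. 16 * A\<^sup>2 * B\<^sup>2 * (X n)\<^sup>2) \<longlonglongrightarrow> 16 * A\<^sup>2 * B\<^sup>2 * 0\<^sup>2"
    by (intro tendsto_intros X0)
  then have ev1: "\<forall>\<^sub>F n in sequentially. 16 * A\<^sup>2 * B\<^sup>2 * (X n)\<^sup>2 < 1" by (intro order_tendstoD(2)) auto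
  have ev2: "\<forall>\<^sub>F n in sequentially. X n < 1 / 12" by (rule order_tendstoD(2)[OF X0]) simp
  have ev3: "\<forall>\<^sub>F n in sequentially. norm (branch n) < 1 / (2 * M)"
    using M(4) by (intro order_tendstoD(2)[OF tendsto_norm_zero[OF branch_tendsto_0]]) auto
  have ev4: "\<forall>\<^sub>F n in sequentially. M \<le> real n" using filterlim_real_sequentially by (simp add: filterlim_at_top)
  have "\<forall>\<^sub>F n in sequentially. 16 * A\<^sup>2 * B\<^sup>2 * (X n)\<^sup>2 < 1 \<and> X n < 1 / 12 \<and> norm (branch n) < 1 / (2 * M) \<and> M \<le> real n"
    using ev1 ev2 ev3 ev4 by eventually_elim blast
  then have "\<forall>\<^sub>F k in sequentially. 16 * A\<^sup>2 * B\<^sup>2 * (X (m k))\<^sup>2 < 1 \<and> X (m k) < 1 / 12 \<and> norm (branch (m k)) < 1 / (2 * M) \<and> M \<le> real (m k)"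
    using m by (rule eventually_compose_filterlim)
  moreover have "\<forall>\<^sub>F k in sequentially. 2 * M \<le> (real (m k) + 1) * norm (branch (m k))"
    using branch_dominates[OF m log] by (simp add: filterlim_at_top)
  ultimately have "\<forall>\<^sub>F k in sequentially. False"
  proof eventually_elim
    case (elim k)
    define n where "n = m k"
    have n: "16 * A\<^sup>2 * B\<^sup>2 * (X n)\<^sup>2 < 1" "X n < 1 / 12" "norm (branch n) < 1 / (2 * M)" "M \<le> real n"
      "2 * M \<le> (real n + 1) * norm (branch n)" using elim by (auto simp: n_def)
    define z where "z = branch n"
    have inv: "1 / M \<le> 1 / M1" "1 / M \<le> 1 / M2" "1 / M \<le> 1 / M3" using M M1 M2 M3 by (auto intro!: divide_left_mono)
    have Mpos: "1 / M > 0" using M(4) by simp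
    have zM: "2 * norm z < 1 / M" using n(3) M(4) unfolding z_def by (simp add: field_simps)
    have z0: "norm z > 0" using n(5) M(4) by (cases "norm z = 0") (auto simp: z_def)
    have root: "\<exists>\<delta>\<in>cball w (norm z / 2). redet n \<delta> = 0" if w: "w = z \<or> w = - z" for w
    proof -
      have "norm w = norm z" "w\<^sup>2 = shift_sq n" using w branch_squared[of n] by (auto simp: z_def)
      moreover have "norm z \<le> 1 / M2" using zM inv Mpos z0 by linarith
      moreover have "M2 \<le> (real n + 1) * norm z" using n(5) M unfolding z_def by linarith
      moreover have "M2 \<le> real n" using n(4) M by linarith
      ultimately show ?thesis using exist[of n w] by simp
    qed
    obtain \<delta>1 where \<delta>1: "\<delta>1 \<in> cball z (norm z / 2)" "redet n \<delta>1 = 0" using root[of z] by blast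
    obtain \<delta>2 where \<delta>2: "\<delta>2 \<in> cball (- z) (norm z / 2)" "redet n \<delta>2 = 0" using root[of "- z"] by blast
    have bounds: "norm \<delta> \<le> 3 / 2 * norm z" "norm z / 2 \<le> norm \<delta>" if "\<delta> \<in> cball w (norm z / 2)" "w = z \<or> w = - z" for \<delta> w
    proof -
      have "norm (w - \<delta>) \<le> norm z / 2" "norm w = norm z" using that by (auto simp: dist_norm)
      then show "norm \<delta> \<le> 3 / 2 * norm z" "norm z / 2 \<le> norm \<delta>"
        using norm_triangle_ineq2[of w \<delta>] norm_triangle_ineq2[of \<delta> w] by (auto simp: norm_minus_commute)
    qed
    have efun: "\<exists>i. eigenfunction q \<beta> ((rn n + \<delta>)\<^sup>2) (e i) \<and> e i 0 \<noteq> 0 \<and>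
       (\<forall>x\<in>{0..1}. norm (e i x - e i 0 * cos (rn n * of_real x)) \<le> X n * norm (e i 0))"
      if \<delta>: "norm \<delta> \<le> 3 / 2 * norm z" "norm z / 2 \<le> norm \<delta>" and r: "redet n \<delta> = 0" for \<delta>
    proof -
      have dM: "norm \<delta> \<le> 1 / M" using \<delta>(1) zM z0 by linarith
      have 1: "M1 \<le> real n" "norm \<delta> \<le> 1 / M1" using n(4) M dM inv by linarith+
      note nr = near[OF 1]
      obtain u where u: "eigenfunction q \<beta> ((rn n + \<delta>)\<^sup>2) u"
        using char_det_zero_imp_eigenfunction nr r unfolding redet_0_iff by blast
      have "2 * M \<le> (real n + 1) * norm z" using n(5) by (simp add: z_def)
      also have "\<dots> \<le> (real n + 1) * (2 * norm \<delta>)" using \<delta>(2) by (intro mult_left_mono) auto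
      finally have 2: "M3 \<le> real n" "norm \<delta> \<le> 1 / M3" "M3 \<le> (real n + 1) * norm \<delta>" using n(4) M dM inv by linarith+
      obtain i where i: "eigenfunction q \<beta> ((rn n + \<delta>)\<^sup>2) (e i)"
        using root_function_system_contains_eigenfunction[OF sys u] simple[OF 2 u] by blast
      have "e i 0 \<noteq> 0" using eigenfunction_0_nonzero i nr by blast
      moreover have "norm (e i x - e i 0 * cos (rn n * of_real x)) \<le> X n * norm (e i 0)" if x: "x \<in> {0..1}" for x
      proof -
        have "norm (e i x - e i 0 * cos (rn n * of_real x)) \<le> K * (norm \<delta> + 1 / (real n + 1)) * norm (e i 0)"
          using nr i x by blast
        also have "\<dots> \<le> X n * norm (e i 0)"
          unfolding X_def using \<delta>(1) K0 by (intro mult_right_mono mult_left_mono) (auto simp: z_def)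
        finally show ?thesis .
      qed
      ultimately show ?thesis using i by blast
    qed
    obtain i where i: "eigenfunction q \<beta> ((rn n + \<delta>1)\<^sup>2) (e i)" "e i 0 \<noteq> 0"
       "\<And>x. x \<in> {0..1} \<Longrightarrow> norm (e i x - e i 0 * cos (rn n * of_real x)) \<le> X n * norm (e i 0)"
      using efun[OF bounds[OF \<delta>1(1)] \<delta>1(2)] by blast
    obtain j where j: "eigenfunction q \<beta> ((rn n + \<delta>2)\<^sup>2) (e j)" "e j 0 \<noteq> 0"
       "\<And>x. x \<in> {0..1} \<Longrightarrow> norm (e j x - e j 0 * cos (rn n * of_real x)) \<le> X n * norm (e j 0)"
      using efun[OF bounds[OF \<delta>2(1)] \<delta>2(2)] by blast
    have d12: "\<delta>1 \<noteq> \<delta>2"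
    proof
      assume eq: "\<delta>1 = \<delta>2"
      have "norm (z - \<delta>1) \<le> norm z / 2" "norm (\<delta>2 - (- z)) \<le> norm z / 2"
        using \<delta>1(1) \<delta>2(1) by (auto simp: dist_norm norm_minus_commute add.commute)
      from norm_triangle_mono[OF this] have "norm (2 * z) \<le> norm z" unfolding eq by simp
      then show False using z0 by (simp add: norm_mult)
    qed
    have "i \<noteq> j"
    proof
      assume "i = j"
      then have "(rn n + \<delta>1)\<^sup>2 = (rn n + \<delta>2)\<^sup>2" using eigenfunction_determines_eigenvalue i(1) j(1) by blast
      then have "rn n + \<delta>1 = - (rn n + \<delta>2)" using d12 by (simp add: power2_eq_iff)
      then have "2 * rn n = - \<delta>1 - \<delta>2" by (simp add: algebra_simps eq_neg_iff_add_eq_0)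
      then have "2 * norm (rn n) \<le> norm \<delta>1 + norm \<delta>2" by (metis norm_minus_cancel norm_mult norm_numeral norm_triangle_ineq4)
      also have "\<dots> \<le> 3 * norm z" using bounds(1)[OF \<delta>1(1)] bounds(1)[OF \<delta>2(1)] by simp
      also have "\<dots> < 2 * (1 / M)" using zM z0 by linarith
      also have "\<dots> \<le> 2" using M(4) by (simp add: divide_le_eq)
      finally show False using rn_lower[of n] by (simp add: norm_rn)
    qed
    note Bij = B[OF this, of "1 / e i 0" "- 1 / e j 0"]
    have ci: "continuous_on {0..1} (e i)" and cj: "continuous_on {0..1} (e j)" using eigenfunction_continuous i(1) j(1) by blast+
    have Xn0: "X n \<ge> 0" using K0 by (simp add: X_def)
    have quot: "norm (f x / a - cos (rn n * of_real x)) \<le> X n"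
      if "norm (f x - a * cos (rn n * of_real x)) \<le> X n * norm a" "a \<noteq> 0" for f :: "real \<Rightarrow> complex" and a x
    proof -
      have "norm (f x / a - cos (rn n * of_real x)) = norm (f x - a * cos (rn n * of_real x)) / norm a"
        unfolding norm_divide[symmetric] using that(2) by (simp add: diff_divide_distrib)
      then show ?thesis using that by (simp add: divide_le_eq)
    qed
    have "l2_norm (\<lambda>x. 1 / e i 0 * e i x + - 1 / e j 0 * e j x) \<le> X n + X n"
    proof (rule l2_norm_le_sup)
      show "continuous_on {0..1} (\<lambda>x. 1 / e i 0 * e i x + - 1 / e j 0 * e j x)" by (intro continuous_intros ci cj)
      fix x :: real assume x: "x \<in> {0..1}"
      have "1 / e i 0 * e i x + - 1 / e j 0 * e j x = (e i x / e i 0 - cos (rn n * of_real x)) - (e j x / e j 0 - cos (rn n * of_real x))"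
        by simp
      also have "norm \<dots> \<le> X n + X n"
        using quot[of "e i" x, OF i(3)[OF x] i(2)] quot[of "e j" x, OF j(3)[OF x] j(2)] by (intro norm_triangle_le_diff) linarith
      finally show "norm (1 / e i 0 * e i x + - 1 / e j 0 * e j x) \<le> X n + X n" .
    qed
    then have "(l2_norm (\<lambda>x. 1 / e i 0 * e i x + - 1 / e j 0 * e j x))\<^sup>2 \<le> (X n + X n)\<^sup>2"
      by (intro power_mono l2_norm_nonneg)
    then have "B\<^sup>2 * (l2_norm (\<lambda>x. 1 / e i 0 * e i x + - 1 / e j 0 * e j x))\<^sup>2 \<le> B\<^sup>2 * (X n + X n)\<^sup>2"
      by (intro mult_left_mono) auto
    moreover have "(norm (1 / e i 0))\<^sup>2 \<le> (norm (1 / e i 0))\<^sup>2 + (norm (- 1 / e j 0))\<^sup>2" by simp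
    ultimately have up: "(norm (1 / e i 0))\<^sup>2 \<le> B\<^sup>2 * (X n + X n)\<^sup>2"
      using Bij unfolding power_mult_distrib by linarith
    have "\<bar>(l2_norm (e i))\<^sup>2 - (norm (e i 0))\<^sup>2 / 2\<bar> \<le> 3 * X n * (norm (e i 0))\<^sup>2"
      by (rule l2_norm_near_cos[OF ci i(3) Xn0]) (use n(2) in auto)
    moreover have "3 * X n * (norm (e i 0))\<^sup>2 \<le> 1/4 * (norm (e i 0))\<^sup>2"
      using n(2) by (intro mult_right_mono) auto
    moreover have "(l2_norm (e i))\<^sup>2 \<le> A\<^sup>2" using A[of i] by (intro power_mono l2_norm_nonneg)
    ultimately have low: "(norm (e i 0))\<^sup>2 \<le> 4 * A\<^sup>2" by linarith
    have "1 = (norm (1 / e i 0))\<^sup>2 * (norm (e i 0))\<^sup>2" using i(2) by (simp add: norm_divide power_divide)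
    also have "\<dots> \<le> (B\<^sup>2 * (X n + X n)\<^sup>2) * (4 * A\<^sup>2)" using up low by (intro mult_mono) auto
    also have "\<dots> = 16 * A\<^sup>2 * B\<^sup>2 * (X n)\<^sup>2" by (simp add: power2_eq_square)
    finally show False using n(1) by simp
  qed
  then show False by simp
qed

end

section \<open>Asymptotics of the labelled eigenvalues and eigenfunctions\<close>

lemma tendsto_1_if_square_tendsto_1:
  fixes u :: "nat \<Rightarrow> complex"
  assumes sq: "(\<lambda>n. (u n)\<^sup>2) \<longlonglongrightarrow> 1" and re: "\<And>n. Re (u n) \<ge> 0"
  shows "u \<longlonglongrightarrow> 1"
proof -
  have "(\<lambda>n. (u n)\<^sup>2 - 1) \<longlonglongrightarrow> 1 - 1" by (intro tendsto_intros sq)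
  then have z: "(\<lambda>n. norm ((u n)\<^sup>2 - 1)) \<longlonglongrightarrow> 0" by (simp add: tendsto_norm_zero)
  have "(\<lambda>n. u n - 1) \<longlonglongrightarrow> 0"
  proof (rule Lim_null_comparison[OF always_eventually z], intro allI)
    fix n
    have "1 \<le> Re (u n + 1)" using re[of n] by simp
    also have "\<dots> \<le> norm (u n + 1)" by (rule complex_Re_le_cmod)
    finally have "norm (u n - 1) * 1 \<le> norm (u n - 1) * norm (u n + 1)" by (intro mult_left_mono) auto
    also have "\<dots> = norm ((u n)\<^sup>2 - 1)" unfolding norm_mult[symmetric] by (simp add: power2_eq_square algebra_simps)
    finally show "norm (u n - 1) \<le> norm ((u n)\<^sup>2 - 1)" by simp
  qed
  then show ?thesis by (simp add: LIM_zero_iff)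
qed

context nondegenerate_problem
begin

lemma rn_squared: "(rn n)\<^sup>2 = of_real (((2 * real n + 1) * pi)\<^sup>2)"
  unfolding rn_def of_real_power ..

lemma labelled_eigenfunction_exists:
  assumes lab: "eigenvalue_labelling q \<beta> lam" and j: "j \<in> {1, 2}"
  shows "\<exists>y. eigenfunction q \<beta> (lam n j) y"
proof (rule ccontr)
  let ?S = "{(n', j'). j' \<in> {1, 2} \<and> lam n' j' = lam n j}"
  assume "\<nexists>y. eigenfunction q \<beta> (lam n j) y"
  then have "card ?S = 0" "finite ?S"
    using lab algebraic_multiplicity_eq_0 unfolding eigenvalue_labelling_def by auto
  moreover have "(n, j) \<in> ?S" using j by simp
  ultimately show False using card_0_eq by blast
qed

text \<open>Equal labels would give the common value multiplicity at least two.\<close>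
lemma labelled_distinct:
  assumes lab: "eigenvalue_labelling q \<beta> lam" and simple: "simple_eigenvalue q \<beta> (lam n 1)"
  shows "lam n 1 \<noteq> lam n 2"
proof
  let ?S = "{(n', j'). j' \<in> {1, 2} \<and> lam n' j' = lam n 1}"
  assume eq: "lam n 1 = lam n 2"
  have S: "finite ?S" "card ?S = algebraic_multiplicity q \<beta> (lam n 1)"
    using lab unfolding eigenvalue_labelling_def by auto
  have "{(n, 1), (n, 2)} \<subseteq> ?S" using eq by simp
  from card_mono[OF S(1) this] S(2) show False using simple by (simp add: simple_eigenvalue_def)
qed

text \<open>The principal root \<open>r\<close> of an eigenvalue has nonnegative real part, so \<open>\<bar>r + \<rho>\<^sub>n\<bar> \<ge> \<rho>\<^sub>n \<ge> n\<close> and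
  \<open>\<bar>r - \<rho>\<^sub>n\<bar> \<le> \<bar>r\<^sup>2 - \<rho>\<^sub>n\<^sup>2\<bar> / n\<close>.\<close>
lemma labelled_shift:
  assumes lab: "eigenvalue_labelling q \<beta> lam"
  shows "\<exists>C\<ge>0. \<forall>\<^sub>F n in sequentially. \<forall>j\<in>{1, 2}. norm (csqrt (lam n j) - rn n) \<le> C * real n powr (-1/2)"
proof -
  have O: "(\<lambda>n. lam n j - of_real ((2 * real n * pi + pi)\<^sup>2)) \<in> O(\<lambda>n. of_real (sqrt (real n)))" if "j \<in> {1, 2}" for j
    using lab that unfolding eigenvalue_labelling_def by blast
  obtain c1 where c1: "c1 > 0" "\<forall>\<^sub>F n in sequentially. norm (lam n 1 - of_real ((2 * real n * pi + pi)\<^sup>2)) \<le> c1 * norm (of_real (sqrt (real n)) :: complex)"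
    using landau_o.bigE[OF O[of 1]] by auto
  obtain c2 where c2: "c2 > 0" "\<forall>\<^sub>F n in sequentially. norm (lam n 2 - of_real ((2 * real n * pi + pi)\<^sup>2)) \<le> c2 * norm (of_real (sqrt (real n)) :: complex)"
    using landau_o.bigE[OF O[of 2]] by auto
  define C where "C = c1 + c2"
  have sq: "of_real ((2 * real n * pi + pi)\<^sup>2) = (rn n)\<^sup>2" for n
    unfolding rn_squared by (simp add: algebra_simps)
  have "\<forall>\<^sub>F n in sequentially. \<forall>j\<in>{1, 2}. norm (lam n j - (rn n)\<^sup>2) \<le> C * sqrt (real n)"
    using c1(2) c2(2)
  proof eventually_elim
    case (elim n)
    have "c1 * sqrt (real n) \<le> C * sqrt (real n)" "c2 * sqrt (real n) \<le> C * sqrt (real n)"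
      using c1(1) c2(1) by (auto simp: C_def intro!: mult_right_mono)
    then show ?case using elim unfolding sq by auto
  qed
  moreover have "\<forall>\<^sub>F n in sequentially. n \<ge> (1::nat)" by (rule eventually_ge_at_top)
  ultimately have "\<forall>\<^sub>F n in sequentially. \<forall>j\<in>{1, 2}. norm (csqrt (lam n j) - rn n) \<le> C * real n powr (-1/2)"
  proof eventually_elim
    case (elim n)
    show ?case
    proof
      fix j :: nat assume j: "j \<in> {1, 2}"
      define s where "s = csqrt (lam n j)"
      have n0: "real n > 0" using elim(2) by simp
      have "real n \<le> (2 * real n + 1) * pi" using rn_lower[of n] by simp
      also have "\<dots> \<le> Re (s + rn n)" using csqrt_principal[of "lam n j"] by (auto simp: s_def rn_def)
      also have "\<dots> \<le> norm (s + rn n)" by (rule complex_Re_le_cmod)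
      finally have "norm (s - rn n) * real n \<le> norm (s - rn n) * norm (s + rn n)" by (intro mult_left_mono) auto
      also have "\<dots> = norm (s\<^sup>2 - (rn n)\<^sup>2)" unfolding norm_mult[symmetric] by (simp add: power2_eq_square algebra_simps)
      also have "\<dots> \<le> C * sqrt (real n)" using elim(1)[rule_format, OF j] by (simp add: s_def)
      finally have "(norm (s - rn n) * sqrt (real n)) * sqrt (real n) \<le> C * sqrt (real n)" by (simp add: mult.assoc)
      then have "norm (s - rn n) * sqrt (real n) \<le> C" using n0 by simp
      moreover have "real n powr (-1/2) = 1 / sqrt (real n)"
        using n0 powr_minus_divide[of "real n" "1/2"] by (simp add: powr_half_sqrt)
      moreover have "norm (s - rn n) \<le> C / sqrt (real n)" using calculation(1) n0 by (simp add: pos_le_divide_eq)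
      ultimately show "norm (csqrt (lam n j) - rn n) \<le> C * real n powr (-1/2)" by (simp add: s_def)
    qed
  qed
  then show ?thesis using c1(1) c2(1) by (intro exI[of _ C]) (simp add: C_def)
qed

lemma powr_tendsto_0: "(\<lambda>n. C * real n powr (-1/2)) \<longlonglongrightarrow> 0"
proof -
  have "(\<lambda>n. real n powr (-1/2)) \<longlonglongrightarrow> 0"
    by (rule tendsto_neg_powr[OF _ filterlim_real_sequentially]) simp
  from tendsto_mult_left[OF this, of C] show ?thesis by simp
qed

lemma eventually_ge_real: "\<forall>\<^sub>F n in sequentially. M \<le> real n"
  using filterlim_real_sequentially by (simp add: filterlim_at_top)

text \<open>Let \<open>w n j\<close> be the shift of the \<open>j\<close>-th root divided by \<open>branch n\<close>.  Its square tends to \<open>1\<close>, and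
  the sum \<open>S n\<close> of the two values tends to \<open>0\<close> by \<open>distinct_zeros\<close>.  The labels are therefore
  assigned according to the sign of \<open>Re (w n 1)\<close>: the negative branch gets the label \<open>1\<close>.\<close>
lemma labelled_eigenvalue_asymptotics:
  assumes lab: "eigenvalue_labelling q \<beta> lam" and log: "log_over_sine_coeff_tendsto_0 q (\<lambda>n. n)"
  shows "\<exists>N. \<forall>n>N. \<forall>j\<in>{1, 2}. simple_eigenvalue q \<beta> (lam n j)"
    and "\<exists>\<sigma>. (\<forall>n. bij_betw (\<sigma> n) {1, 2} {1, 2}) \<and>
             (\<forall>j\<in>{1, 2}. \<exists>r. r \<longlonglongrightarrow> 0 \<and>
                (\<forall>\<^sub>F n in sequentially.
                   lam n (\<sigma> n j) =
                     of_real (((2 * real n + 1) * pi)\<^sup>2)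
                     + (-1) ^ j * (csqrt (2 * gamma2 \<beta>) / 2)
                       * csqrt (of_nat (2 * n + 1) * sine_coeff q (2 * n + 1)) * (1 + r n)))" (is ?formula)
proof -
  define d where "d = (\<lambda>n j. csqrt (lam n j) - rn n)"
  have lam: "lam n j = (rn n + d n j)\<^sup>2" for n j by (simp add: d_def)
  obtain C where C: "\<forall>\<^sub>F n in sequentially. \<forall>j\<in>{1, 2}. norm (d n j) \<le> C * real n powr (-1/2)"
    using labelled_shift[OF lab] unfolding d_def by blast
  have d0: "(\<lambda>n. d n j) \<longlonglongrightarrow> 0" if "j \<in> {1, 2}" for j
    by (rule Lim_null_comparison[OF _ powr_tendsto_0[of C]], rule eventually_mono[OF C]) (use that in blast)
  \<comment> \<open>Stated for both labels at once, since the permutation of the labels depends on \<open>n\<close>.\<close>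
  have dsmall: "\<forall>\<^sub>F n in sequentially. \<forall>j\<in>{1, 2}. norm (d n j) \<le> e" if "e > 0" for e
  proof -
    have "\<forall>\<^sub>F n in sequentially. C * real n powr (-1/2) < e" by (rule order_tendstoD(2)[OF powr_tendsto_0 that])
    with C show ?thesis by eventually_elim force
  qed
  have ef: "\<exists>y. eigenfunction q \<beta> ((rn n + d n j)\<^sup>2) y" if "j \<in> {1, 2}" for n j
    using labelled_eigenfunction_exists[OF lab that, of n] by (simp only: lam)
  obtain M1 where M1: "M1 \<ge> 1" and near: "\<And>n \<delta>. M1 \<le> real n \<Longrightarrow> norm \<delta> \<le> 1 / M1 \<Longrightarrow> admissible (rn n + \<delta>) \<and> m22 (rn n + \<delta>) \<noteq> 0"
    using eigenfunction_near_cos by blast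
  have zero: "\<forall>\<^sub>F n in sequentially. \<forall>j\<in>{1, 2}. redet n (d n j) = 0"
  proof -
    have "1 / M1 > 0" using M1 by simp
    from dsmall[OF this] eventually_ge_real[of M1] show ?thesis
    proof eventually_elim
      case (elim n)
      show ?case
      proof
        fix j :: nat assume j: "j \<in> {1, 2}"
        then have "admissible (rn n + d n j) \<and> m22 (rn n + d n j) \<noteq> 0" using elim near by blast
        then show "redet n (d n j) = 0"
          unfolding redet_0_iff using ef[OF j, of n] eigenfunction_imp_char_det_zero by blast
      qed
    qed
  qed
  have dom: "filterlim (\<lambda>n. (real n + 1) * norm (branch n)) at_top sequentially"
    using branch_dominates[OF filterlim_ident log] .
  have dom': "\<forall>\<^sub>F n in sequentially. M \<le> (real n + 1) * norm (branch n)" for M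
    using dom by (simp add: filterlim_at_top)
  define w where "w = (\<lambda>n j. d n j / branch n)"
  have wclose: "\<forall>\<^sub>F n in sequentially. \<forall>j\<in>{1, 2}. norm ((w n j)\<^sup>2 - 1) \<le> e" if e: "e > 0" for e
  proof -
    obtain M where M: "M \<ge> 1" "\<And>n \<delta> z. M \<le> real n \<Longrightarrow> z\<^sup>2 = shift_sq n \<Longrightarrow> M \<le> (real n + 1) * norm z \<Longrightarrow> norm \<delta> \<le> 1 / M \<Longrightarrow>
     redet n \<delta> = 0 \<Longrightarrow> norm ((\<delta> / z)\<^sup>2 - 1) \<le> e"
      using redet_zero_asymptotics[OF e] by blast
    have "1 / M > 0" using M by simp
    from dsmall[OF this] eventually_ge_real[of M] dom'[of M] zero show ?thesis
      by eventually_elim (use M(2) branch_squared in \<open>simp add: w_def\<close>)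
  qed
  have wsq: "(\<lambda>n. (w n j)\<^sup>2) \<longlonglongrightarrow> 1" if j: "j \<in> {1, 2}" for j
  proof (rule tendstoI)
    fix e :: real assume "e > 0"
    then have "e / 2 > 0" by simp
    from wclose[OF this] show "\<forall>\<^sub>F n in sequentially. dist ((w n j)\<^sup>2) 1 < e"
      by (rule eventually_mono) (use j \<open>e > 0\<close> in \<open>force simp: dist_norm\<close>)
  qed
  have simple: "\<forall>\<^sub>F n in sequentially. \<forall>j\<in>{1, 2}. simple_eigenvalue q \<beta> (lam n j)"
  proof -
    obtain M where M: "M \<ge> 1" "\<And>n \<delta> u. M \<le> real n \<Longrightarrow> norm \<delta> \<le> 1 / M \<Longrightarrow> M \<le> (real n + 1) * norm \<delta> \<Longrightarrow>
     eigenfunction q \<beta> ((rn n + \<delta>)\<^sup>2) u \<Longrightarrow> simple_eigenvalue q \<beta> ((rn n + \<delta>)\<^sup>2)"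
      using simple_near_rn by blast
    have "1 / M > 0" "(1/2::real) > 0" using M by simp_all
    from dsmall[OF this(1)] wclose[OF this(2)] eventually_ge_real[of M] dom'[of "2 * M"] show ?thesis
    proof eventually_elim
      case (elim n)
      show ?case
      proof
        fix j :: nat assume j: "j \<in> {1, 2}"
        have z0: "norm (branch n) > 0" using elim(4) M(1) by (cases "branch n = 0") auto
        have "norm ((w n j)\<^sup>2 - 1) \<le> 1/2" using elim(2) j by blast
        then have "1/2 \<le> norm ((w n j)\<^sup>2)" using norm_triangle_ineq2[of 1 "1 - (w n j)\<^sup>2"] by (simp add: norm_minus_commute)
        moreover have "(1/2)\<^sup>2 \<le> (1/2 :: real)" by (simp add: power2_eq_square)
        ultimately have "(1/2)\<^sup>2 \<le> (norm (w n j))\<^sup>2" unfolding norm_power by linarith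
        then have "1/2 \<le> norm (w n j)" by (rule power2_le_imp_le) simp
        then have "norm (branch n) / 2 \<le> norm (d n j)" using z0 by (simp add: w_def norm_divide field_simps)
        then have "(real n + 1) * (norm (branch n) / 2) \<le> (real n + 1) * norm (d n j)" by (intro mult_left_mono) auto
        then have "(real n + 1) * norm (branch n) / 2 \<le> (real n + 1) * norm (d n j)" by simp
        then have "M \<le> (real n + 1) * norm (d n j)" using elim(4) by linarith
        then show "simple_eigenvalue q \<beta> (lam n j)" unfolding lam using M(2)[OF elim(3)] elim(1) ef[OF j, of n] j by blast
      qed
    qed
  qed
  then obtain N where N: "\<And>n j. n \<ge> N \<Longrightarrow> j \<in> {1, 2} \<Longrightarrow> simple_eigenvalue q \<beta> (lam n j)"
    unfolding eventually_sequentially by blast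
  then show "\<exists>N. \<forall>n>N. \<forall>j\<in>{1, 2}. simple_eigenvalue q \<beta> (lam n j)" by (meson less_imp_le_nat)

  define S where "S = (\<lambda>n. w n 1 + w n 2)"
  have S0: "S \<longlonglongrightarrow> 0"
  proof -
    obtain K where K: "\<And>n \<delta> \<epsilon>. 6 * qnorm \<le> real n \<Longrightarrow> norm \<delta> \<le> 1/2 \<Longrightarrow> norm \<epsilon> \<le> 1/2 \<Longrightarrow> redet n \<delta> = 0 \<Longrightarrow> redet n \<epsilon> = 0 \<Longrightarrow>
      \<delta> \<noteq> \<epsilon> \<Longrightarrow> (real n + 1) * norm (\<delta> + \<epsilon>) \<le> K"
      using distinct_zeros by blast
    have "(\<lambda>n. K / ((real n + 1) * norm (branch n))) \<longlonglongrightarrow> 0"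
      by (rule tendsto_divide_0[OF tendsto_const filterlim_at_top_imp_at_infinity[OF dom]])
    moreover have "\<forall>\<^sub>F n in sequentially. norm (S n) \<le> K / ((real n + 1) * norm (branch n))"
      using dsmall[of "1/2", simplified] zero simple eventually_ge_real[of "6 * qnorm"] dom'[of 1]
    proof eventually_elim
      case (elim n)
      have z0: "norm (branch n) > 0" using elim(5) by (cases "branch n = 0") auto
      have "lam n 1 \<noteq> lam n 2" using labelled_distinct[OF lab] elim(3) by blast
      then have "d n 1 \<noteq> d n 2" unfolding lam by auto
      then have K': "(real n + 1) * norm (d n 1 + d n 2) \<le> K" using K elim by simp
      have "norm (S n) = (real n + 1) * norm (d n 1 + d n 2) / ((real n + 1) * norm (branch n))"
        using z0 by (simp add: S_def w_def add_divide_distrib[symmetric] norm_divide)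
      also have "\<dots> \<le> K / ((real n + 1) * norm (branch n))" using K' z0 by (intro divide_right_mono) auto
      finally show ?case .
    qed
    ultimately show ?thesis by (rule Lim_null_comparison[rotated])
  qed

  define neg where "neg = (\<lambda>n. Re (w n 1) < 0)"
  define u where "u = (\<lambda>n. if neg n then - w n 1 else w n 1)"
  have u1: "u \<longlonglongrightarrow> 1"
  proof (rule tendsto_1_if_square_tendsto_1)
    have "(\<lambda>n. (u n)\<^sup>2) = (\<lambda>n. (w n 1)\<^sup>2)" by (auto simp: u_def)
    then show "(\<lambda>n. (u n)\<^sup>2) \<longlonglongrightarrow> 1" using wsq[of 1] by simp
  qed (auto simp: u_def neg_def)
  have S0': "(\<lambda>n. if P n then S n else 0) \<longlonglongrightarrow> 0" for P
    by (rule Lim_null_comparison[OF always_eventually tendsto_norm_zero[OF S0]]) auto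
  define \<sigma> where "\<sigma> = (\<lambda>n j. if neg n then j else 3 - j :: nat)"
  have bij: "bij_betw (\<sigma> n) {1, 2} {1, 2}" for n
    by (auto simp: \<sigma>_def bij_betw_def inj_on_def)
  have ws: "(\<lambda>n. (-1) ^ j * w n (\<sigma> n j)) \<longlonglongrightarrow> 1" if j: "j \<in> {1, 2}" for j
  proof -
    have "(\<lambda>n. (-1) ^ 1 * w n (\<sigma> n 1)) = (\<lambda>n. u n - (if \<not> neg n then S n else 0))"
      by (auto simp: \<sigma>_def u_def S_def fun_eq_iff numeral_2_eq_2)
    moreover have "(\<lambda>n. (-1) ^ 2 * w n (\<sigma> n 2)) = (\<lambda>n. u n + (if neg n then S n else 0))"
      by (auto simp: \<sigma>_def u_def S_def fun_eq_iff)
    ultimately show ?thesis using j tendsto_diff[OF u1 S0'] tendsto_add[OF u1 S0'] by auto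
  qed
  define x where "x = (\<lambda>n j. d n j / (2 * rn n))"
  have x0: "(\<lambda>n. x n (\<sigma> n j)) \<longlonglongrightarrow> 0" if j: "j \<in> {1, 2}" for j
  proof (rule Lim_null_comparison[OF always_eventually], intro allI)
    have "(\<lambda>n. norm (d n 1) + norm (d n 2)) \<longlonglongrightarrow> 0 + 0"
      by (intro tendsto_add tendsto_norm_zero d0) auto
    then show "(\<lambda>n. norm (d n 1) + norm (d n 2)) \<longlonglongrightarrow> 0" by simp
    fix n
    have "norm (x n (\<sigma> n j)) \<le> norm (d n (\<sigma> n j)) / 1"
      unfolding x_def norm_divide using rn_lower[of n] by (intro divide_left_mono) (auto simp: norm_mult norm_rn)
    also have "\<sigma> n j = 1 \<or> \<sigma> n j = 2" using j by (auto simp: \<sigma>_def)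
    then have "norm (d n (\<sigma> n j)) / 1 \<le> norm (d n 1) + norm (d n 2)" by auto
    finally show "norm (x n (\<sigma> n j)) \<le> norm (d n 1) + norm (d n 2)" .
  qed
  have "\<exists>r. r \<longlonglongrightarrow> 0 \<and> (\<forall>\<^sub>F n in sequentially. lam n (\<sigma> n j) =
        of_real (((2 * real n + 1) * pi)\<^sup>2) + (-1) ^ j * (csqrt (2 * gamma2 \<beta>) / 2)
            * csqrt (of_nat (2 * n + 1) * sine_coeff q (2 * n + 1)) * (1 + r n))" if j: "j \<in> {1, 2}" for j
  proof (intro exI conjI)
    let ?r = "\<lambda>n. (-1) ^ j * w n (\<sigma> n j) * (1 + x n (\<sigma> n j)) - 1"
    have "?r \<longlonglongrightarrow> 1 * (1 + 0) - 1" by (intro tendsto_intros ws x0 j)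
    then show "?r \<longlonglongrightarrow> 0" by simp
    show "\<forall>\<^sub>F n in sequentially. lam n (\<sigma> n j) =
        of_real (((2 * real n + 1) * pi)\<^sup>2) + (-1) ^ j * (csqrt (2 * gamma2 \<beta>) / 2)
            * csqrt (of_nat (2 * n + 1) * sine_coeff q (2 * n + 1)) * (1 + ?r n)"
      using dom'[of 1]
    proof eventually_elim
      case (elim n)
      have z0: "branch n \<noteq> 0" using elim by auto
      define D where "D = csqrt (2 * gamma2 \<beta>) / 2 * csqrt (of_nat (2 * n + 1) * sine_coeff q (2 * n + 1))"
      have D: "D = 2 * rn n * branch n" using rn_nonzero[of n] by (simp add: branch_def D_def)
      have sgn: "(-1) ^ j * ((-1) ^ j :: complex) = 1" by (simp add: power_mult_distrib[symmetric])
      define k where "k = \<sigma> n j"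
      have "D * (w n k * (1 + x n k)) = 2 * rn n * d n k + d n k * d n k"
        unfolding D w_def x_def using z0 rn_nonzero[of n] by (simp add: field_simps)
      then have "lam n k = (rn n)\<^sup>2 + D * (w n k * (1 + x n k))" unfolding lam by (simp add: power2_eq_square algebra_simps)
      also have "D * (w n k * (1 + x n k)) = ((-1) ^ j * (-1) ^ j) * (D * (w n k * (1 + x n k)))" by (simp only: sgn mult_1_left)
      also have "\<dots> = (-1) ^ j * D * (1 + ((-1) ^ j * w n k * (1 + x n k) - 1))" by (simp only: mult_ac add_diff_cancel_left' add_diff_eq)
      finally show ?case unfolding rn_squared D_def k_def by (simp only: mult.assoc)
    qed
  qed
  then show ?formula
    using bij by (intro exI[of _ \<sigma>]) blast
qed

text \<open>The normalization forces \<open>\<bar>a\<bar>\<close> to be close to \<open>sqrt 2\<close>; the factor \<open>c = \<bar>a\<bar> / a\<close> removes the phase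
  of \<open>a\<close>.\<close>
lemma normalized_near_cos:
  assumes y: "continuous_on {0..1} y" and norm: "l2_norm y = 1"
    and near: "\<And>x. x \<in> {0..1} \<Longrightarrow> norm (y x - a * cos (rn n * of_real x)) \<le> \<kappa> * norm a"
    and \<kappa>: "0 \<le> \<kappa>" "\<kappa> \<le> 1 / 12" and a: "a \<noteq> 0"
  shows "\<exists>c. norm c = 1 \<and> (\<forall>x\<in>{0..1}. norm (c * y x - of_real (sqrt 2 * cos ((2 * real n + 1) * pi * x))) \<le> 26 * \<kappa>)"
proof -
  define A where "A = norm a"
  have A0: "A > 0" using a by (simp add: A_def)
  have 1: "\<bar>1 - A\<^sup>2 / 2\<bar> \<le> 3 * \<kappa> * A\<^sup>2"
    using l2_norm_near_cos[OF y near] \<kappa> norm by (simp add: A_def)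
  moreover have "3 * \<kappa> * A\<^sup>2 \<le> 1/4 * A\<^sup>2" using \<kappa> by (intro mult_right_mono) auto
  ultimately have A4: "A\<^sup>2 \<le> 2\<^sup>2" by simp
  then have A2: "A \<le> 2" by (rule power2_le_imp_le) simp
  have "\<bar>A\<^sup>2 - 2\<bar> \<le> 24 * \<kappa>"
  proof -
    have "\<bar>A\<^sup>2 - 2\<bar> \<le> 6 * \<kappa> * A\<^sup>2" using 1 by linarith
    also have "\<dots> \<le> 6 * \<kappa> * 4" using A4 \<kappa> by (intro mult_left_mono) auto
    finally show ?thesis by simp
  qed
  moreover have "\<bar>A - sqrt 2\<bar> * 1 \<le> \<bar>A - sqrt 2\<bar> * (A + sqrt 2)"
  proof (rule mult_left_mono)
    have "1 \<le> sqrt (2::real)" by (rule real_le_rsqrt) simp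
    then show "1 \<le> A + sqrt 2" using A0 by linarith
  qed simp
  moreover have "\<bar>A - sqrt 2\<bar> * (A + sqrt 2) = \<bar>A\<^sup>2 - 2\<bar>"
  proof -
    have "A\<^sup>2 - 2 = (A - sqrt 2) * (A + sqrt 2)" by (simp add: algebra_simps power2_eq_square)
    then show ?thesis using A0 by (simp add: abs_mult)
  qed
  ultimately have As: "\<bar>A - sqrt 2\<bar> \<le> 24 * \<kappa>" by (simp only: mult_1_right)
  define c where "c = of_real A / a"
  have c1: "norm c = 1" using a by (simp add: c_def norm_divide A_def)
  have "norm (c * y x - of_real (sqrt 2 * cos ((2 * real n + 1) * pi * x))) \<le> 26 * \<kappa>" if x: "x \<in> {0..1}" for x
  proof -
    let ?c = "cos ((2 * real n + 1) * pi * x)"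
    have "c * y x - of_real (sqrt 2 * ?c) = c * (y x - a * cos (rn n * of_real x)) + of_real ((A - sqrt 2) * ?c)"
      using a unfolding cos_rn_of_real by (simp add: c_def algebra_simps)
    also have "norm \<dots> \<le> \<kappa> * A + 24 * \<kappa>"
    proof (rule norm_triangle_mono)
      show "norm (c * (y x - a * cos (rn n * of_real x))) \<le> \<kappa> * A" using near[OF x] by (simp add: norm_mult c1 A_def)
      have "\<bar>A - sqrt 2\<bar> * \<bar>?c\<bar> \<le> (24 * \<kappa>) * 1" using As \<kappa> by (intro mult_mono abs_cos_le_one) auto
      then show "norm (of_real ((A - sqrt 2) * ?c) :: complex) \<le> 24 * \<kappa>" unfolding norm_of_real abs_mult by simp
    qed
    also have "\<dots> \<le> \<kappa> * 2 + 24 * \<kappa>" using A2 \<kappa> by (intro add_mono mult_left_mono) auto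
    finally show ?thesis by simp
  qed
  then show ?thesis using c1 by blast
qed

lemma labelled_eigenfunction_asymptotics:
  assumes lab: "eigenvalue_labelling q \<beta> lam"
  shows "\<exists>C N. \<forall>n\<ge>N. \<forall>j\<in>{1, 2}. \<forall>\<Psi>.
            eigenfunction q \<beta> (lam n j) \<Psi> \<and> l2_norm \<Psi> = 1 \<longrightarrow>
            (\<exists>c. norm c = 1 \<and>
                 (\<forall>x\<in>{0..1}. norm (c * \<Psi> x - of_real (sqrt 2 * cos ((2 * real n + 1) * pi * x)))
                                \<le> C * real n powr (-1/2)))"
proof -
  obtain C where C: "C \<ge> 0" "\<forall>\<^sub>F n in sequentially. \<forall>j\<in>{1, 2}. norm (csqrt (lam n j) - rn n) \<le> C * real n powr (-1/2)"
    using labelled_shift[OF lab] by blast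
  obtain M K where M: "M \<ge> 1" and K: "K \<ge> 0" and near: "\<And>n \<delta>. M \<le> real n \<Longrightarrow> norm \<delta> \<le> 1 / M \<Longrightarrow>
     admissible (rn n + \<delta>) \<and> m22 (rn n + \<delta>) \<noteq> 0 \<and>
     (\<forall>y. eigenfunction q \<beta> ((rn n + \<delta>)\<^sup>2) y \<longrightarrow>
        (\<forall>x\<in>{0..1}. norm (y x - y 0 * cos (rn n * of_real x)) \<le> K * (norm \<delta> + 1 / (real n + 1)) * norm (y 0)))"
    using eigenfunction_near_cos by blast
  define L where "L = K * (C + 1)"
  have L0: "L \<ge> 0" using K C(1) by (simp add: L_def)
  have ev: "\<forall>\<^sub>F n in sequentially. C * real n powr (-1/2) < 1 / M" "\<forall>\<^sub>F n in sequentially. L * real n powr (-1/2) < 1 / 12"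
    by (rule order_tendstoD(2)[OF powr_tendsto_0]; use M in simp)+
  have "\<forall>\<^sub>F n in sequentially. \<forall>j\<in>{1, 2}. \<forall>\<Psi>.
            eigenfunction q \<beta> (lam n j) \<Psi> \<and> l2_norm \<Psi> = 1 \<longrightarrow>
            (\<exists>c. norm c = 1 \<and>
                 (\<forall>x\<in>{0..1}. norm (c * \<Psi> x - of_real (sqrt 2 * cos ((2 * real n + 1) * pi * x)))
                                \<le> (26 * L) * real n powr (-1/2)))"
    using C(2) ev eventually_ge_real[of M]
  proof eventually_elim
    case (elim n)
    define p where "p = real n powr (-1/2)"
    have n1: "real n \<ge> 1" using elim(4) M by linarith
    have p: "1 / (real n + 1) \<le> p"
    proof -
      have "1 / (real n + 1) \<le> 1 / real n" using n1 by (intro divide_left_mono) auto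
      also have "\<dots> = real n powr (-1)" using n1 by (simp add: powr_minus_divide)
      also have "\<dots> \<le> p" unfolding p_def using n1 by (intro powr_mono) auto
      finally show ?thesis .
    qed
    show ?case
    proof (intro ballI allI impI)
      fix j :: nat and \<Psi> assume j: "j \<in> {1, 2}" and \<Psi>: "eigenfunction q \<beta> (lam n j) \<Psi> \<and> l2_norm \<Psi> = 1"
      define \<delta> where "\<delta> = csqrt (lam n j) - rn n"
      have lam: "lam n j = (rn n + \<delta>)\<^sup>2" by (simp add: \<delta>_def)
      have \<delta>: "norm \<delta> \<le> C * p" using elim(1) j unfolding \<delta>_def p_def by blast
      then have "norm \<delta> \<le> 1 / M" using elim(2) by (simp add: p_def)
      note nr = near[OF elim(4) this]
      have e: "eigenfunction q \<beta> ((rn n + \<delta>)\<^sup>2) \<Psi>" using \<Psi> by (simp add: lam)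
      have "\<exists>c. norm c = 1 \<and> (\<forall>x\<in>{0..1}. norm (c * \<Psi> x - of_real (sqrt 2 * cos ((2 * real n + 1) * pi * x))) \<le> 26 * (L * p))"
      proof (rule normalized_near_cos)
        show "continuous_on {0..1} \<Psi>" by (rule eigenfunction_continuous[OF e])
        show "\<Psi> 0 \<noteq> 0" using eigenfunction_0_nonzero nr e by blast
        show "0 \<le> L * p" "L * p \<le> 1 / 12" using L0 elim(3) by (auto simp: p_def)
        fix x :: real assume x: "x \<in> {0..1}"
        have "norm (\<Psi> x - \<Psi> 0 * cos (rn n * of_real x)) \<le> K * (norm \<delta> + 1 / (real n + 1)) * norm (\<Psi> 0)"
          using nr e x by blast
        also have "\<dots> \<le> K * (C * p + p) * norm (\<Psi> 0)"
          using \<delta> p K by (intro mult_right_mono mult_left_mono add_mono) auto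
        also have "K * (C * p + p) = L * p" by (simp add: L_def algebra_simps)
        finally show "norm (\<Psi> x - \<Psi> 0 * cos (rn n * of_real x)) \<le> L * p * norm (\<Psi> 0)" .
      qed (use \<Psi> in blast)
      then show "\<exists>c. norm c = 1 \<and> (\<forall>x\<in>{0..1}. norm (c * \<Psi> x - of_real (sqrt 2 * cos ((2 * real n + 1) * pi * x)))
                                \<le> (26 * L) * real n powr (-1/2))"
        unfolding p_def mult.assoc .
    qed
  qed
  then show ?thesis unfolding eventually_sequentially by blast
qed

end

theorem theorem4:
  fixes q :: "real \<Rightarrow> complex" and \<beta> :: complex
  assumes q_integrable: "integrable leb01 q"
    and q_mean: "(LINT x|leb01. q x) = 0"
    and beta: "\<beta> \<noteq> 1" "\<beta> \<noteq> -1"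
  shows
    "(\<forall>lam. eigenvalue_labelling q \<beta> lam \<longrightarrow> log_over_sine_coeff_tendsto_0 q (\<lambda>n. n) \<longrightarrow>
        (\<exists>N. \<forall>n>N. \<forall>j\<in>{1, 2}. simple_eigenvalue q \<beta> (lam n j)) \<and>
        (\<exists>\<sigma>. (\<forall>n. bij_betw (\<sigma> n) {1, 2} {1, 2}) \<and>
             (\<forall>j\<in>{1, 2}. \<exists>r. r \<longlonglongrightarrow> 0 \<and>
                (\<forall>\<^sub>F n in sequentially.
                   lam n (\<sigma> n j) =
                     of_real (((2 * real n + 1) * pi)\<^sup>2)
                     + (-1) ^ j * (csqrt (2 * gamma2 \<beta>) / 2)
                       * csqrt (of_nat (2 * n + 1) * sine_coeff q (2 * n + 1)) * (1 + r n)))) \<and>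
        (\<exists>C N. \<forall>n\<ge>N. \<forall>j\<in>{1, 2}. \<forall>\<Psi>.
            eigenfunction q \<beta> (lam n j) \<Psi> \<and> l2_norm \<Psi> = 1 \<longrightarrow>
            (\<exists>c. norm c = 1 \<and>
                 (\<forall>x\<in>{0..1}. norm (c * \<Psi> x - of_real (sqrt 2 * cos ((2 * real n + 1) * pi * x)))
                                \<le> C * real n powr (-1/2)))))
     \<and>
     (\<forall>m :: nat \<Rightarrow> nat.
        (\<forall>k. 0 < m k) \<longrightarrow> filterlim m at_top sequentially \<longrightarrow>
        log_over_sine_coeff_tendsto_0 q m \<longrightarrow>
        \<not> root_functions_form_riesz_basis q \<beta>)"
proof -
  interpret nondegenerate_problem q \<beta>
    by unfold_locales (use q_integrable beta in \<open>simp_all add: integrable_leb01_iff\<close>)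
  show ?thesis
    by (intro conjI allI impI labelled_eigenvalue_asymptotics labelled_eigenfunction_asymptotics not_riesz_basis)
qed

end
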